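(* Let $t\ge 1$, $k\ge 3$, $1 \le \ell < k$ be integers and $n> (t+1)(k-t+1)$. Suppose that $\mathcal{H} \subset \binom{[n]}{k}$ is $t$-intersecting and \[ |\mathcal{H}| = m > m(n,k,t) = \begin{cases} \max\left\{|AK(n,k,t)|,|EM(n,k,t+2,t+1)|\right\}, & \text{if } t < \frac{k-1}{2}, \\ |EM(n,k,t+2,t+1)|, & \text{if } t \ge \frac{k-1}{2}. \end{cases} \] Then $|\partial_{\ell}\mathcal{H}|\ge |\partial_{\ell} L_{m}EM(n,k,t,t)|$. In particular, if $|\mathcal{H}| = \binom{x-t}{k-t} > m(n,k,t)$ for some real number $x$, then $|\partial_{\ell}\mathcal{H}|\ge \sum_{i= t-\ell}^{k-\ell}\binom{t}{i}\binom{x-t}{k-\ell-i}$.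
   Context: $[n]=\{1,\dots,n\}$, $\binom{[n]}{k}$ is the family of $k$-subsets of $[n]$. A family is $t$-intersecting if every two members share at least $t$ elements. For $\mathcal{H}\subset\binom{[n]}{k}$, $\partial_\ell\mathcal{H}=\{A\in\binom{[n]}{k-\ell}: A\subset B\text{ for some }B\in\mathcal{H}\}$. Colex order on $\binom{[n]}{k}$: $A\prec B$ iff $\max\big((A\setminus B)\cup(B\setminus A)\big)\in B$; for $\mathcal{F}\subset\binom{[n]}{k}$ and $m\le|\mathcal{F}|$, $L_m\mathcal{F}$ is the set of the first $m$ members of $\mathcal{F}$ in colex order. For $0\le t\le\min\{k,s\}$, $EM(n,k,s,t)=\{A\in\binom{[n]}{k}: |A\cap[s]|\ge t\}$; $EM(n,k,s,t)=\emptyset$ if $t>\min\{k,s\}$, and $EM(n,k,s,t)=\binom{[n]}{k}$ if $n\le s$. $AK(n,k,t)=\{A\in\binom{[n]}{k}: [t]\subset A \text{ and } \{t+1,\dots,k+1\}\cap A\ne\emptyset\}\cup\{[k+1]\setminus\{i\}: i\in[t]\}$. For real $y$ and integer $b\ge0$, $\binom{y}{b}=y(y-1)\cdots(y-b+1)/b!$; for integers, $\binom{a}{b}=0$ if $b<0$ or $a<b$, and $\binom{a}{0}=1$ for $a\ge0$. *)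

theory Defs
  imports Complex_Main
begin

definition ksets :: "nat \<Rightarrow> nat \<Rightarrow> nat set set" where
  "ksets n k = {A. A \<subseteq> {1..n} \<and> card A = k}"

definition t_intersecting :: "nat \<Rightarrow> nat set set \<Rightarrow> bool" where
  "t_intersecting t F \<longleftrightarrow> (\<forall>A\<in>F. \<forall>B\<in>F. card (A \<inter> B) \<ge> t)"

definition shadow :: "nat \<Rightarrow> nat \<Rightarrow> nat \<Rightarrow> nat set set \<Rightarrow> nat set set" where
  "shadow n k l H = {A \<in> ksets n (k - l). \<exists>B\<in>H. A \<subseteq> B}"

definition colex_less :: "nat set \<Rightarrow> nat set \<Rightarrow> bool" where
  "colex_less A B \<longleftrightarrow> A \<noteq> B \<and> Max ((A - B) \<union> (B - A)) \<in> B"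

definition Lcolex :: "nat \<Rightarrow> nat set set \<Rightarrow> nat set set" where
  "Lcolex m F = {A \<in> F. card {B \<in> F. colex_less B A} < m}"

definition EM :: "nat \<Rightarrow> nat \<Rightarrow> nat \<Rightarrow> nat \<Rightarrow> nat set set" where
  "EM n k s t = (if t > min k s then {}
                 else if n \<le> s then ksets n k
                 else {A \<in> ksets n k. card (A \<inter> {1..s}) \<ge> t})"

definition AK :: "nat \<Rightarrow> nat \<Rightarrow> nat \<Rightarrow> nat set set" where
  "AK n k t = {A \<in> ksets n k. {1..t} \<subseteq> A \<and> {t+1..k+1} \<inter> A \<noteq> {}}
              \<union> {{1..k+1} - {i} | i. i \<in> {1..t}}"

definition mnkt :: "nat \<Rightarrow> nat \<Rightarrow> nat \<Rightarrow> nat" where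
  "mnkt n k t = (if real t < (real k - 1) / 2
                 then max (card (AK n k t)) (card (EM n k (t+2) (t+1)))
                 else card (EM n k (t+2) (t+1)))"

end

theory Submission
  imports Defs
begin

text \<open>The Ahlswede--Khachatrian theorem bounds nontrivial \<open>t\<close>-intersecting families by \<open>m(n,k,t)\<close>, so
  all members of \<open>H\<close> share a \<open>t\<close>-set \<open>T\<close>. The shadow then splits according to the trace on \<open>T\<close>,
  \<open>|\<partial>\<^sub>\<ell> H| = \<Sum>\<^sub>i (t choose i) |shad (k - \<ell> - i) G|\<close> with \<open>G = {A - T | A \<in> H}\<close>, and each summand is
  estimated by Kruskal--Katona, or by Lovasz's form of it.

  For the nontrivial intersection theorem take an extremal family. If some shift makes it trivial,
  it is essentially a Hilton--Milner family, and an inequality for cross-intersecting families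
  applies. Otherwise it may be assumed compressed and is described by minimal generating sets in
  \<open>{1..s}\<close> with \<open>s\<close> minimal. If \<open>s > t + 2\<close>, deleting \<open>s\<close> from the generators of one size, while
  discarding those of the complementary size, keeps the family \<open>t\<close>-intersecting, and one of the two
  ways of doing so enlarges it. The only obstruction is that the new family is trivial, which forces
  the shape of the family; its size is maximal at an endpoint \<open>s = t + 2\<close> or \<open>s = k + 1\<close>.\<close>

section \<open>Shifting and shadows\<close>

text \<open>Complementary sizes have sum \<open>s + t\<close>: two generators through
  \<open>s\<close> with exactly \<open>t\<close> common elements must cover \<open>{1..s}\<close>,
  and only such pairs resist the deletion of \<open>s\<close>. If for distinct sizes
  \<open>i\<close> and \<open>j\<close> neither choice gained anything, the two inequalities could
  be multiplied; the class sizes cancel and a false inequality between products of binomials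
  remains. For \<open>i = j\<close> the two classes coincide, so only a part of the class is pushed,
  and there the bound on \<open>n\<close> enters at full strength. As a function of
  \<open>s\<close>, the size of the exceptional shape keeps rising once it has risen. The shapes at
  the two endpoints lie in \<open>EM\<close> and \<open>AK\<close>, whence the maximum in
  \<open>mnkt\<close>. Several levels of the shadow of \<open>G\<close> occur in one sum, so the
  comparison family has to be optimal at all of them simultaneously. Colex initial segments are, and
  removing \<open>{1..t}\<close> from the first \<open>m\<close> sets of the star leaves such a
  segment. Kruskal--Katona is therefore proved as a comparison with a given segment at every level
  \<open>b\<close>, by induction on the ground set and without cascade expansions.\<close>

lemma card_trace:
  assumes "finite V" "S \<subseteq> V" "E \<subseteq> S" "card E \<le> k"
  shows "card {A. A \<subseteq> V \<and> card A = k \<and> A \<inter> S = E} = (card V - card S) choose (k - card E)"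
proof -
  have fin: "finite A" if "A \<subseteq> V" for A
    using that assms(1) finite_subset by blast
  let ?X = "{B. B \<subseteq> V - S \<and> card B = k - card E}"
  let ?Y = "{A. A \<subseteq> V \<and> card A = k \<and> A \<inter> S = E}"
  have 1: "B \<union> E \<in> ?Y" if B: "B \<in> ?X" for B
  proof -
    have "card (B \<union> E) = card B + card E"
      using assms(2,3) B fin[of B] fin[of E] by (intro card_Un_disjoint) auto
    then show ?thesis
      using B assms by auto
  qed
  have 2: "A - S \<in> ?X" if A: "A \<in> ?Y" for A
  proof -
    have "card (A - S) = card A - card (A \<inter> S)"
      using A fin[of A] by (intro card_Diff_subset_Int) auto
    then show ?thesis
      using A by auto
  qed
  have "bij_betw (\<lambda>B. B \<union> E) ?X ?Y"
  proof (rule bij_betw_byWitness[where f' = "\<lambda>A. A - S"])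
    show "\<forall>B\<in>?X. B \<union> E - S = B" "\<forall>A\<in>?Y. A - S \<union> E = A"
      using assms(3) by blast+
    show "(\<lambda>B. B \<union> E) ` ?X \<subseteq> ?Y" "(\<lambda>A. A - S) ` ?Y \<subseteq> ?X"
      by (intro image_subsetI 1 2; assumption)+
  qed
  then have "card ?Y = card ?X"
    by (simp add: bij_betw_same_card)
  also have "\<dots> = card (V - S) choose (k - card E)"
    using assms(1) by (intro n_subsets) auto
  also have "card (V - S) = card V - card S"
    using assms(2) fin[of S] by (intro card_Diff_subset) auto
  finally show ?thesis .
qed

lemma card_swap:
  assumes "finite B" "i \<in> B" "j \<notin> B"
  shows "card (insert j (B - {i})) = card B"
  using card_Suc_Diff1[OF assms(1,2)] assms by (subst card_insert_disjoint) auto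

definition shift_set :: "'a \<Rightarrow> 'a \<Rightarrow> 'a set set \<Rightarrow> 'a set \<Rightarrow> 'a set" where
  "shift_set i j F A =
     (if j \<in> A \<and> i \<notin> A \<and> insert i (A - {j}) \<notin> F then insert i (A - {j}) else A)"

definition shift :: "'a \<Rightarrow> 'a \<Rightarrow> 'a set set \<Rightarrow> 'a set set" where
  "shift i j F = shift_set i j F ` F"

text \<open>Both orientations occur: \<open>stable v j\<close> for all \<open>j\<close> says that
  the family is pushed towards \<open>v\<close>, as for shadows; \<open>stable i v\<close> for all
  \<open>i\<close> says that it is pushed away from \<open>v\<close>, as for cross-intersecting
  families.\<close>

definition stable :: "'a \<Rightarrow> 'a \<Rightarrow> 'a set set \<Rightarrow> bool" where
  "stable i j F \<longleftrightarrow> (\<forall>A\<in>F. j \<in> A \<and> i \<notin> A \<longrightarrow> insert i (A - {j}) \<in> F)"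

lemma stableD: "stable i j F \<Longrightarrow> A \<in> F \<Longrightarrow> j \<in> A \<Longrightarrow> i \<notin> A \<Longrightarrow> insert i (A - {j}) \<in> F"
  by (auto simp: stable_def)

text \<open>A replacement can be undone, and a replaced set lies outside \<open>F\<close> while a
  fixed one lies in \<open>F\<close>, so the two kinds of images never collide.\<close>

lemma inj_on_shift_set: "inj_on (shift_set i j F) F"
proof (rule inj_onI)
  fix A B assume AB: "A \<in> F" "B \<in> F" and eq: "shift_set i j F A = shift_set i j F B"
  have undo: "insert j (insert i (X - {j}) - {i}) = X" if "j \<in> X" "i \<notin> X" for X :: "'a set"
    using that by blast
  define moves where "moves X \<longleftrightarrow> j \<in> X \<and> i \<notin> X \<and> insert i (X - {j}) \<notin> F" for X
  have sh: "shift_set i j F X = (if moves X then insert i (X - {j}) else X)" for X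
    by (simp add: shift_set_def moves_def)
  consider "moves A" "moves B" | "moves A" "\<not> moves B" | "\<not> moves A" "moves B"
    | "\<not> moves A" "\<not> moves B"
    by blast
  then show "A = B"
  proof cases
    case 1
    then have "insert i (A - {j}) = insert i (B - {j})"
      using eq by (simp add: sh)
    then have "insert j (insert i (A - {j}) - {i}) = insert j (insert i (B - {j}) - {i})"
      by simp
    then show ?thesis
      using undo[of A] undo[of B] 1 unfolding moves_def by blast
  next
    case 2
    then have "insert i (A - {j}) = B"
      using eq by (simp add: sh)
    then show ?thesis using 2 AB by (simp add: moves_def)
  next
    case 3
    then have "A = insert i (B - {j})"
      using eq by (simp add: sh)
    then show ?thesis using 3 AB by (simp add: moves_def)
  next
    case 4
    then show ?thesis
      using eq by (simp add: sh)
  qed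
qed

lemma card_shift [simp]: "card (shift i j F) = card F"
  unfolding shift_def by (rule card_image[OF inj_on_shift_set])

lemma finite_shift [simp]: "finite F \<Longrightarrow> finite (shift i j F)"
  by (simp add: shift_def)

lemma shift_cases:
  assumes "B \<in> shift i j F"
  obtains (old) "B \<in> F" "j \<in> B \<Longrightarrow> i \<notin> B \<Longrightarrow> insert i (B - {j}) \<in> F"
    | (moved) "i \<in> B" "j \<notin> B" "insert j (B - {i}) \<in> F" "B \<notin> F"
proof -
  from assms obtain A where A: "A \<in> F" "B = shift_set i j F A"
    by (auto simp: shift_def)
  show thesis
  proof (cases "j \<in> A \<and> i \<notin> A \<and> insert i (A - {j}) \<notin> F")
    case True
    then have "insert j (B - {i}) = A" and "B = insert i (A - {j})"
      using A by (auto simp: shift_set_def)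
    then show ?thesis
      using moved True A by auto
  next
    case False
    then have "B = A"
      using A by (auto simp: shift_set_def)
    then show ?thesis
      using old False A by auto
  qed
qed

lemma shift_oldI:
  assumes "B \<in> F" "j \<in> B \<Longrightarrow> i \<notin> B \<Longrightarrow> insert i (B - {j}) \<in> F"
  shows "B \<in> shift i j F"
proof -
  have "shift_set i j F B = B"
    using assms by (auto simp: shift_set_def)
  then show ?thesis
    using assms(1) unfolding shift_def by force
qed

lemma shift_movedI:
  assumes "i \<in> B" "j \<notin> B" "insert j (B - {i}) \<in> F"
  shows "B \<in> shift i j F"
proof (cases "B \<in> F")
  case True
  then show ?thesis using assms by (intro shift_oldI) auto
next
  case False
  have "insert i (insert j (B - {i}) - {j}) = B"
    using assms by auto
  then have "shift_set i j F (insert j (B - {i})) = B"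
    using assms False by (auto simp: shift_set_def)
  then show ?thesis
    using assms(3) unfolding shift_def by force
qed

lemma shift_uniform:
  assumes F: "F \<subseteq> {A. A \<subseteq> V \<and> card A = k}" and V: "finite V" "i \<in> V"
  shows "shift i j F \<subseteq> {A. A \<subseteq> V \<and> card A = k}"
proof
  fix B assume "B \<in> shift i j F"
  then show "B \<in> {A. A \<subseteq> V \<and> card A = k}"
  proof (cases rule: shift_cases)
    case old
    then show ?thesis using F by auto
  next
    case moved
    then have *: "insert j (B - {i}) \<subseteq> V" "card (insert j (B - {i})) = k"
      using F by auto
    have "finite (insert j (B - {i}))"
      by (rule finite_subset[OF *(1) V(1)])
    then have "finite B"
      by simp
    then have "card (insert j (B - {i})) = card B"
      using moved by (intro card_swap)
    moreover have "B \<subseteq> V"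
      using *(1) V(2) by blast
    ultimately show ?thesis
      using *(2) by simp
  qed
qed

text \<open>Two families are allowed so that one proof covers intersecting and cross-intersecting
  families. The critical case is a moved \<open>A\<close> against an unmoved \<open>B\<close> that
  contains \<open>j\<close> but not \<open>i\<close>: \<open>B\<close> stayed because its
  replacement is already in \<open>G\<close>, and this replacement meets the preimage of
  \<open>A\<close> exactly in \<open>A \<inter> B\<close>.\<close>

lemma cross_intersecting_shift:
  assumes FG: "\<And>A B. A \<in> F \<Longrightarrow> B \<in> G \<Longrightarrow> t \<le> card (A \<inter> B)"
    and fin: "\<And>A. A \<in> F \<union> G \<Longrightarrow> finite A"
    and ij: "i \<noteq> j"
    and A: "A \<in> shift i j F" and B: "B \<in> shift i j G"
  shows "t \<le> card (A \<inter> B)"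
proof -
  have main: "t \<le> card (A \<inter> B)"
    if FG: "\<And>A B. A \<in> F \<Longrightarrow> B \<in> G \<Longrightarrow> t \<le> card (A \<inter> B)"
      and fin: "\<And>A. A \<in> F \<Longrightarrow> finite A"
      and A: "i \<in> A" "j \<notin> A" "insert j (A - {i}) \<in> F"
      and B: "B \<in> G" "j \<in> B \<Longrightarrow> i \<notin> B \<Longrightarrow> insert i (B - {j}) \<in> G"
    for F G :: "'a set set" and A B
  proof -
    let ?A = "insert j (A - {i})"
    have finA: "finite A"
      using fin[OF A(3)] by auto
    show ?thesis
    proof (cases "i \<in> B")
      case True
      have "?A \<inter> B \<subseteq> insert j (A \<inter> B - {i})"
        by auto
      then have "card (?A \<inter> B) \<le> card (insert j (A \<inter> B - {i}))"
        using finA by (intro card_mono) auto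
      also have "\<dots> = card (A \<inter> B)"
        using A True finA by (intro card_swap) auto
      finally show ?thesis
        using FG[OF A(3) B(1)] by simp
    next
      case i: False
      show ?thesis
      proof (cases "j \<in> B")
        case True
        then have "t \<le> card (?A \<inter> insert i (B - {j}))"
          using FG[OF A(3)] B(2) i by auto
        moreover have "?A \<inter> insert i (B - {j}) = A \<inter> B"
          using A i ij by auto
        ultimately show ?thesis by simp
      next
        case False
        then have "?A \<inter> B = A \<inter> B"
          using i by auto
        then show ?thesis
          using FG[OF A(3) B(1)] by simp
      qed
    qed
  qed
  show ?thesis
    using A
  proof (cases rule: shift_cases)
    case A: old
    show ?thesis
      using B
    proof (cases rule: shift_cases)
      case old
      then show ?thesis using FG A by auto
    next
      case moved
      have "t \<le> card (B \<inter> A)"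
      proof (rule main[of G F])
        show "t \<le> card (Y \<inter> X)" if "Y \<in> G" "X \<in> F" for X Y
          using FG[OF that(2,1)] by (simp add: Int_commute)
      qed (use fin moved A in auto)
      then show ?thesis by (simp add: Int_commute)
    qed
  next
    case A: moved
    show ?thesis
      using B
    proof (cases rule: shift_cases)
      case old
      show ?thesis
        by (rule main[of F G, OF FG]) (use fin old A in auto)
    next
      case moved
      have "finite A"
        using fin[of "insert j (A - {i})"] A by auto
      moreover have "insert j (A - {i}) \<inter> insert j (B - {i}) = insert j (A \<inter> B - {i})"
        using A moved by auto
      ultimately have "card (insert j (A - {i}) \<inter> insert j (B - {i})) = card (A \<inter> B)"
        using A moved card_swap[of "A \<inter> B" i j] by simp
      then show ?thesis
        using FG[OF A(3) moved(3)] by simp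
    qed
  qed
qed

text \<open>The index is the size of the subsets, not the number of deleted elements, which suits
  the recursion in \<open>b\<close> below. Infinite sets have \<open>card\<close> 0 and are excluded
  explicitly.\<close>

definition shad :: "nat \<Rightarrow> 'a set set \<Rightarrow> 'a set set" where
  "shad b F = {B. finite B \<and> card B = b \<and> (\<exists>A\<in>F. B \<subseteq> A)}"

lemma shadI: "finite B \<Longrightarrow> card B = b \<Longrightarrow> A \<in> F \<Longrightarrow> B \<subseteq> A \<Longrightarrow> B \<in> shad b F"
  by (auto simp: shad_def)

lemma shad_subset: "F \<subseteq> Pow V \<Longrightarrow> shad b F \<subseteq> Pow V"
  by (auto simp: shad_def)

lemma finite_shad:
  assumes "finite V" "F \<subseteq> Pow V"
  shows "finite (shad b F)"
  by (rule finite_subset[OF shad_subset[OF assms(2)]]) (simp add: assms)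

text \<open>If \<open>B\<close> lies below a set \<open>A\<close> that stayed in place, the
  replacement of \<open>B\<close> lies below \<open>A\<close> when \<open>i \<in> A\<close>, and
  otherwise below the replacement of \<open>A\<close>, whose presence in \<open>F\<close> blocked
  the move. So \<open>B\<close> stays in place as well.\<close>

lemma shad_shift_subset:
  assumes "i \<noteq> j"
  shows "shad b (shift i j F) \<subseteq> shift i j (shad b F)"
proof
  fix B assume "B \<in> shad b (shift i j F)"
  then obtain A where A: "A \<in> shift i j F" and B: "finite B" "card B = b" "B \<subseteq> A"
    by (auto simp: shad_def)
  have cswap: "finite (insert x (B - {y}))" "card (insert x (B - {y})) = b"
    if "y \<in> B" "x \<notin> B" for x y
    using B that card_swap[of B y x] by (simp_all del: card_insert_disjoint)
  show "B \<in> shift i j (shad b F)"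
    using A
  proof (cases rule: shift_cases)
    case old
    show ?thesis
    proof (rule shift_oldI)
      show "B \<in> shad b F"
        using B old by (intro shadI)
      assume *: "j \<in> B" "i \<notin> B"
      show "insert i (B - {j}) \<in> shad b F"
      proof (cases "i \<in> A")
        case True
        then show ?thesis using * B old cswap by (intro shadI[of _ _ A]) auto
      next
        case False
        then show ?thesis using * B old cswap by (intro shadI[of _ _ "insert i (A - {j})"]) auto
      qed
    qed
  next
    case moved
    show ?thesis
    proof (cases "i \<in> B")
      case True
      have "insert j (B - {i}) \<in> shad b F"
        using B True moved cswap[of i j] by (intro shadI[of _ _ "insert j (A - {i})"]) blast+
      then show ?thesis
        using True moved B by (intro shift_movedI) auto
    next
      case False
      then have "B \<in> shad b F"
        using B moved by (intro shadI[of _ _ "insert j (A - {i})"]) auto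
      then show ?thesis
        using False moved B by (intro shift_oldI) auto
    qed
  qed
qed

lemma card_shad_shift_le:
  assumes "i \<noteq> j" "finite (shad b F)"
  shows "card (shad b (shift i j F)) \<le> card (shad b F)"
  using card_mono[OF finite_shift[OF assms(2)] shad_shift_subset[OF assms(1)]] by simp

text \<open>Strict growth of this count is what ends the repeated shifting towards
  \<open>i\<close>.\<close>

lemma card_containing_less_shift:
  assumes "finite F" "\<not> stable i j F"
  shows "card {A \<in> F. i \<in> A} < card {A \<in> shift i j F. i \<in> A}"
proof -
  obtain A where A: "A \<in> F" "j \<in> A" "i \<notin> A" "insert i (A - {j}) \<notin> F"
    using assms(2) by (auto simp: stable_def)
  let ?A = "insert i (A - {j})"
  have "?A \<in> shift i j F"
    unfolding shift_def using A by (intro image_eqI[of _ _ A]) (simp_all add: shift_set_def)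
  moreover have "{A \<in> F. i \<in> A} \<subseteq> shift i j F"
    by (auto intro: shift_oldI)
  ultimately have "{A \<in> F. i \<in> A} \<subset> {A \<in> shift i j F. i \<in> A}"
    using A(4) by blast
  then show ?thesis
    using assms(1) by (intro psubset_card_mono) auto
qed

text \<open>Among the families of the same size with no larger shadow, one with the most members
  through \<open>v\<close> is stable towards \<open>v\<close>. Stability at this single point
  already gives the recursion of \<open>card_shad_stable\<close>.\<close>

lemma ex_stable_shad_le:
  assumes V: "finite V" "v \<in> V" and F: "F \<subseteq> {A. A \<subseteq> V \<and> card A = d}"
  obtains F' where "F' \<subseteq> {A. A \<subseteq> V \<and> card A = d}" "card F' = card F"
    "card (shad b F') \<le> card (shad b F)" "\<And>j. stable v j F'"
proof -
  define P where "P G \<longleftrightarrow> G \<subseteq> {A. A \<subseteq> V \<and> card A = d} \<and> card G = card F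
    \<and> card (shad b G) \<le> card (shad b F)" for G
  have sub: "G \<subseteq> Pow V" if "P G" for G
    using that by (auto simp: P_def)
  have fin: "finite G" if "P G" for G
    using sub[OF that] V(1) by (simp add: finite_subset)
  have "card {A \<in> G. v \<in> A} < Suc (card (Pow V))" if "P G" for G
    using sub[OF that] V(1) by (intro le_imp_less_Suc card_mono) auto
  moreover have "P F"
    using F by (simp add: P_def)
  ultimately have "\<exists>G. P G \<and> (\<forall>G'. P G' \<longrightarrow> card {A \<in> G'. v \<in> A} \<le> card {A \<in> G. v \<in> A})"
    by (intro ex_has_greatest_nat[of P F _ "Suc (card (Pow V))"]) auto
  then obtain G where G: "P G"
    and max: "\<And>G'. P G' \<Longrightarrow> card {A \<in> G'. v \<in> A} \<le> card {A \<in> G. v \<in> A}"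
    by auto
  have "stable v j G" for j
  proof (rule ccontr)
    assume ns: "\<not> stable v j G"
    then have "v \<noteq> j"
      by (auto simp: stable_def)
    then have "card (shad b (shift v j G)) \<le> card (shad b G)"
      by (intro card_shad_shift_le finite_shad[OF V(1) sub[OF G]])
    then have "P (shift v j G)"
      using G shift_uniform[of G V d v j] V by (auto simp: P_def)
    then show False
      using max card_containing_less_shift[OF fin[OF G] ns] by fastforce
  qed
  then show thesis
    using that[of G] G by (auto simp: P_def)
qed

section \<open>Link and deletion at a point\<close>

definition link :: "'a \<Rightarrow> 'a set set \<Rightarrow> 'a set set" where
  "link v F = {A. v \<notin> A \<and> insert v A \<in> F}"

definition deletion :: "'a \<Rightarrow> 'a set set \<Rightarrow> 'a set set" where
  "deletion v F = {A \<in> F. v \<notin> A}"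

lemma link_eq_image: "link v F = (\<lambda>A. A - {v}) ` {A \<in> F. v \<in> A}"
proof -
  have "A \<in> (\<lambda>A. A - {v}) ` {A \<in> F. v \<in> A}" if "A \<in> link v F" for A
    using that by (intro image_eqI[of _ _ "insert v A"]) (auto simp: link_def)
  then show ?thesis
    by (auto simp: link_def insert_absorb)
qed

lemma finite_link [simp]: "finite F \<Longrightarrow> finite (link v F)"
  by (simp add: link_eq_image)

lemma finite_deletion [simp]: "finite F \<Longrightarrow> finite (deletion v F)"
  by (simp add: deletion_def)

lemma card_link_plus_card_deletion:
  assumes "finite F"
  shows "card F = card (link v F) + card (deletion v F)"
proof -
  have "inj_on (\<lambda>A. A - {v}) {A \<in> F. v \<in> A}"
    by (rule inj_onI) (metis (mono_tags, lifting) insert_Diff mem_Collect_eq)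
  then have "card (link v F) = card {A \<in> F. v \<in> A}"
    by (simp add: link_eq_image card_image)
  moreover have "card F = card {A \<in> F. v \<in> A} + card {A \<in> F. v \<notin> A}"
    using assms by (subst card_Un_disjoint[symmetric]) (auto intro: arg_cong[where f = card])
  ultimately show ?thesis
    by (simp add: deletion_def)
qed

lemma link_uniform:
  assumes "F \<subseteq> {A. A \<subseteq> V \<and> card A = Suc d}" "finite V"
  shows "link v F \<subseteq> {A. A \<subseteq> V - {v} \<and> card A = d}"
proof
  fix A assume "A \<in> link v F"
  then have "v \<notin> A" "insert v A \<subseteq> V" "card (insert v A) = Suc d"
    using assms(1) by (auto simp: link_def)
  moreover have "finite A"
    using \<open>insert v A \<subseteq> V\<close> assms(2) finite_subset by auto
  ultimately show "A \<in> {A. A \<subseteq> V - {v} \<and> card A = d}"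
    by auto
qed

lemma deletion_uniform:
  assumes "F \<subseteq> {A. A \<subseteq> V \<and> card A = d}"
  shows "deletion v F \<subseteq> {A. A \<subseteq> V - {v} \<and> card A = d}"
  using assms by (auto simp: deletion_def)

text \<open>A subset with one element less arises by removing some \<open>x\<close>, and stability
  trades that \<open>x\<close> for \<open>v\<close>. This bounds the link from below by the shadow
  of the deletion, the key estimate in both shadow theorems.\<close>

lemma shad_deletion_subset_link:
  assumes st: "\<And>j. stable v j F" and F: "\<And>A. A \<in> F \<Longrightarrow> finite A \<and> card A = Suc d"
  shows "shad d (deletion v F) \<subseteq> link v F"
proof
  fix B assume "B \<in> shad d (deletion v F)"
  then obtain A where A: "A \<in> F" "v \<notin> A" "finite B" "card B = d" "B \<subseteq> A"
    by (auto simp: shad_def deletion_def)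
  then have "card (A - B) = Suc 0"
    using F by (simp add: card_Diff_subset)
  then obtain x where "A - B = {x}"
    using card_1_singletonE by auto
  then have "x \<in> A" "B = A - {x}"
    using A(5) by auto
  then show "B \<in> link v F"
    using stableD[OF st A(1), of x] A(2) by (auto simp: link_def)
qed

text \<open>The whole shadow comes from the link, split by whether \<open>v\<close> is present. If
  \<open>B\<close> lies below a member that avoids \<open>v\<close>, then \<open>b < d\<close>
  leaves an element outside \<open>B\<close> that can be traded for \<open>v\<close>.\<close>

lemma card_shad_stable:
  assumes st: "\<And>j. stable v j F" and F: "\<And>A. A \<in> F \<Longrightarrow> finite A \<and> card A = d"
    and "finite F" "1 \<le> b" "b < d"
  shows "card (shad b F) = card (shad b (link v F)) + card (shad (b - 1) (link v F))"
proof -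
  have 1: "B \<in> shad b (link v F)" if B: "B \<in> shad b F" "v \<notin> B" for B
  proof -
    obtain A where A: "A \<in> F" "finite B" "card B = b" "B \<subseteq> A"
      using B by (auto simp: shad_def)
    show ?thesis
    proof (cases "v \<in> A")
      case True
      then have "A - {v} \<in> link v F"
        using A by (simp add: link_def insert_absorb)
      then show ?thesis
        using A B by (intro shadI[of B b "A - {v}"]) auto
    next
      case False
      have "B \<noteq> A"
        using F[OF A(1)] A(3) assms(5) by auto
      then obtain x where x: "x \<in> A" "x \<notin> B"
        using A(4) by auto
      then have "A - {x} \<in> link v F"
        using stableD[OF st A(1), of x] False by (simp add: link_def)
      then show ?thesis
        using A x by (intro shadI[of B b "A - {x}"]) auto
    qed
  qed
  have 2: "B \<in> insert v ` shad (b - 1) (link v F)" if B: "B \<in> shad b F" "v \<in> B" for B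
  proof -
    obtain A where A: "A \<in> F" "finite B" "card B = b" "B \<subseteq> A"
      using B by (auto simp: shad_def)
    then have "A - {v} \<in> link v F"
      using B(2) by (auto simp: link_def insert_absorb)
    then have "B - {v} \<in> shad (b - 1) (link v F)"
      using A B(2) by (intro shadI[of _ _ "A - {v}"]) auto
    then show ?thesis
      using B(2) by (intro image_eqI[of _ _ "B - {v}"]) auto
  qed
  have 3: "shad b (link v F) \<subseteq> shad b F"
    unfolding shad_def link_def by blast
  have nv: "v \<notin> B" if "B \<in> shad c (link v F)" for B c
    using that by (auto simp: shad_def link_def)
  have 4: "insert v ` shad (b - 1) (link v F) \<subseteq> shad b F"
  proof (rule image_subsetI)
    fix B assume B: "B \<in> shad (b - 1) (link v F)"
    then obtain A where "insert v A \<in> F" "B \<subseteq> A" "finite B" "card B = b - 1"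
      by (auto simp: shad_def link_def)
    then show "insert v B \<in> shad b F"
      using nv[OF B] assms(4) by (intro shadI[of _ _ "insert v A"]) auto
  qed
  have eq: "shad b F = shad b (link v F) \<union> insert v ` shad (b - 1) (link v F)"
    using 1 2 3 4 by blast
  have "finite (\<Union>F)"
    using F assms(3) by auto
  moreover have "link v F \<subseteq> Pow (\<Union>F)"
    by (auto simp: link_def)
  ultimately have fin: "finite (shad c (link v F))" for c
    by (rule finite_shad)
  have "inj_on (insert v) (shad (b - 1) (link v F))"
    by (rule inj_onI) (metis nv Diff_insert_absorb)
  then have "card (insert v ` shad (b - 1) (link v F)) = card (shad (b - 1) (link v F))"
    by (rule card_image)
  moreover have "shad b (link v F) \<inter> insert v ` shad (b - 1) (link v F) = {}"
    using nv by blast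
  ultimately show ?thesis
    unfolding eq by (simp add: card_Un_disjoint fin)
qed

lemma shad_top:
  assumes "\<And>A. A \<in> F \<Longrightarrow> finite A \<and> card A = d"
  shows "shad d F = F"
proof -
  have "B \<in> F" if B: "B \<in> shad d F" for B
  proof -
    obtain A where "A \<in> F" "card B = d" "B \<subseteq> A"
      using B by (auto simp: shad_def)
    then show ?thesis
      using assms[of A] card_subset_eq[of A B] by simp
  qed
  then show ?thesis
    using assms by (auto intro: shadI)
qed

lemma shad_above:
  assumes "\<And>A. A \<in> F \<Longrightarrow> finite A \<and> card A = d" "d < b"
  shows "shad b F = {}"
proof -
  have False if "B \<in> shad b F" for B
  proof -
    obtain A where "A \<in> F" "B \<subseteq> A" "card B = b"
      using \<open>B \<in> shad b F\<close> by (auto simp: shad_def)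
    then show False
      using assms(1)[of A] assms(2) card_mono[of A B] by auto
  qed
  then show ?thesis by auto
qed

lemma shad_0: "shad 0 F = (if F = {} then {} else {{}})"
  by (auto simp: shad_def)

section \<open>The Kruskal--Katona theorem\<close>

lemma colex_less_iff:
  assumes "finite A" "finite B"
  shows "colex_less A B \<longleftrightarrow> (\<exists>m. m \<in> B \<and> m \<notin> A \<and> (\<forall>x>m. x \<in> A \<longleftrightarrow> x \<in> B))"
proof
  let ?D = "(A - B) \<union> (B - A)"
  have fin: "finite ?D"
    using assms by simp
  show "\<exists>m. m \<in> B \<and> m \<notin> A \<and> (\<forall>x>m. x \<in> A \<longleftrightarrow> x \<in> B)" if "colex_less A B"
  proof (intro exI[of _ "Max ?D"] conjI allI impI)
    have B: "Max ?D \<in> B" and "?D \<noteq> {}"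
      using that unfolding colex_less_def by blast+
    then have "Max ?D \<in> ?D"
      using Max_in[OF fin] by blast
    then show "Max ?D \<in> B" "Max ?D \<notin> A"
      using B by blast+
    show "x \<in> A \<longleftrightarrow> x \<in> B" if "x > Max ?D" for x
      using Max_ge[OF fin, of x] that by auto
  qed
  show "colex_less A B" if ex: "\<exists>m. m \<in> B \<and> m \<notin> A \<and> (\<forall>x>m. x \<in> A \<longleftrightarrow> x \<in> B)"
  proof -
    obtain m where m: "m \<in> B" "m \<notin> A" "\<And>x. x > m \<Longrightarrow> x \<in> A \<longleftrightarrow> x \<in> B"
      using ex by blast
    then have "Max ?D = m"
      using fin by (intro Max_eqI) (auto simp: not_less[symmetric])
    then show ?thesis
      using m by (auto simp: colex_less_def)
  qed
qed

lemma colex_lessE: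
  assumes "colex_less A B" "finite A" "finite B"
  obtains m where "m \<in> B" "m \<notin> A" "\<And>x. x > m \<Longrightarrow> x \<in> A \<longleftrightarrow> x \<in> B"
proof -
  obtain m where "m \<in> B \<and> m \<notin> A \<and> (\<forall>x>m. x \<in> A \<longleftrightarrow> x \<in> B)"
    using assms(1) colex_less_iff[OF assms(2,3)] by blast
  then show thesis
    by (intro that[of m]) simp_all
qed

text \<open>The number whose binary digits are given by \<open>A\<close>. Colex order on finite sets
  is the order of these numbers, so minima and ranks can be taken in \<open>nat\<close>.\<close>

definition colex_weight :: "nat set \<Rightarrow> nat" where
  "colex_weight A = (\<Sum>i\<in>A. 2 ^ i)"

lemma colex_weight_less:
  assumes fin: "finite A" "finite B" and "colex_less A B"
  shows "colex_weight A < colex_weight B"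
proof -
  obtain m where m: "m \<in> B" "m \<notin> A" "\<And>x. x > m \<Longrightarrow> x \<in> A \<longleftrightarrow> x \<in> B"
    using colex_lessE[OF assms(3) fin] by metis
  have "x < m" if "x \<in> A - B" for x
    using that m by (metis DiffE linorder_neqE_nat)
  then have "(\<Sum>i\<in>A - B. 2 ^ i) \<le> (\<Sum>i\<in>{..<m}. 2 ^ i :: nat)"
    by (intro sum_mono2) auto
  also have "\<dots> < 2 ^ m"
    by (simp add: sum_power2 lessThan_atLeast0)
  also have "\<dots> \<le> (\<Sum>i\<in>B - A. 2 ^ i)"
    using m fin by (intro member_le_sum) auto
  finally have "(\<Sum>i\<in>A - B. 2 ^ i) < (\<Sum>i\<in>B - A. 2 ^ i :: nat)" .
  moreover have "colex_weight A = (\<Sum>i\<in>A - B. 2 ^ i) + (\<Sum>i\<in>A \<inter> B. 2 ^ i)"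
    unfolding colex_weight_def by (rule sum.Int_Diff[OF fin(1), THEN trans]) (rule add.commute)
  moreover have "colex_weight B = (\<Sum>i\<in>B - A. 2 ^ i) + (\<Sum>i\<in>B \<inter> A. 2 ^ i)"
    unfolding colex_weight_def by (rule sum.Int_Diff[OF fin(2), THEN trans]) (rule add.commute)
  ultimately show ?thesis
    by (simp add: Int_commute)
qed

lemma colex_less_total:
  assumes "finite A" "finite B" "A \<noteq> B"
  shows "colex_less A B \<or> colex_less B A"
proof -
  have "Max ((A - B) \<union> (B - A)) \<in> (A - B) \<union> (B - A)"
    using assms by (intro Max_in) auto
  then show ?thesis
    using assms(3) by (auto simp: colex_less_def Un_commute)
qed

lemma colex_less_iff_weight:
  assumes "finite A" "finite B"
  shows "colex_less A B \<longleftrightarrow> colex_weight A < colex_weight B"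
  using colex_less_total[OF assms] colex_weight_less[of A B] colex_weight_less[of B A] assms
  by fastforce

lemma inj_on_colex_weight: "inj_on colex_weight {A. finite A}"
  by (rule inj_onI) (metis colex_less_total colex_weight_less less_irrefl mem_Collect_eq)

text \<open>The variable lower end \<open>p\<close> makes link and deletion at \<open>p\<close>
  initial segments over \<open>{Suc p..}\<close> without renaming. The ground set has no upper end,
  so a segment can always be extended when \<open>d\<close> is positive.\<close>

definition colex_initial :: "nat \<Rightarrow> nat \<Rightarrow> nat set set \<Rightarrow> bool" where
  "colex_initial p d C \<longleftrightarrow> C \<subseteq> {A. finite A \<and> A \<subseteq> {p..} \<and> card A = d} \<and>
     (\<forall>A\<in>C. \<forall>B. finite B \<and> B \<subseteq> {p..} \<and> card B = d \<and> colex_less B A \<longrightarrow> B \<in> C)"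

lemma colex_initialD:
  assumes "colex_initial p d C"
  shows "A \<in> C \<Longrightarrow> finite A" "A \<in> C \<Longrightarrow> A \<subseteq> {p..}" "A \<in> C \<Longrightarrow> card A = d"
    "A \<in> C \<Longrightarrow> finite B \<Longrightarrow> B \<subseteq> {p..} \<Longrightarrow> card B = d \<Longrightarrow> colex_less B A \<Longrightarrow> B \<in> C"
  using assms by (auto simp: colex_initial_def)

text \<open>Trading any element for the least one goes down in colex. Initial segments therefore
  satisfy the exact recursion of \<open>card_shad_stable\<close> at \<open>p\<close> as they
  stand.\<close>

lemma colex_initial_stable:
  assumes "colex_initial p d C"
  shows "stable p j C"
  unfolding stable_def
proof (intro ballI impI, elim conjE)
  fix A assume A: "A \<in> C" "j \<in> A" "p \<notin> A"
  note C = colex_initialD[OF assms]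
  have "j > p"
    using C(2)[OF A(1)] A by (metis atLeast_iff le_neq_implies_less subsetD)
  then have "colex_less (insert p (A - {j})) A"
    using A C(1)[OF A(1)] by (subst colex_less_iff) (auto intro!: exI[of _ j])
  then show "insert p (A - {j}) \<in> C"
    using A C(1-3)[OF A(1)] card_swap[of A j p] by (intro C(4)[OF A(1)]) auto
qed

lemma subset_atLeast_Suc_iff: "A \<subseteq> {Suc p..} \<longleftrightarrow> A \<subseteq> {p..} \<and> p \<notin> A"
  by (auto simp: subset_eq Suc_le_eq le_less)

lemma colex_initial_link:
  assumes "colex_initial p (Suc d) C"
  shows "colex_initial (Suc p) d (link p C)"
  unfolding colex_initial_def
proof (intro conjI ballI allI impI subsetI)
  note C = colex_initialD[OF assms]
  fix A assume "A \<in> link p C"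
  then have A: "p \<notin> A" "insert p A \<in> C"
    by (auto simp: link_def)
  then have fin: "finite A" and sub: "A \<subseteq> {p..}" and card: "card A = d"
    using C(1-3)[OF A(2)] by auto
  have "A \<subseteq> {Suc p..}"
    using sub A(1) by (simp add: subset_atLeast_Suc_iff)
  then show "A \<in> {A. finite A \<and> A \<subseteq> {Suc p..} \<and> card A = d}"
    using fin card by auto
  fix B assume B: "finite B \<and> B \<subseteq> {Suc p..} \<and> card B = d \<and> colex_less B A"
  obtain m where m: "m \<in> A" "m \<notin> B" "\<And>x. x > m \<Longrightarrow> x \<in> B \<longleftrightarrow> x \<in> A"
    using colex_lessE[of B A] B fin by metis
  have pB: "p \<notin> B"
    using B by auto
  have "colex_less (insert p B) (insert p A)"
    using B fin m A(1) by (subst colex_less_iff) (auto intro!: exI[of _ m])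
  then have "insert p B \<in> C"
    using B pB by (intro C(4)[OF A(2)]) auto
  then show "B \<in> link p C"
    using pB by (simp add: link_def)
qed

lemma colex_initial_deletion:
  assumes "colex_initial p d C"
  shows "colex_initial (Suc p) d (deletion p C)"
  unfolding colex_initial_def
proof (intro conjI ballI allI impI subsetI)
  note C = colex_initialD[OF assms]
  fix A assume "A \<in> deletion p C"
  then have A: "A \<in> C" "p \<notin> A"
    by (auto simp: deletion_def)
  then show "A \<in> {A. finite A \<and> A \<subseteq> {Suc p..} \<and> card A = d}"
    using C(1-3)[OF A(1)] by (simp add: subset_atLeast_Suc_iff)
  fix B assume "finite B \<and> B \<subseteq> {Suc p..} \<and> card B = d \<and> colex_less B A"
  then show "B \<in> deletion p C"
    using C(4)[OF A(1), of B] by (simp add: subset_atLeast_Suc_iff deletion_def)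
qed

text \<open>The number \<open>N\<close> only provides a window \<open>{p..<p + N}\<close> in which
  some set is missing from \<open>C\<close>. The colex-least missing set of the window is the least
  one altogether, because whatever lies below it in colex stays in the window.\<close>

lemma ex_colex_initial_insert:
  assumes C: "colex_initial p d C" and fin: "finite C" and less: "card C < N choose d"
  obtains B where "B \<notin> C" "colex_initial p d (insert B C)"
proof -
  define X where "X = {B. B \<subseteq> {p..<p + N} \<and> card B = d}"
  have finX: "finite X"
    unfolding X_def by simp
  have "card X = N choose d"
    unfolding X_def by (subst n_subsets) auto
  then have "\<not> X \<subseteq> C"
    using card_mono[OF fin, of X] less by linarith
  then have "X - C \<noteq> {}"
    by blast
  then obtain B where B: "B \<in> X - C" and min: "\<And>A. A \<in> X - C \<Longrightarrow> colex_weight B \<le> colex_weight A"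
    using finX by (metis finite_Diff arg_min_if_finite(1) arg_min_least)
  have finB: "finite B" "B \<subseteq> {p..}" "card B = d"
    using B finite_subset by (fastforce simp: X_def)+
  have "A \<in> C" if A: "finite A" "A \<subseteq> {p..}" "card A = d" "colex_less A B" for A
  proof (rule ccontr)
    assume "A \<notin> C"
    obtain m where m: "m \<in> B" "\<And>x. x > m \<Longrightarrow> x \<in> A \<longleftrightarrow> x \<in> B"
      using colex_lessE[OF A(4,1) finB(1)] by metis
    have "x < p + N" if "x \<in> A" for x
    proof (cases "x > m")
      case True
      then show ?thesis using that m(2) B by (auto simp: X_def)
    next
      case False
      moreover have "m < p + N"
        using m(1) B by (auto simp: X_def)
      ultimately show ?thesis by simp
    qed
    then have "A \<in> X - C"
      using A \<open>A \<notin> C\<close> by (auto simp: X_def)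
    then show False
      using min colex_weight_less[OF A(1) finB(1) A(4)] by fastforce
  qed
  then have "colex_initial p d (insert B C)"
    using C finB unfolding colex_initial_def by blast
  then show thesis
    using that B by auto
qed

text \<open>Filling the smallest gap \<open>q\<close> of \<open>A \<ni> p\<close> at the expense of \<open>p\<close> yields the successor of
  \<open>A\<close> among the sets that avoid \<open>p\<close>, so it lies in the extended initial segment.\<close>

lemma link_subset_shad_insert:
  assumes C: "colex_initial p (Suc d) C" and B: "B \<notin> deletion p C"
    and C': "colex_initial (Suc p) (Suc d) (insert B (deletion p C))"
  shows "link p C \<subseteq> shad d (insert B (deletion p C))"
proof
  fix A0 assume "A0 \<in> link p C"
  then have A: "p \<notin> A0" "insert p A0 \<in> C" (is "?A \<in> C")
    by (auto simp: link_def)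
  have fin: "finite A0" "card A0 = d" "A0 \<subseteq> {p..}"
    using colex_initialD(1-3)[OF C A(2)] A(1) by auto
  have Bp: "finite B" "B \<subseteq> {Suc p..}" "card B = Suc d"
    using colex_initialD(1-3)[OF C', of B] by auto
  define q where "q = (LEAST q. p \<le> q \<and> q \<notin> ?A)"
  have "\<exists>q. p \<le> q \<and> q \<notin> ?A"
    using fin(1) by (metis (no_types) infinite_Ici finite.insertI finite_subset subsetI atLeast_iff)
  then have q: "p \<le> q" "q \<notin> ?A"
    unfolding q_def by (metis (mono_tags, lifting) LeastI)+
  have q_min: "x \<in> ?A" if "p \<le> x" "x < q" for x
    using not_less_Least[of x] that unfolding q_def by blast
  have pq: "p < q"
    using q by (metis insertI1 le_neq_implies_less)
  let ?A' = "insert q A0"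
  have A': "finite ?A'" "card ?A' = Suc d" "?A' \<subseteq> {Suc p..}"
    using fin A(1) q pq by (auto simp: Suc_le_eq le_less)
  have "p \<notin> B"
    using Bp(2) by auto
  then have "B \<notin> C"
    using B by (auto simp: deletion_def)
  moreover have "B \<subseteq> {p..}"
    by (rule order_trans[OF Bp(2)]) auto
  ultimately have "\<not> colex_less B ?A" "B \<noteq> ?A"
    using colex_initialD(4)[OF C A(2) Bp(1)] Bp(3) A(2) by blast+
  then have "colex_less ?A B"
    using colex_less_total[of B ?A] Bp(1) fin(1) by auto
  then obtain m where m: "m \<in> B" "m \<notin> ?A" "\<And>x. x > m \<Longrightarrow> x \<in> ?A \<longleftrightarrow> x \<in> B"
    using colex_lessE[of ?A B] Bp(1) fin(1) by (metis finite.insertI)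
  have "q \<le> m"
    using q_min[of m] m Bp(2) by (metis Suc_leD atLeast_iff leI subsetD)
  have "?A' \<in> insert B (deletion p C)"
  proof (cases "q = m")
    case True
    have "x \<in> ?A'" if x: "x \<in> B" for x
    proof -
      have "x \<noteq> p" "p \<le> x"
        using x \<open>p \<notin> B\<close> Bp(2) by auto
      then show ?thesis
        using q_min[of x] m(3)[of x] x True by (cases x q rule: linorder_cases) auto
    qed
    then have "B = ?A'"
      using Bp A' by (intro card_subset_eq) auto
    then show ?thesis by simp
  next
    case False
    then have "colex_less ?A' B"
      using Bp(1) fin(1) m \<open>q \<le> m\<close> pq by (subst colex_less_iff) (auto intro!: exI[of _ m])
    then show ?thesis
      by (rule colex_initialD(4)[OF C' insertI1 A'(1,3,2)])
  qed
  then show "A0 \<in> shad d (insert B (deletion p C))"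
    using fin by (intro shadI[of _ _ ?A']) auto
qed

text \<open>The induction varies \<open>p\<close> because links and deletions raise the least
  admissible element. The hypothesis is an inequality of sizes because the link of \<open>C\<close>
  may be smaller than the link it is compared with.\<close>

theorem kruskal_katona:
  fixes V :: "'a set"
  assumes "finite V" "F \<subseteq> {A. A \<subseteq> V \<and> card A = d}"
    and "colex_initial p d C" "finite C" "card C \<le> card F"
  shows "card (shad b C) \<le> card (shad b F)"
  using assms
proof (induction V arbitrary: F d p C b rule: finite_psubset_induct)
  case (psubset V)
  note C = colex_initialD[OF psubset.prems(2)]
  have F: "finite A \<and> card A = d" if "A \<in> F" for A
    using that psubset.prems(1) finite_subset[OF _ psubset.hyps, of A] by auto
  have C': "finite A \<and> card A = d" if "A \<in> C" for A
    using that C(1,3) by auto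
  consider "C = {}" | "d < b" | "b = d" | "C \<noteq> {}" "b = 0" | "C \<noteq> {}" "1 \<le> b" "b < d"
    by linarith
  then show ?case
  proof cases
    case 1
    then show ?thesis by (simp add: shad_def)
  next
    case 2
    then show ?thesis using shad_above[of C d b] C' by auto
  next
    case 3
    then show ?thesis using shad_top[of C d] shad_top[of F d] F C' psubset.prems by simp
  next
    case 4
    then have "F \<noteq> {}"
      using psubset.prems(3,4) card_gt_0_iff[of C] by fastforce
    then show ?thesis using 4 by (simp add: shad_0)
  next
    case 5
    obtain d' where d': "d = Suc d'"
      using 5 by (cases d) auto
    have "F \<noteq> {}"
      using 5 psubset.prems(3,4) card_gt_0_iff[of C] by fastforce
    then obtain A where A: "A \<in> F"
      by blast
    then have "A \<noteq> {}" "A \<subseteq> V"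
      using F[OF A] 5 psubset.prems(1) by auto
    then obtain v where v: "v \<in> V"
      by blast
    obtain G where G: "G \<subseteq> {A. A \<subseteq> V \<and> card A = d}" "card G = card F"
      "card (shad b G) \<le> card (shad b F)" and st: "\<And>j. stable v j G"
      using ex_stable_shad_le[OF psubset.hyps v psubset.prems(1), where b = b] by blast
    have finG: "finite G"
      using psubset.hyps by (intro finite_subset[OF G(1)]) auto
    have G': "finite A \<and> card A = d" if "A \<in> G" for A
      using that G(1) finite_subset[OF _ psubset.hyps, of A] by auto
    let ?V = "V - {v}"
    have V: "?V \<subset> V" "finite ?V"
      using v psubset.hyps by auto
    note link_G = link_uniform[OF G(1)[unfolded d'] psubset.hyps]
    note del_G = deletion_uniform[OF G(1), of v]
    have link_C: "colex_initial (Suc p) d' (link p C)"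
      using colex_initial_link psubset.prems(2) d' by simp
    have del_C: "colex_initial (Suc p) d (deletion p C)"
      using colex_initial_deletion psubset.prems(2) by simp
    \<comment> \<open>If the link of \<open>C\<close> were larger, the deletion of \<open>G\<close>
      would exceed that of \<open>C\<close> by at least one set. For the segment enlarged by one
      set, the induction hypothesis then yields a shadow of the deletion of \<open>G\<close> at
      least as large as the link of \<open>C\<close>; but that shadow lies in the link of
      \<open>G\<close>.\<close>
    have le: "card (link p C) \<le> card (link v G)"
    proof (rule ccontr)
      assume less: "\<not> ?thesis"
      then have less': "card (deletion p C) < card (deletion v G)"
        using card_link_plus_card_deletion[OF psubset.prems(3), of p]
          card_link_plus_card_deletion[OF finG, of v] psubset.prems(4) G(2) by linarith
      also have "\<dots> \<le> card {A. A \<subseteq> ?V \<and> card A = d}"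
        using V by (intro card_mono[OF _ del_G]) auto
      also have "\<dots> = card ?V choose d"
        using V by (intro n_subsets) auto
      finally obtain B where B: "B \<notin> deletion p C" "colex_initial (Suc p) d (insert B (deletion p C))"
        using ex_colex_initial_insert[OF del_C] psubset.prems(3) by (metis finite_deletion)
      let ?C = "insert B (deletion p C)"
      have "card ?C \<le> card (deletion v G)"
        using B(1) less' psubset.prems(3) by simp
      then have "card (shad d' ?C) \<le> card (shad d' (deletion v G))"
        using psubset.prems(3) by (intro psubset.IH[OF V(1) del_G B(2)]) auto
      moreover have "link p C \<subseteq> shad d' ?C"
        using link_subset_shad_insert B psubset.prems(2) d' by simp
      moreover have "finite (shad d' ?C)"
        using colex_initialD(1)[OF B(2)] psubset.prems(3)
        by (intro finite_shad[of "\<Union>?C"]) auto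
      moreover have "shad d' (deletion v G) \<subseteq> link v G"
        using G' d' by (intro shad_deletion_subset_link st) auto
      ultimately have "card (link p C) \<le> card (link v G)"
        using card_mono finG finite_link by (metis order_trans)
      then show False
        using less by simp
    qed
    have IH: "card (shad c (link p C)) \<le> card (shad c (link v G))" for c
      using psubset.prems(3) by (intro psubset.IH[OF V(1) link_G link_C _ le]) auto
    have "card (shad b C) = card (shad b (link p C)) + card (shad (b - 1) (link p C))"
      using 5 C' psubset.prems(3) by (intro card_shad_stable[where d = d])
        (auto intro: colex_initial_stable[OF psubset.prems(2)])
    also have "\<dots> \<le> card (shad b (link v G)) + card (shad (b - 1) (link v G))"
      by (intro add_mono IH)
    also have "\<dots> = card (shad b G)"
      using 5 G' finG st by (intro card_shad_stable[where d = d, symmetric]) auto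
    finally show ?thesis
      using G(3) by simp
  qed
qed

section \<open>Lovasz's form of the Kruskal--Katona theorem\<close>

lemma gbinomial_nonneg:
  fixes a :: real
  assumes "real k - 1 \<le> a"
  shows "0 \<le> a gchoose k"
  unfolding gbinomial_prod_rev using assms by (intro divide_nonneg_nonneg prod_nonneg) auto

lemma gbinomial_mono_strong:
  fixes a b :: real
  assumes "real k - 1 \<le> a" "a \<le> b"
  shows "a gchoose k \<le> b gchoose k"
  unfolding gbinomial_prod_rev using assms by (intro divide_right_mono prod_mono) auto

lemma gbinomial_self: "(real d) gchoose d = 1"
  by (simp add: binomial_gbinomial[symmetric])

text \<open>The argument of \<open>kruskal_katona\<close> with Pascal's rule for real
  \<open>y\<close> in place of the comparison segment: a link below
  \<open>(y - 1) gchoose d'\<close> forces a deletion above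
  \<open>(y - 1) gchoose d\<close>.\<close>

theorem lovasz_shadow:
  fixes V :: "'a set"
  assumes "finite V" "F \<subseteq> {A. A \<subseteq> V \<and> card A = d}"
    and "real d \<le> y" "y gchoose d \<le> real (card F)" "b \<le> d"
  shows "y gchoose b \<le> real (card (shad b F))"
  using assms
proof (induction V arbitrary: F d y b rule: finite_psubset_induct)
  case (psubset V)
  have F: "finite A \<and> card A = d" if "A \<in> F" for A
    using that psubset.prems(1) finite_subset[OF _ psubset.hyps, of A] by auto
  have "1 \<le> y gchoose d"
    using gbinomial_mono_strong[of d "real d" y] psubset.prems(2) gbinomial_self[of d] by simp
  then have "F \<noteq> {}"
    using psubset.prems(3) by auto
  then obtain A where A: "A \<in> F"
    by blast
  consider "b = d" | "b = 0" | "1 \<le> b" "b < d"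
    using psubset.prems(4) by linarith
  then show ?case
  proof cases
    case 1
    then show ?thesis using shad_top[of F d] F psubset.prems by simp
  next
    case 2
    then show ?thesis using \<open>F \<noteq> {}\<close> by (simp add: shad_0)
  next
    case 3
    obtain d' where d': "d = Suc d'"
      using 3 by (cases d) auto
    have "A \<noteq> {}" "A \<subseteq> V"
      using F[OF A] A 3 psubset.prems(1) by auto
    then obtain v where v: "v \<in> V"
      by blast
    obtain G where G: "G \<subseteq> {A. A \<subseteq> V \<and> card A = d}" "card G = card F"
      "card (shad b G) \<le> card (shad b F)" and st: "\<And>j. stable v j G"
      using ex_stable_shad_le[OF psubset.hyps v psubset.prems(1), where b = b] by blast
    have finG: "finite G"
      using psubset.hyps by (intro finite_subset[OF G(1)]) auto
    have G': "finite A \<and> card A = d" if "A \<in> G" for A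
      using that G(1) finite_subset[OF _ psubset.hyps, of A] by auto
    let ?V = "V - {v}"
    have V: "?V \<subset> V" "finite ?V"
      using v psubset.hyps by auto
    note link_G = link_uniform[OF G(1)[unfolded d'] psubset.hyps]
    note del_G = deletion_uniform[OF G(1), of v]
    have y: "real d' \<le> y - 1" "real d - 1 \<le> y - 1"
      using psubset.prems(2) d' by auto
    have le: "(y - 1) gchoose d' \<le> real (card (link v G))"
    proof (rule ccontr)
      assume less: "\<not> ?thesis"
      have "real (card G) = real (card (link v G)) + real (card (deletion v G))"
        using card_link_plus_card_deletion[OF finG, of v] by simp
      moreover have "y gchoose d = ((y - 1) gchoose d') + ((y - 1) gchoose d)"
        using gbinomial_reduce_nat[of d y] d' by simp
      ultimately have gr: "(y - 1) gchoose d < real (card (deletion v G))"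
        using less psubset.prems(3) G(2) by linarith
      \<comment> \<open>The induction hypothesis needs an argument of at least \<open>d\<close>,
        which \<open>y - 1\<close> may fail to be. In that case \<open>z = d\<close> works, as
        \<open>d gchoose d = 1\<close> and the deletion is nonempty.\<close>
      define z where "z = max (y - 1) (real d)"
      have z: "real d \<le> z" "y - 1 \<le> z"
        by (auto simp: z_def)
      have "0 < card (deletion v G)"
        using gr gbinomial_nonneg[OF y(2)] by linarith
      then have "z gchoose d \<le> real (card (deletion v G))"
        using gr gbinomial_self[of d] by (auto simp: z_def max_def)
      then have "z gchoose d' \<le> real (card (shad d' (deletion v G)))"
        using d' z by (intro psubset.IH[OF V(1) del_G]) auto
      also have "\<dots> \<le> real (card (link v G))"
        using finG G' d' by (intro of_nat_mono card_mono shad_deletion_subset_link st) auto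
      finally show False
        using less gbinomial_mono_strong[of d' "y - 1" z] y(1) z(2) by linarith
    qed
    have IH: "(y - 1) gchoose c \<le> real (card (shad c (link v G)))" if "c \<le> d'" for c
      by (rule psubset.IH[OF V(1) link_G y(1) le that])
    have "y gchoose b = ((y - 1) gchoose b) + ((y - 1) gchoose (b - 1))"
      using gbinomial_reduce_nat[of b y] 3 by simp
    also have "\<dots> \<le> real (card (shad b (link v G))) + real (card (shad (b - 1) (link v G)))"
      using 3 d' by (intro add_mono IH) auto
    also have "\<dots> = real (card (shad b G))"
      using 3 G' finG st by (subst card_shad_stable[where d = d and v = v and F = G]) auto
    finally show ?thesis
      using G(3) by simp
  qed
qed

lemma gbinomial_Suc_eq:
  fixes y :: real
  shows "y gchoose Suc d = (y gchoose d) * ((y - real d) / real (Suc d))"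
proof -
  have "(y gchoose d) * y = real d * (y gchoose d) + real (Suc d) * (y gchoose Suc d)"
    using gbinomial_mult_1'[of y d] by (simp add: algebra_simps)
  then show ?thesis
    by (simp add: field_simps)
qed

text \<open>This excludes \<open>0 \<le> y < d\<close> in the reflection below: the value there is
  less than 1, whereas a nonempty family has at least one member.\<close>

lemma abs_gbinomial_le_1:
  fixes y :: real
  assumes "0 \<le> y" "y \<le> real d"
  shows "\<bar>y gchoose d\<bar> \<le> 1 \<and> (y < real d \<longrightarrow> \<bar>y gchoose d\<bar> < 1)"
  using assms
proof (induction d)
  case 0
  then show ?case by simp
next
  case (Suc d)
  have abs: "\<bar>y gchoose Suc d\<bar> = \<bar>y gchoose d\<bar> * (\<bar>y - real d\<bar> / real (Suc d))"
    unfolding gbinomial_Suc_eq by (simp add: abs_mult)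
  show ?case
  proof (cases "y \<le> real d")
    case True
    then have "\<bar>y gchoose d\<bar> * (\<bar>y - real d\<bar> / real (Suc d)) \<le> 1 * (\<bar>y - real d\<bar> / real (Suc d))"
      using Suc by (intro mult_right_mono) auto
    also have "\<dots> < 1"
      using True Suc.prems by simp
    finally show ?thesis
      unfolding abs by simp
  next
    case False
    have "y gchoose d \<le> real (Suc d) gchoose d"
      using False Suc.prems by (intro gbinomial_mono_strong) auto
    also have "\<dots> = real (Suc d)"
      unfolding binomial_gbinomial[symmetric] by simp
    finally have "\<bar>y gchoose d\<bar> \<le> real (Suc d)"
      using gbinomial_nonneg[of d y] False by simp
    then have "\<bar>y gchoose d\<bar> * (\<bar>y - real d\<bar> / real (Suc d))
        \<le> real (Suc d) * (\<bar>y - real d\<bar> / real (Suc d))"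
      by (intro mult_right_mono) auto
    also have "\<dots> = y - real d"
      using False by simp
    finally have "\<bar>y gchoose Suc d\<bar> \<le> y - real d"
      unfolding abs .
    then show ?thesis
      using Suc.prems by auto
  qed
qed

text \<open>The polynomial \<open>y gchoose d\<close> attains large values also at negative \<open>y\<close> if \<open>d\<close> is even;
  the reflection \<open>y \<mapsto> d - 1 - y\<close> then leads back to the range of Lovasz's theorem.\<close>

lemma gbinomial_reflect:
  fixes y :: real
  assumes "1 \<le> d" "1 \<le> y gchoose d"
  obtains z where "real d \<le> z" "z gchoose d = y gchoose d"
    "\<And>j. j \<le> d \<Longrightarrow> y gchoose j \<le> z gchoose j"
proof (cases "real d \<le> y")
  case True
  then show thesis using that[of y] by simp
next
  case False
  have "y < 0"
    using abs_gbinomial_le_1[of y d] assms(2) False by force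
  define z where "z = real d - 1 - y"
  have z: "real d - 1 < z"
    using \<open>y < 0\<close> by (simp add: z_def)
  have "y gchoose d = (- 1) ^ d * (z gchoose d)"
    unfolding z_def diff_right_commute[of "real d" 1 y] by (rule gbinomial_negated_upper)
  moreover have "0 \<le> z gchoose d"
    using z by (intro gbinomial_nonneg) simp
  ultimately have eq: "z gchoose d = y gchoose d"
    using assms(2) by (cases "even d") auto
  have "real d \<le> z"
    using abs_gbinomial_le_1[of z d] z assms eq by force
  \<comment> \<open>The reflection belonging to \<open>j\<close> is \<open>j - 1 - y\<close>, which
    is at most \<open>z\<close>. For odd \<open>j\<close> the left side is not even
    positive.\<close>
  moreover have "y gchoose j \<le> z gchoose j" if "j \<le> d" for j
  proof -
    have "real j - 1 - y \<le> z" "real j - 1 \<le> real j - 1 - y"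
      using that \<open>y < 0\<close> by (auto simp: z_def)
    then have *: "(real j - 1 - y) gchoose j \<le> z gchoose j" "0 \<le> (real j - 1 - y) gchoose j"
      by (auto intro: gbinomial_mono_strong gbinomial_nonneg)
    have "y gchoose j = (- 1) ^ j * ((real j - 1 - y) gchoose j)"
      unfolding diff_right_commute[of "real j" 1 y] by (rule gbinomial_negated_upper)
    then show ?thesis
      using * by (cases "even j") auto
  qed
  ultimately show thesis
    using that[of z] eq by simp
qed

section \<open>Cross-intersecting families\<close>

lemma containing_shift_subset: "{A \<in> shift i v F. v \<in> A} \<subseteq> {A \<in> F. v \<in> A}"
  by (auto elim: shift_cases)

lemma card_containing_shift_le:
  "finite F \<Longrightarrow> card {A \<in> shift i v F. v \<in> A} \<le> card {A \<in> F. v \<in> A}"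
  by (rule card_mono[OF _ containing_shift_subset]) simp

lemma card_containing_shift_less:
  assumes "finite F" "\<not> stable i v F"
  shows "card {A \<in> shift i v F. v \<in> A} < card {A \<in> F. v \<in> A}"
proof -
  obtain A where A: "A \<in> F" "v \<in> A" "i \<notin> A" "insert i (A - {v}) \<notin> F"
    using assms(2) by (auto simp: stable_def)
  have "A \<notin> shift i v F"
  proof
    assume "A \<in> shift i v F"
    then show False
      using A by (cases rule: shift_cases) auto
  qed
  then have "{A \<in> shift i v F. v \<in> A} \<subset> {A \<in> F. v \<in> A}"
    using containing_shift_subset[of i v F] A by blast
  then show ?thesis
    using assms(1) by (intro psubset_card_mono) auto
qed

lemma card_meeting_family:
  assumes "finite W" "A \<subseteq> W" "card A = a" "G \<subseteq> {B. B \<subseteq> W \<and> card B = c}"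
    and meet: "\<And>B. B \<in> G \<Longrightarrow> A \<inter> B \<noteq> {}"
  shows "card G + ((card W - a) choose c) \<le> card W choose c"
proof -
  let ?D = "{B. B \<subseteq> W - A \<and> card B = c}"
  have "finite A"
    using assms(1,2) finite_subset by auto
  then have "card ?D = (card W - a) choose c"
    using assms(1-3) by (subst n_subsets) (auto simp: card_Diff_subset)
  moreover have "G \<inter> ?D = {}"
    using meet by blast
  moreover have "finite G"
    using assms(1) by (intro finite_subset[OF assms(4)]) simp
  moreover have "card (G \<union> ?D) \<le> card {B. B \<subseteq> W \<and> card B = c}"
    using assms(1,4) by (intro card_mono) auto
  ultimately show ?thesis
    using assms(1) by (simp add: card_Un_disjoint n_subsets)
qed

text \<open>Here the families are pushed away from \<open>v\<close>. Two members through
  \<open>v\<close> leave a free element \<open>i\<close> because \<open>2 * Suc a < card V\<close>;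
  were their links disjoint, trading \<open>v\<close> for \<open>i\<close> in one of them would
  separate them. The last bound holds because a member of \<open>F\<close> avoiding \<open>v\<close>
  meets every member of the link of \<open>G\<close>.\<close>

lemma card_cross_intersecting_stable:
  assumes V: "finite V" "v \<in> V" "2 * Suc a < card V"
    and F: "F \<subseteq> {A. A \<subseteq> V \<and> card A = Suc a}" "F \<noteq> {}" "\<And>i. i \<in> V \<Longrightarrow> stable i v F"
    and G: "G \<subseteq> {A. A \<subseteq> V \<and> card A = Suc a}" "G \<noteq> {}" "\<And>i. i \<in> V \<Longrightarrow> stable i v G"
    and cross: "\<And>A B. A \<in> F \<Longrightarrow> B \<in> G \<Longrightarrow> A \<inter> B \<noteq> {}"
  shows "deletion v F \<noteq> {}" "\<And>A B. A \<in> link v F \<Longrightarrow> B \<in> link v G \<Longrightarrow> A \<inter> B \<noteq> {}"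
    "deletion v F \<noteq> {} \<Longrightarrow> card (link v G) + ((card V - Suc (Suc a)) choose a) \<le> (card V - 1) choose a"
proof -
  have out: "\<exists>i. i \<in> V - X" if "X \<subseteq> V" "card X < card V" for X
    using that by (metis Diff_eq_empty_iff all_not_in_conv less_irrefl subset_antisym)
  show "deletion v F \<noteq> {}"
  proof -
    obtain A where A: "A \<in> F"
      using F(2) by blast
    show ?thesis
    proof (cases "v \<in> A")
      case True
      have "A \<subseteq> V" "card A < card V"
        using F(1) A V(3) by auto
      then obtain i where "i \<in> V - A"
        using out[of A] by blast
      then have "insert i (A - {v}) \<in> deletion v F"
        using stableD[OF F(3) A, of i] True V(2) by (auto simp: deletion_def)
      then show ?thesis by blast
    next
      case False
      then show ?thesis using A by (auto simp: deletion_def)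
    qed
  qed
  show "A \<inter> B \<noteq> {}" if A: "A \<in> link v F" and B: "B \<in> link v G" for A B
  proof
    assume disj: "A \<inter> B = {}"
    have A': "insert v A \<in> F" "v \<notin> A" and B': "insert v B \<in> G" "v \<notin> B"
      using A B by (auto simp: link_def)
    then have sub: "insert v A \<subseteq> V" "insert v B \<subseteq> V" "card (insert v A) = Suc a" "card (insert v B) = Suc a"
      using F(1) G(1) by auto
    have "insert v A \<union> insert v B \<subseteq> V"
      using sub by blast
    moreover have "card (insert v A \<union> insert v B) < card V"
    proof -
      have "finite A" "finite B"
        using sub(1,2) finite_subset[OF _ V(1)] by auto
      then have "card A = a" "card B = a"
        using sub(3,4) A'(2) B'(2) by auto
      moreover have "insert v A \<union> insert v B = insert v (A \<union> B)"
        by blast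
      ultimately have "card (insert v A \<union> insert v B) \<le> Suc (a + a)"
        using card_Un_le[of A B] \<open>finite A\<close> \<open>finite B\<close> by (simp add: card_insert_if)
      then show ?thesis
        using V(3) by simp
    qed
    ultimately obtain i where i: "i \<in> V" "i \<notin> insert v A" "i \<notin> insert v B"
      using out by blast
    then have "insert i A \<in> F"
      using stableD[OF F(3)[OF i(1)] A'(1), of] A'(2) by auto
    moreover have "insert i A \<inter> insert v B = {}"
      using disj i A'(2) by auto
    ultimately show False
      using cross B'(1) by blast
  qed
  show "card (link v G) + ((card V - Suc (Suc a)) choose a) \<le> (card V - 1) choose a"
    if ne: "deletion v F \<noteq> {}"
  proof -
    obtain A where A: "A \<in> F" "v \<notin> A"
      using ne by (auto simp: deletion_def)
    have meet: "A \<inter> B \<noteq> {}" if B: "B \<in> link v G" for B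
    proof -
      have "insert v B \<in> G"
        using B by (simp add: link_def)
      then show ?thesis
        using cross[OF A(1)] A(2) by blast
    qed
    have "card (link v G) + ((card (V - {v}) - Suc a) choose a) \<le> card (V - {v}) choose a"
    proof (rule card_meeting_family[OF _ _ _ link_uniform[OF G(1) V(1)] meet])
      show "A \<subseteq> V - {v}" "card A = Suc a"
        using A F(1) by auto
    qed (use V in auto)
    then show ?thesis
      using V by (simp add: card_Diff_singleton)
  qed
qed

text \<open>The bound is attained by a single set together with all \<open>a\<close>-sets that meet
  it.\<close>

theorem card_cross_intersecting:
  fixes V :: "'a set"
  assumes "finite V" "2 * a \<le> card V"
    and "F \<subseteq> {A. A \<subseteq> V \<and> card A = a}" "F \<noteq> {}"
    and "G \<subseteq> {A. A \<subseteq> V \<and> card A = a}" "G \<noteq> {}"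
    and "\<And>A B. A \<in> F \<Longrightarrow> B \<in> G \<Longrightarrow> A \<inter> B \<noteq> {}"
  shows "card F + card G + ((card V - a) choose a) \<le> (card V choose a) + 1"
  using assms
proof (induction V arbitrary: F G a rule: finite_psubset_induct)
  case (psubset V)
  let ?K = "{A. A \<subseteq> V \<and> card A = a}"
  have finA: "finite A" if "A \<subseteq> V" for A
    by (rule finite_subset[OF that psubset.hyps])
  have finK: "finite ?K"
    using psubset.hyps by simp
  have fin: "finite H" if "H \<subseteq> ?K" for H
    by (rule finite_subset[OF that finK])
  have "a \<noteq> 0"
  proof
    assume "a = 0"
    then have "F \<subseteq> {{}}" "G \<subseteq> {{}}"
      using psubset.prems(2,4) finA by auto
    then show False
      using psubset.prems(3,5,6) by blast
  qed
  then obtain c where c: "a = Suc c"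
    by (cases a) auto
  show ?case
  proof (cases "card V = 2 * a")
    case True
    \<comment> \<open>Complements of members of \<open>F\<close> are \<open>a\<close>-sets outside
      \<open>G\<close>, and \<open>(card V - a) choose a\<close> is 1 here.\<close>
    let ?F = "(\<lambda>A. V - A) ` F"
    have "inj_on (\<lambda>A. V - A) F"
      using psubset.prems(2) by (intro inj_onI) blast
    then have "card ?F = card F"
      by (rule card_image)
    moreover have "?F \<inter> G = {}"
      using psubset.prems(2,6) by blast
    moreover have "?F \<union> G \<subseteq> ?K"
      using psubset.prems(2,4) True finA by (auto simp: card_Diff_subset)
    ultimately have "card F + card G \<le> card ?K"
      using card_mono[OF finK, of "?F \<union> G"] fin[OF psubset.prems(2)] fin[OF psubset.prems(4)]
      by (simp add: card_Un_disjoint)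
    then show ?thesis
      using True psubset.hyps by (simp add: n_subsets)
  next
    case False
    then have big: "2 * Suc c < card V"
      using psubset.prems(1) c by simp
    then obtain v where v: "v \<in> V"
      by (metis card.empty ex_in_conv not_less_zero)
    define P where "P = (\<lambda>(F', G'). F' \<subseteq> ?K \<and> G' \<subseteq> ?K \<and> card F' = card F \<and> card G' = card G
      \<and> (\<forall>A\<in>F'. \<forall>B\<in>G'. 1 \<le> card (A \<inter> B)))"
    have ne: "card F \<noteq> 0" "card G \<noteq> 0"
      using fin psubset.prems by auto
    have "1 \<le> card (A \<inter> B)" if "A \<in> F" "B \<in> G" for A B
      using psubset.prems(6)[OF that] finA[of A] psubset.prems(2) that
      by (auto simp: Suc_le_eq card_gt_0_iff)
    then have "P (F, G)"
      using psubset.prems by (simp add: P_def)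
    \<comment> \<open>Both families are shifted simultaneously; a pair with the fewest members
      through \<open>v\<close> is stable away from \<open>v\<close>.\<close>
    define w where "w = (\<lambda>(F', G'). card {A \<in> F'. v \<in> A} + card {A \<in> G'. v \<in> A})"
    obtain X where PX: "P X" and min: "\<And>Y. P Y \<Longrightarrow> w X \<le> w Y"
      using ex_has_least_nat[of P "(F, G)" w] \<open>P (F, G)\<close> by auto
    obtain F' G' where X: "X = (F', G')"
      by (cases X)
    have F': "F' \<subseteq> ?K" "card F' = card F" and G': "G' \<subseteq> ?K" "card G' = card G"
      and cross: "\<And>A B. A \<in> F' \<Longrightarrow> B \<in> G' \<Longrightarrow> 1 \<le> card (A \<inter> B)"
      using PX by (auto simp: P_def X)
    have st: "stable i v F' \<and> stable i v G'" if i: "i \<in> V" for i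
    proof (cases "i = v")
      case True
      then show ?thesis by (auto simp: stable_def)
    next
      case iv: False
      have "P (shift i v F', shift i v G')"
      proof -
        have "1 \<le> card (A \<inter> B)" if "A \<in> shift i v F'" "B \<in> shift i v G'" for A B
          by (rule cross_intersecting_shift[OF cross _ iv that]) (use F'(1) G'(1) finA in auto)
        then show ?thesis
          using shift_uniform[OF F'(1) psubset.hyps i, of v]
            shift_uniform[OF G'(1) psubset.hyps i, of v] F'(2) G'(2) by (simp add: P_def)
      qed
      from min[OF this] have "w (F', G') \<le> w (shift i v F', shift i v G')"
        by (simp add: X)
      then show ?thesis
        using card_containing_shift_le[OF fin[OF F'(1)], of i v]
          card_containing_shift_le[OF fin[OF G'(1)], of i v]
          card_containing_shift_less[OF fin[OF F'(1)], of i v]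
          card_containing_shift_less[OF fin[OF G'(1)], of i v] by (force simp: w_def)
    qed
    have ne': "F' \<noteq> {}" "G' \<noteq> {}"
      using ne F' G' by auto
    have cross': "A \<inter> B \<noteq> {}" if "A \<in> F'" "B \<in> G'" for A B
      using cross[OF that] by auto
    have cross'': "B \<inter> A \<noteq> {}" if "B \<in> G'" "A \<in> F'" for A B
      using cross'[OF that(2,1)] by (simp add: Int_commute)
    have stF: "stable i v F'" and stG: "stable i v G'" if "i \<in> V" for i
      using st[OF that] by auto
    note FG = card_cross_intersecting_stable[OF psubset.hyps v big F'(1)[unfolded c] ne'(1) _
        G'(1)[unfolded c] ne'(2)]
    note GF = card_cross_intersecting_stable[OF psubset.hyps v big G'(1)[unfolded c] ne'(2) _
        F'(1)[unfolded c] ne'(1)]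
    have FG1: "deletion v F' \<noteq> {}" and GF1: "deletion v G' \<noteq> {}"
      using FG(1) GF(1) stF stG cross' cross'' by blast+
    have FG2: "A \<inter> B \<noteq> {}" if "A \<in> link v F'" "B \<in> link v G'" for A B
      using FG(2)[OF stF stG cross' that] .
    have FG3: "card (link v G') + ((card V - Suc (Suc c)) choose c) \<le> (card V - 1) choose c"
      using FG(3)[OF stF stG cross' FG1] .
    have GF3: "card (link v F') + ((card V - Suc (Suc c)) choose c) \<le> (card V - 1) choose c"
      using GF(3)[OF stG stF cross'' GF1] .
    let ?V = "V - {v}"
    have V: "?V \<subset> V" "card ?V = card V - 1" "1 \<le> card V"
      using v psubset.hyps big by auto
    have del: "card (deletion v F') + card (deletion v G') + ((card V - 1 - a) choose a)
        \<le> ((card V - 1) choose a) + 1"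
    proof -
      have "card (deletion v F') + card (deletion v G') + ((card ?V - a) choose a)
        \<le> (card ?V choose a) + 1"
        using big V(2) c cross'
        by (intro psubset.IH[OF V(1) _ deletion_uniform[OF F'(1)] FG1 deletion_uniform[OF G'(1)] GF1])
          (auto simp: deletion_def)
      then show ?thesis by (simp add: V(2))
    qed
    have sum: "card F + card G = card (deletion v F') + card (deletion v G') + (card (link v F') + card (link v G'))"
      using card_link_plus_card_deletion[OF fin[OF F'(1)], of v]
        card_link_plus_card_deletion[OF fin[OF G'(1)], of v] F'(2) G'(2) by simp
    have pascal: "n choose a = ((n - 1) choose c) + ((n - 1) choose a)" if "1 \<le> n" for n
      using that c by (cases n) auto
    note p1 = pascal[of "card V"]
    have e: "card V - a - 1 = card V - Suc (Suc c)" "card V - 1 - a = card V - Suc (Suc c)"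
      using c by auto
    have p2: "(card V - a) choose a = ((card V - Suc (Suc c)) choose c) + ((card V - 1 - a) choose a)"
      using pascal[of "card V - a"] big c e by simp
    \<comment> \<open>The induction hypothesis asks for nonempty families. If one link is empty, the
      bound obtained from a set avoiding \<open>v\<close> takes its place.\<close>
    consider "link v F' = {}" | "link v G' = {}" | "link v F' \<noteq> {}" "link v G' \<noteq> {}"
      by blast
    then have "card (link v F') + card (link v G') + ((card V - Suc (Suc c)) choose c) \<le> (card V - 1) choose c"
    proof cases
      case 1
      then show ?thesis using FG3 by simp
    next
      case 2
      then show ?thesis using GF3 by simp
    next
      case 3
      have "2 * c \<le> card ?V"
        using big V by simp
      then have IH: "card (link v F') + card (link v G') + ((card V - 1 - c) choose c) \<le> ((card V - 1) choose c) + 1"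
        using psubset.IH[OF V(1) _ link_uniform[OF F'(1)[unfolded c] psubset.hyps] 3(1)
            link_uniform[OF G'(1)[unfolded c] psubset.hyps] 3(2) FG2] V(2) by simp
      have "c \<noteq> 0"
      proof
        assume "c = 0"
        obtain A B where AB: "A \<in> link v F'" "B \<in> link v G'"
          using 3 by blast
        then have "A \<subseteq> V" "card A = 0"
          using link_uniform[OF F'(1)[unfolded c] psubset.hyps, of v] \<open>c = 0\<close> by auto
        then show False
          using FG2[OF AB] finA by auto
      qed
      \<comment> \<open>Two uses of the induction hypothesis, for deletions and for links, would
        give \<open>+ 2\<close>. The second 1 is absorbed by the Pascal summand with
        \<open>c - 1\<close>, which is positive.\<close>
      then have "(card V - 1 - c) choose c = ((card V - Suc (Suc c)) choose (c - 1)) + ((card V - Suc (Suc c)) choose c)"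
      proof -
        have "card V - 1 - c = Suc (card V - Suc (Suc c))"
          using big by simp
        moreover obtain e where "c = Suc e"
          using \<open>c \<noteq> 0\<close> by (cases c) auto
        ultimately show ?thesis by simp
      qed
      moreover have "1 \<le> (card V - Suc (Suc c)) choose (c - 1)"
        using big by (simp add: Suc_le_eq)
      ultimately show ?thesis
        using IH by linarith
    qed
    then show ?thesis
      using sum del p1 p2 V(3) by linarith
  qed
qed

section \<open>Nontrivial intersecting families\<close>

definition trivial_family :: "nat \<Rightarrow> 'a set set \<Rightarrow> bool" where
  "trivial_family t F \<longleftrightarrow> (\<exists>T. finite T \<and> card T = t \<and> (\<forall>A\<in>F. T \<subseteq> A))"

lemma trivial_familyI: "finite T \<Longrightarrow> card T = t \<Longrightarrow> (\<And>A. A \<in> F \<Longrightarrow> T \<subseteq> A) \<Longrightarrow> trivial_family t F"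
  by (auto simp: trivial_family_def)

lemma ksetsD:
  assumes "A \<in> ksets n k"
  shows "A \<subseteq> {1..n}" "card A = k" "finite A"
  using assms finite_subset[of A "{1..n}"] by (auto simp: ksets_def)

lemma finite_ksets [simp]: "finite (ksets n k)"
  by (rule finite_subset[of _ "Pow {1..n}"]) (auto simp: ksets_def)

lemma card_ksets_trace:
  assumes "S \<subseteq> {1..n}" "E \<subseteq> S" "card E \<le> k"
  shows "card {A \<in> ksets n k. A \<inter> S = E} = (n - card S) choose (k - card E)"
  using card_trace[OF _ assms] by (simp add: ksets_def conj_assoc)

lemma card_ksets_superset:
  assumes "S \<subseteq> {1..n}" "card S \<le> k"
  shows "card {A \<in> ksets n k. S \<subseteq> A} = (n - card S) choose (k - card S)"
proof -
  have "{A \<in> ksets n k. S \<subseteq> A} = {A \<in> ksets n k. A \<inter> S = S}"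
    by blast
  then show ?thesis
    using card_ksets_trace[OF assms(1) subset_refl assms(2)] by simp
qed

lemma t_less_k_of_nontrivial:
  assumes "H \<subseteq> ksets n k" "t_intersecting t H" "\<not> trivial_family t H"
  shows "t < k"
proof -
  have "H \<noteq> {}"
  proof
    assume "H = {}"
    then have "trivial_family t H"
      by (intro trivial_familyI[of "{..<t}"]) auto
    then show False using assms(3) by simp
  qed
  then obtain A where A: "A \<in> H"
    by blast
  have fin: "finite B" "card B = k" if "B \<in> H" for B
    using ksetsD[of B n k] assms(1) that by auto
  have "t \<le> k"
    using assms(2) A fin(2)[OF A] unfolding t_intersecting_def by (metis Int_absorb)
  moreover have "t \<noteq> k"
  proof
    assume "t = k"
    have "A \<subseteq> B" if B: "B \<in> H" for B
    proof -
      have "card A \<le> card (A \<inter> B)"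
        using assms(2) A B fin(2)[OF A] \<open>t = k\<close> by (simp add: t_intersecting_def)
      then show ?thesis
        using card_seteq[of A "A \<inter> B"] fin(1)[OF A] by auto
    qed
    then have "trivial_family t H"
      using fin[OF A] \<open>t = k\<close> by (intro trivial_familyI[of A]) simp_all
    then show False using assms(3) by simp
  qed
  ultimately show ?thesis by simp
qed

lemma t_intersecting_shift:
  assumes "H \<subseteq> ksets n k" "t_intersecting t H" "i \<noteq> j"
  shows "t_intersecting t (shift i j H)"
  unfolding t_intersecting_def
proof (intro ballI)
  fix A B assume AB: "A \<in> shift i j H" "B \<in> shift i j H"
  show "t \<le> card (A \<inter> B)"
    by (rule cross_intersecting_shift[OF _ _ assms(3) AB])
      (use assms(1,2) ksetsD(3) in \<open>auto simp: t_intersecting_def\<close>)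
qed

lemma ksets_shift:
  assumes "H \<subseteq> ksets n k" "1 \<le> i" "i \<le> n"
  shows "shift i j H \<subseteq> ksets n k"
  using shift_uniform[of H "{1..n}" k i j] assms by (simp add: ksets_def)

text \<open>A \<open>t\<close>-set common to the shifted family but not to \<open>H\<close> must
  contain \<open>x\<close> and miss \<open>y\<close>, since only these two elements are affected by
  the shift. Without \<open>x\<close> it is still common to \<open>H\<close>, and every member then
  contains \<open>x\<close> or \<open>y\<close>.\<close>

lemma trivial_shift_cases:
  assumes nontriv: "\<not> trivial_family t H" and "x \<noteq> y"
    and triv: "trivial_family t (shift x y H)"
  obtains T where "finite T" "card (insert x T) = t" "x \<notin> T" "y \<notin> T"
    "\<And>A. A \<in> H \<Longrightarrow> T \<subseteq> A" "\<And>A. A \<in> H \<Longrightarrow> x \<in> A \<or> y \<in> A"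
    "\<exists>A\<in>H. x \<notin> A" "\<exists>A\<in>H. y \<notin> A"
proof -
  obtain T0 where T0: "finite T0" "card T0 = t" "\<And>A. A \<in> shift x y H \<Longrightarrow> T0 \<subseteq> A"
    using triv by (auto simp: trivial_family_def)
  have sub: "T0 \<subseteq> shift_set x y H A" if "A \<in> H" for A
    using T0(3) that by (auto simp: shift_def)
  have not_sub: "\<exists>A\<in>H. \<not> T \<subseteq> A" if "finite T" "card T = t" for T
    using nontriv that by (auto simp: trivial_family_def)
  have or: "T0 \<subseteq> A \<or> y \<in> A \<and> x \<notin> A \<and> T0 \<subseteq> insert x (A - {y})" if "A \<in> H" for A
    using sub[OF that] by (auto simp: shift_set_def split: if_splits)
  have x: "x \<in> T0"
  proof (rule ccontr)
    assume "x \<notin> T0"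
    then have "T0 \<subseteq> A" if "A \<in> H" for A
      using or[OF that] by blast
    then show False
      using not_sub[OF T0(1,2)] by blast
  qed
  have y: "y \<notin> T0"
  proof
    assume "y \<in> T0"
    then have "T0 \<subseteq> A" if "A \<in> H" for A
      using or[OF that] assms(2) by blast
    then show False
      using not_sub[OF T0(1,2)] by blast
  qed
  show thesis
  proof (rule that[of "T0 - {x}"])
    show "card (insert x (T0 - {x})) = t"
      using T0(2) x by (simp add: insert_absorb)
    show TA: "T0 - {x} \<subseteq> A" if "A \<in> H" for A
      using or[OF that] by blast
    show xy: "x \<in> A \<or> y \<in> A" if "A \<in> H" for A
      using or[OF that] x by blast
    show "\<exists>A\<in>H. x \<notin> A"
    proof (rule ccontr)
      assume "\<not> ?thesis"
      then have "T0 \<subseteq> A" if "A \<in> H" for A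
        using TA that by blast
      then show False
        using not_sub[OF T0(1,2)] by blast
    qed
    show "\<exists>A\<in>H. y \<notin> A"
    proof (rule ccontr)
      assume "\<not> ?thesis"
      then have "insert y (T0 - {x}) \<subseteq> A" if "A \<in> H" for A
        using TA that by blast
      moreover have "card (insert y (T0 - {x})) = t"
        using card_swap[OF T0(1) x y] T0(2) by simp
      ultimately show False
        using not_sub[of "insert y (T0 - {x})"] T0(1) by blast
    qed
  qed (use T0(1) y in auto)
qed

text \<open>If a shift destroys nontriviality, then, after removing \<open>t - 1\<close> common elements, the family
  is an intersecting family covered by \<open>{x, y}\<close>, and the bound is the one of Hilton and Milner.\<close>

lemma card_le_of_trivial_shift:
  assumes H: "H \<subseteq> ksets n k" "t_intersecting t H" and nontriv: "\<not> trivial_family t H"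
    and n: "2 * k < n + t" and xy: "x \<noteq> y" "x \<in> {1..n}" "y \<in> {1..n}"
    and triv: "trivial_family t (shift x y H)"
  shows "card H + ((n - Suc k) choose (k - t)) \<le> ((n - t) choose (k - t)) + 1"
proof -
  obtain T where T: "finite T" "card (insert x T) = t" "x \<notin> T" "y \<notin> T"
    and TH: "\<And>A. A \<in> H \<Longrightarrow> T \<subseteq> A" and meet: "\<And>A. A \<in> H \<Longrightarrow> x \<in> A \<or> y \<in> A"
    and nx: "\<exists>A\<in>H. x \<notin> A" and ny: "\<exists>A\<in>H. y \<notin> A"
    using trivial_shift_cases[OF nontriv xy(1) triv] by metis
  have tk: "t < k"
    by (rule t_less_k_of_nontrivial[OF H nontriv])
  have cT: "Suc (card T) = t" "card (insert y T) = t"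
    using T by auto
  have Tn: "T \<subseteq> {1..n}"
    using nx TH H(1) ksetsD(1) by blast
  have finH: "finite H"
    by (rule finite_subset[OF H(1)]) simp
  have HA: "A \<subseteq> {1..n}" "card A = k" "finite A" if "A \<in> H" for A
    using ksetsD[of A n k] H(1) that by auto
  let ?S = "insert x (insert y T)"
  define V where "V = {1..n} - ?S"
  have S: "?S \<subseteq> {1..n}" "card ?S = Suc t"
    using xy T Tn cT by auto
  have V: "finite V" "card V = n - Suc t"
    using S by (auto simp: V_def card_Diff_subset T(1))
  \<comment> \<open>Members containing exactly one of \<open>x\<close>, \<open>y\<close> form two
    classes. Stripped of \<open>t\<close> elements each, they become \<open>(k - t)\<close>-sets in
    \<open>V\<close>; members of different classes can meet outside \<open>V\<close> only in
    \<open>T\<close>, which has \<open>t - 1\<close> elements, so the stripped families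
    cross-intersect.\<close>
  define X where "X u w = {A \<in> H. u \<in> A \<and> w \<notin> A}" for u w
  have X: "card ((\<lambda>A. A - insert u T) ` X u w) = card (X u w)"
    "(\<lambda>A. A - insert u T) ` X u w \<subseteq> {A. A \<subseteq> V \<and> card A = k - t}"
    if uw: "card (insert u T) = t" "{u, w} = {x, y}" for u w
  proof -
    have sub: "insert u T \<subseteq> A" if "A \<in> X u w" for A
      using that TH by (auto simp: X_def)
    have "inj_on (\<lambda>A. A - insert u T) (X u w)"
    proof (rule inj_onI)
      fix A B assume "A \<in> X u w" "B \<in> X u w" "A - insert u T = B - insert u T"
      then show "A = B" using sub[of A] sub[of B] by blast
    qed
    then show "card ((\<lambda>A. A - insert u T) ` X u w) = card (X u w)"
      by (rule card_image)
    have "A - insert u T \<subseteq> V" "card (A - insert u T) = k - t" if A: "A \<in> X u w" for A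
    proof -
      have "A \<in> H" "w \<notin> A"
        using A by (auto simp: X_def)
      then show "A - insert u T \<subseteq> V"
        using HA(1) uw(2) unfolding V_def by blast
      show "card (A - insert u T) = k - t"
        using HA[OF \<open>A \<in> H\<close>] sub[OF A] uw(1) T(1) by (simp add: card_Diff_subset)
    qed
    then show "(\<lambda>A. A - insert u T) ` X u w \<subseteq> {A. A \<subseteq> V \<and> card A = k - t}"
      by blast
  qed
  have cross: "A \<inter> B \<noteq> {}" if A: "A \<in> (\<lambda>A. A - insert x T) ` X x y"
    and B: "B \<in> (\<lambda>A. A - insert y T) ` X y x" for A B
  proof -
    obtain A' B' where A': "A' \<in> H" "y \<notin> A'" "A = A' - insert x T"
      and B': "B' \<in> H" "x \<notin> B'" "B = B' - insert y T"
      using A B by (auto simp: X_def)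
    have "\<not> A' \<inter> B' \<subseteq> T"
    proof
      assume "A' \<inter> B' \<subseteq> T"
      then have "card (A' \<inter> B') \<le> card T"
        using T(1) by (rule card_mono[rotated])
      then show False
        using H(2) A'(1) B'(1) cT(1) by (fastforce simp: t_intersecting_def)
    qed
    then show ?thesis
      using A' B' by blast
  qed
  have ne: "X x y \<noteq> {}" "X y x \<noteq> {}"
    using nx ny meet by (auto simp: X_def)
  have "card (X x y) + card (X y x) + ((card V - (k - t)) choose (k - t)) \<le> (card V choose (k - t)) + 1"
    using card_cross_intersecting[OF V(1) _ X(2)[OF T(2), of y] _ X(2)[OF cT(2), of x] _ cross]
      X(1)[OF T(2), of y] X(1)[OF cT(2), of x] ne V(2) n tk by (simp add: insert_commute)
  moreover have "card V - (k - t) = n - Suc k"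
    using V(2) tk by simp
  moreover have "card {A \<in> H. x \<in> A \<and> y \<in> A} \<le> card {A \<in> ksets n k. ?S \<subseteq> A}"
    using H(1) TH by (intro card_mono) auto
  moreover have "\<dots> = (n - Suc t) choose (k - Suc t)"
    using card_ksets_superset[OF S(1), of k] S(2) tk by simp
  moreover have "card H = card {A \<in> H. x \<in> A \<and> y \<in> A} + (card (X x y) + card (X y x))"
  proof -
    have "H = {A \<in> H. x \<in> A \<and> y \<in> A} \<union> (X x y \<union> X y x)"
      using meet by (auto simp: X_def)
    then have "card H = card ({A \<in> H. x \<in> A \<and> y \<in> A} \<union> (X x y \<union> X y x))"
      by simp
    also have "\<dots> = card {A \<in> H. x \<in> A \<and> y \<in> A} + card (X x y \<union> X y x)"
      using finH by (intro card_Un_disjoint) (auto simp: X_def)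
    also have "card (X x y \<union> X y x) = card (X x y) + card (X y x)"
      using finH by (intro card_Un_disjoint) (auto simp: X_def)
    finally show ?thesis .
  qed
  moreover have "(n - t) choose (k - t) = ((n - Suc t) choose (k - Suc t)) + ((n - Suc t) choose (k - t))"
  proof -
    have "n - t = Suc (n - Suc t)" "k - t = Suc (k - Suc t)"
      using n tk by auto
    then show ?thesis
      by (metis binomial_Suc_Suc)
  qed
  ultimately show ?thesis
    using V(2) by simp
qed

section \<open>Generating sets of extremal compressed families\<close>

lemma binomial_Suc_mult: "Suc k * (n choose Suc k) = (n - k) * (n choose k)"
  by (simp only: binomial_absorption binomial_absorb_comp)

text \<open>The quotient of the two sides is \<open>((n - a) * (n - b)) / (Suc a * Suc b)\<close>,
  with \<open>n - b > Suc a\<close> and \<open>n - a > Suc b\<close>. It refutes the product of the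
  two inequalities for complementary sizes.\<close>

lemma binomial_product_less:
  assumes "a + b + 1 < n"
  shows "(n choose a) * (n choose b) < (n choose Suc a) * (n choose Suc b)"
proof -
  have pos: "0 < (n choose a) * (n choose b)"
    using assms by simp
  have "(Suc a * Suc b) * ((n choose a) * (n choose b)) < ((n - b) * (n - a)) * ((n choose a) * (n choose b))"
    using pos assms by (intro mult_less_mono1 mult_strict_mono) auto
  also have "\<dots> = ((n - a) * (n choose a)) * ((n - b) * (n choose b))"
    by (simp only: ac_simps)
  also have "\<dots> = (Suc a * (n choose Suc a)) * (Suc b * (n choose Suc b))"
    by (simp only: binomial_Suc_mult)
  also have "\<dots> = (Suc a * Suc b) * ((n choose Suc a) * (n choose Suc b))"
    by (simp only: ac_simps)
  finally show ?thesis
    by (rule mult_less_cancel1[THEN iffD1, THEN conjunct2])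
qed

definition nontrivial_intersecting :: "nat \<Rightarrow> nat \<Rightarrow> nat \<Rightarrow> nat set set \<Rightarrow> bool" where
  "nontrivial_intersecting n k t F \<longleftrightarrow>
     F \<subseteq> ksets n k \<and> t_intersecting t F \<and> \<not> trivial_family t F"

text \<open>Elements are added one at a time, outside \<open>B\<close> if possible. If
  \<open>A\<close> and \<open>B\<close> already cover \<open>{1..n}\<close>, counting shows that
  they meet in at most \<open>t - 2\<close> elements, so one more common element does no
  harm.\<close>

lemma extend_small_intersection:
  assumes "A \<subseteq> {1..n}" "card A \<le> k" "B \<subseteq> {1..n}" "card B \<le> k" "card (A \<inter> B) < t"
    and n: "2 * k < n + t" "k \<le> n"
  obtains A' where "A' \<in> ksets n k" "A \<subseteq> A'" "card (A' \<inter> B) < t"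
proof -
  have "\<exists>A'\<in>ksets n k. A \<subseteq> A' \<and> card (A' \<inter> B) < t"
    using assms(1,2,5)
  proof (induction "k - card A" arbitrary: A)
    case 0
    then have "A \<in> ksets n k"
      by (simp add: ksets_def)
    then show ?case using 0 by blast
  next
    case (Suc c)
    have fin: "finite A" "finite B"
      using Suc.prems(1) assms(3) by (auto intro: finite_subset)
    have less: "card A < k"
      using Suc.hyps(2) by simp
    have "\<exists>q\<in>{1..n} - A. card (insert q A \<inter> B) < t"
    proof (cases "A \<union> B = {1..n}")
      case False
      then obtain q where q: "q \<in> {1..n}" "q \<notin> A" "q \<notin> B"
        using Suc.prems(1) assms(3) by blast
      then have "insert q A \<inter> B = A \<inter> B"
        by blast
      then show ?thesis
        using q Suc.prems(3) by (intro bexI[of _ q]) auto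
    next
      case True
      have "card A + card B = n + card (A \<inter> B)"
        using card_Un_Int[OF fin] True by simp
      then have small: "Suc (card (A \<inter> B)) < t"
        using less assms(4) n by simp
      have "card A < card {1..n}"
        using less n(2) by simp
      then obtain q where q: "q \<in> {1..n}" "q \<notin> A"
        by (metis Suc.prems(1) less_irrefl subsetI subset_antisym)
      have "card (insert q A \<inter> B) \<le> card (insert q (A \<inter> B))"
        using fin by (intro card_mono) auto
      also have "\<dots> \<le> Suc (card (A \<inter> B))"
        using fin by (simp add: card_insert_if)
      finally show ?thesis
        using q small by (intro bexI[of _ q]) auto
    qed
    then obtain q where q: "q \<in> {1..n}" "q \<notin> A" "card (insert q A \<inter> B) < t"
      by blast
    have "\<exists>A'\<in>ksets n k. insert q A \<subseteq> A' \<and> card (A' \<inter> B) < t"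
      using Suc q fin less by (intro Suc.hyps(1)) auto
    then show ?case by blast
  qed
  then show thesis using that by blast
qed

locale extremal_compressed =
  fixes n k t :: nat and F :: "nat set set"
  assumes nontriv: "nontrivial_intersecting n k t F"
    and maximal: "\<And>G. nontrivial_intersecting n k t G \<Longrightarrow> card G \<le> card F"
    and compressed: "\<And>i j. 1 \<le> i \<Longrightarrow> i < j \<Longrightarrow> j \<le> n \<Longrightarrow> stable i j F"
    and t_pos: "1 \<le> t"
    and n_large: "(t + 1) * (k - t + 1) < n"
begin

lemma F_ksets: "F \<subseteq> ksets n k" and F_inter: "t_intersecting t F" and F_nontriv: "\<not> trivial_family t F"
  using nontriv by (auto simp: nontrivial_intersecting_def)

lemma t_less_k: "t < k"
  by (rule t_less_k_of_nontrivial[OF F_ksets F_inter F_nontriv])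

lemma n_ge: "2 * k + 2 \<le> n + t"
proof -
  obtain d where d: "k = t + d" "0 < d"
    using t_less_k less_imp_add_positive by blast
  have "1 * d \<le> t * d"
    using t_pos by (intro mult_right_mono) auto
  moreover have "(t + 1) * (k - t + 1) = t * d + t + d + 1"
    using d by (simp add: algebra_simps)
  ultimately show ?thesis
    using n_large d by linarith
qed

lemma n_gt: "k < n"
  using n_ge t_less_k by simp

text \<open>No generating system is chosen: every set of at most \<open>k\<close> elements in
  \<open>{1..s}\<close> whose \<open>k\<close>-supersets all belong to \<open>F\<close> counts. Thus
  the minimal generators are canonical, and compression passes to the generators.\<close>

definition gens :: "nat \<Rightarrow> nat set set" where
  "gens s = {E. E \<subseteq> {1..s} \<and> card E \<le> k \<and> (\<forall>B\<in>ksets n k. E \<subseteq> B \<longrightarrow> B \<in> F)}"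

definition min_gens :: "nat \<Rightarrow> nat set set" where
  "min_gens s = {E \<in> gens s. \<forall>E'\<in>gens s. \<not> E' \<subset> E}"

lemma gensD:
  assumes "E \<in> gens s"
  shows "E \<subseteq> {1..s}" "card E \<le> k" "finite E" "B \<in> ksets n k \<Longrightarrow> E \<subseteq> B \<Longrightarrow> B \<in> F"
  using assms finite_subset[of E "{1..s}"] by (auto simp: gens_def)

lemma min_gens_gens: "E \<in> min_gens s \<Longrightarrow> E \<in> gens s"
  by (simp add: min_gens_def)

lemma finite_gens [simp]: "finite (gens s)"
  by (rule finite_subset[of _ "Pow {1..s}"]) (auto simp: gens_def)

lemma finite_min_gens [simp]: "finite (min_gens s)"
  by (simp add: min_gens_def)

lemma F_gens: "A \<in> F \<Longrightarrow> A \<in> gens n"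
proof -
  assume A: "A \<in> F"
  have K: "A \<in> ksets n k"
    using A F_ksets by blast
  have "B = A" if "B \<in> ksets n k" "A \<subseteq> B" for B
    using card_subset_eq[OF ksetsD(3)[OF that(1)] that(2)] ksetsD(2)[OF that(1)] ksetsD(2)[OF K] by simp
  then show "A \<in> gens n"
    using A ksetsD[OF K] by (auto simp: gens_def)
qed

lemma ex_min_gen:
  assumes "E \<in> gens s"
  obtains E' where "E' \<in> min_gens s" "E' \<subseteq> E"
proof -
  obtain E' where "E' \<in> gens s" "E' \<subseteq> E" "\<forall>D\<in>gens s. D \<subseteq> E' \<longrightarrow> E' = D"
    using finite_has_minimal2[OF finite_gens assms] by blast
  then show thesis
    by (intro that[of E']) (auto simp: min_gens_def)
qed

text \<open>Two generators meeting in fewer than \<open>t\<close> elements could be completed, one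
  after the other, to members of \<open>F\<close> that still do. Different ranges are allowed so
  that members of \<open>F\<close>, which are generators in \<open>{1..n}\<close>, can be compared
  with short ones.\<close>

lemma gens_inter:
  assumes E: "E1 \<in> gens s" "E2 \<in> gens s'" and s: "s \<le> n" "s' \<le> n"
  shows "t \<le> card (E1 \<inter> E2)"
proof (rule ccontr)
  assume "\<not> ?thesis"
  then have less: "card (E1 \<inter> E2) < t"
    by simp
  have sub: "E1 \<subseteq> {1..n}" "E2 \<subseteq> {1..n}"
    using gensD(1)[OF E(1)] gensD(1)[OF E(2)] s by force+
  have n: "2 * k < n + t" "k \<le> n"
    using n_ge n_gt by simp_all
  obtain A where A: "A \<in> ksets n k" "E1 \<subseteq> A" "card (A \<inter> E2) < t"
    by (rule extend_small_intersection[OF sub(1) gensD(2)[OF E(1)] sub(2) gensD(2)[OF E(2)] less n])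
  have less': "card (E2 \<inter> A) < t"
    using A(3) by (simp add: Int_commute)
  have "card A \<le> k"
    using ksetsD(2)[OF A(1)] by simp
  then obtain B where B: "B \<in> ksets n k" "E2 \<subseteq> B" "card (B \<inter> A) < t"
    by (rule extend_small_intersection[OF sub(2) gensD(2)[OF E(2)] ksetsD(1)[OF A(1)] _ less' n])
  have "A \<in> F" "B \<in> F"
    using gensD(4)[OF E(1) A(1,2)] gensD(4)[OF E(2) B(1,2)] by auto
  then show False
    using F_inter B(3) by (force simp: t_intersecting_def)
qed

text \<open>A generator of size \<open>t\<close> meets every member of \<open>F\<close> in
  \<open>t\<close> elements, so it would be contained in all of them.\<close>

lemma gens_card:
  assumes "E \<in> gens s" "s \<le> n"
  shows "t < card E"
proof (rule ccontr)
  assume "\<not> ?thesis"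
  moreover have "t \<le> card E"
    using gens_inter[OF assms(1) assms(1) assms(2) assms(2)] by simp
  ultimately have t: "card E = t"
    by simp
  have "E \<subseteq> A" if A: "A \<in> F" for A
  proof -
    have "card E \<le> card (E \<inter> A)"
      using gens_inter[OF assms(1) F_gens[OF A] assms(2) order_refl] t by simp
    then show ?thesis
      using card_seteq[of E "E \<inter> A"] gensD(3)[OF assms(1)] by auto
  qed
  then show False
    using F_nontriv t gensD(3)[OF assms(1)] trivial_familyI by blast
qed

text \<open>A \<open>k\<close>-superset of the new set that misses \<open>j\<close> is turned into a
  superset of \<open>E\<close> by undoing the trade, and compression of \<open>F\<close> brings it
  back.\<close>

lemma gens_shift:
  assumes E: "E \<in> gens s" "s \<le> n" "j \<in> E" "i \<notin> E" "1 \<le> i" "i < j"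
  shows "insert i (E - {j}) \<in> gens s"
proof -
  note D = gensD[OF E(1)]
  have "j \<le> s"
    using D(1) E(3) by auto
  have "B \<in> F" if B: "B \<in> ksets n k" "insert i (E - {j}) \<subseteq> B" for B
  proof (cases "j \<in> B")
    case True
    then show ?thesis using D(4) B by blast
  next
    case False
    let ?B = "insert j (B - {i})"
    have "?B \<in> ksets n k"
      using ksetsD[OF B(1)] B(2) False card_swap[of B i j] \<open>j \<le> s\<close> E by (auto simp: ksets_def)
    then have "?B \<in> F"
      using D(4) B(2) E(4) by blast
    moreover have "stable i j F"
      using compressed E \<open>j \<le> s\<close> by simp
    ultimately have "insert i (?B - {j}) \<in> F"
      using stableD[of i j F ?B] E(6) by auto
    moreover have "insert i (?B - {j}) = B"
      using B(2) False by auto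
    ultimately show ?thesis by simp
  qed
  moreover have "card (insert i (E - {j})) = card E"
    using D(3) E by (intro card_swap)
  moreover have "insert i (E - {j}) \<subseteq> {1..s}"
    using D(1) E \<open>j \<le> s\<close> by auto
  ultimately show ?thesis
    using D(2) by (simp add: gens_def)
qed

section \<open>The least generating interval and the generators through its right end\<close>

definition width :: nat where
  "width = (LEAST s. \<forall>A\<in>F. \<exists>E\<in>gens s. E \<subseteq> A)"

lemma width_le: "width \<le> n"
  unfolding width_def using F_gens by (intro Least_le) blast

lemma width_covers: "A \<in> F \<Longrightarrow> \<exists>E\<in>gens width. E \<subseteq> A"
proof -
  have "\<forall>A\<in>F. \<exists>E\<in>gens n. E \<subseteq> A"
    using F_gens by blast
  then have "\<forall>A\<in>F. \<exists>E\<in>gens width. E \<subseteq> A"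
    unfolding width_def by (rule LeastI)
  then show "A \<in> F \<Longrightarrow> \<exists>E\<in>gens width. E \<subseteq> A" by blast
qed

lemma min_width_covers:
  assumes "A \<in> F"
  obtains E where "E \<in> min_gens width" "E \<subseteq> A"
  using width_covers[OF assms] ex_min_gen by (metis order_trans)

lemma width_minimal:
  assumes "s < width"
  obtains A where "A \<in> F" "\<And>E. E \<in> gens s \<Longrightarrow> \<not> E \<subseteq> A"
  using not_less_Least[OF assms[unfolded width_def]] by blast

lemma F_subset_small_width:
  assumes "width \<le> s" "A \<in> F"
  shows "t + 1 \<le> card (A \<inter> {1..s})"
proof -
  obtain E where E: "E \<in> gens width" "E \<subseteq> A"
    using width_covers[OF assms(2)] by blast
  have "E \<subseteq> A \<inter> {1..s}"
    using E(2) gensD(1)[OF E(1)] assms(1) by auto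
  then have "card E \<le> card (A \<inter> {1..s})"
    by (intro card_mono) auto
  then show ?thesis
    using gens_card[OF E(1) width_le] by simp
qed

definition top_gens :: "nat set set" where
  "top_gens = {E \<in> min_gens width. width \<in> E}"

lemma top_gensD:
  assumes "E \<in> top_gens"
  shows "E \<in> min_gens width" "E \<in> gens width" "width \<in> E" "E - {width} \<notin> gens width"
    "E \<subseteq> {1..width}" "finite E" "card E \<le> k" "t < card E"
proof -
  show 1: "E \<in> min_gens width" "E \<in> gens width" "width \<in> E"
    using assms by (auto simp: top_gens_def min_gens_def)
  show "E - {width} \<notin> gens width"
    using 1 by (auto simp: min_gens_def)
  show "E \<subseteq> {1..width}" "finite E" "card E \<le> k" "t < card E"
    using gensD[OF 1(2)] gens_card[OF 1(2) width_le] by auto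
qed

lemma finite_top_gens [simp]: "finite top_gens"
  by (simp add: top_gens_def)

lemma not_top_gens_width: "E \<in> min_gens width \<Longrightarrow> E \<notin> top_gens \<Longrightarrow> width \<notin> E"
  by (simp add: top_gens_def)

lemma top_gens_ne:
  assumes "0 < width"
  shows "top_gens \<noteq> {}"
proof
  assume empty: "top_gens = {}"
  obtain A where A: "A \<in> F" "\<And>E. E \<in> gens (width - 1) \<Longrightarrow> \<not> E \<subseteq> A"
    using width_minimal[of "width - 1"] assms by auto
  obtain E where E: "E \<in> min_gens width" "E \<subseteq> A"
    by (rule min_width_covers[OF A(1)])
  have "width \<notin> E"
    using not_top_gens_width[OF E(1)] empty by simp
  then have "E \<subseteq> {1..width - 1}"
    using gensD(1)[OF min_gens_gens[OF E(1)]] by (auto simp: subset_eq) (metis One_nat_def Suc_pred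
        assms le_Suc_eq)
  then have "E \<in> gens (width - 1)"
    using min_gens_gens[OF E(1)] by (simp add: gens_def)
  then show False
    using A(2) E(2) by blast
qed

text \<open>Compression moves \<open>width\<close> down to any other free position below it; the result is covered by a
  generator of smaller width.\<close>

lemma top_gens_exchange:
  assumes "E \<in> top_gens" "q \<in> {1..width}" "q \<notin> E"
  obtains E' where "E' \<in> min_gens width" "E' \<notin> top_gens" "E' \<subseteq> insert q (E - {width})"
    "insert q (E - {width}) \<in> gens width"
proof -
  note D = top_gensD[OF assms(1)]
  have "q < width"
    using assms D(3) by (metis atLeastAtMost_iff le_neq_implies_less)
  then have g: "insert q (E - {width}) \<in> gens width"
    using gens_shift[OF D(2) width_le D(3) assms(3)] assms(2) by simp
  then obtain E' where E': "E' \<in> min_gens width" "E' \<subseteq> insert q (E - {width})"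
    by (rule ex_min_gen)
  then have "E' \<notin> top_gens"
    using \<open>q < width\<close> by (auto simp: top_gens_def)
  then show thesis
    using that E' g by blast
qed

text \<open>By minimality some \<open>k\<close>-set above \<open>E - {width}\<close> is not in
  \<open>F\<close>. It has no further element in \<open>{1..width}\<close>, since an exchange would
  put it into \<open>F\<close>; so its remaining elements lie beyond \<open>width\<close>. This
  makes the binomials that count gains positive.\<close>

lemma top_gens_room:
  assumes "E \<in> top_gens"
  shows "k + 1 - card E \<le> n - width"
proof -
  note D = top_gensD[OF assms]
  have "card (E - {width}) \<le> k" "E - {width} \<subseteq> {1..width}"
    using D card_Diff1_le[of E width] by auto
  then obtain B where B: "B \<in> ksets n k" "E - {width} \<subseteq> B" "B \<notin> F"
    using D(4) by (auto simp: gens_def)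
  have "B \<inter> {1..width} = E - {width}"
  proof
    show "B \<inter> {1..width} \<subseteq> E - {width}"
    proof
      fix q assume q: "q \<in> B \<inter> {1..width}"
      show "q \<in> E - {width}"
      proof (rule ccontr)
        assume nq: "q \<notin> E - {width}"
        show False
        proof (cases "q \<in> E")
          case True
          then have "E \<subseteq> B"
            using nq q B(2) by blast
          then show False
            using gensD(4)[OF D(2) B(1)] B(3) by blast
        next
          case False
          have "insert q (E - {width}) \<in> gens width"
            using top_gens_exchange[OF assms _ False] q by blast
          then show False
            using gensD(4)[of _ width B] B q by blast
        qed
      qed
    qed
    show "E - {width} \<subseteq> B \<inter> {1..width}"
      using B(2) D(5) by blast
  qed
  then have "card (B - {1..width}) = k - (card E - 1)"
    using ksetsD[OF B(1)] D(3,6) by (simp add: card_Diff_subset_Int)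
  moreover have "card (B - {1..width}) \<le> card ({1..n} - {1..width})"
    using ksetsD(1)[OF B(1)] by (intro card_mono) auto
  moreover have "card ({1..n} - {1..width}) = n - width"
    using width_le by (subst card_Diff_subset) auto
  moreover have "1 \<le> card E"
    using D(8) by simp
  ultimately show ?thesis by simp
qed

text \<open>Otherwise an uncovered \<open>q\<close> replaces \<open>width\<close> in one generator,
  and the result meets the other one in only \<open>t - 1\<close> elements.\<close>

lemma top_gens_union:
  assumes "E1 \<in> top_gens" "E2 \<in> top_gens" "card (E1 \<inter> E2) = t"
  shows "E1 \<union> E2 = {1..width}"
proof (rule ccontr)
  note D1 = top_gensD[OF assms(1)] and D2 = top_gensD[OF assms(2)]
  assume "E1 \<union> E2 \<noteq> {1..width}"
  then obtain q where q: "q \<in> {1..width}" "q \<notin> E1" "q \<notin> E2"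
    using D1(5) D2(5) by blast
  have "insert q (E1 - {width}) \<in> gens width"
    using top_gens_exchange[OF assms(1) q(1,2)] by blast
  then have "t \<le> card (insert q (E1 - {width}) \<inter> E2)"
    using gens_inter D2(2) width_le by blast
  moreover have "insert q (E1 - {width}) \<inter> E2 = (E1 \<inter> E2) - {width}"
    using q by blast
  moreover have "card ((E1 \<inter> E2) - {width}) = t - 1"
    using D1(3) D2(3) assms(3) by simp
  ultimately show False
    using t_pos by simp
qed

lemma top_gens_card_sum:
  assumes "E1 \<in> top_gens" "E2 \<in> top_gens" "card (E1 \<inter> E2) = t"
  shows "card E1 + card E2 = width + t"
  using card_Un_Int[OF top_gensD(6)[OF assms(1)] top_gensD(6)[OF assms(2)]] top_gens_union[OF assms] assms(3)
  by simp

end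

section \<open>Deleting the right end from generators\<close>

context extremal_compressed
begin

text \<open>The generators in \<open>Q'\<close> lose \<open>width\<close> and those in
  \<open>Q\<close> are dropped. The two classes are disjoint for distinct complementary sizes,
  whereas \<open>Q' \<subseteq> Q\<close> in the balanced case.\<close>

definition pushed_gens :: "nat set set \<Rightarrow> nat set set \<Rightarrow> nat set set" where
  "pushed_gens Q Q' = (min_gens width - Q) \<union> (\<lambda>E. E - {width}) ` Q'"

definition pushed :: "nat set set \<Rightarrow> nat set set \<Rightarrow> nat set set" where
  "pushed Q Q' = {B \<in> ksets n k. \<exists>E\<in>pushed_gens Q Q'. E \<subseteq> B}"

lemma pushed_gens_cases:
  assumes "X \<in> pushed_gens Q Q'"
  obtains (kept) "X \<in> min_gens width" "X \<notin> Q" | (push) E where "E \<in> Q'" "X = E - {width}"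
  using assms by (auto simp: pushed_gens_def)

lemma pushed_gens_bounds:
  assumes "X \<in> pushed_gens Q Q'" "Q' \<subseteq> top_gens"
  shows "X \<subseteq> {1..width}" "card X \<le> k" "finite X"
proof -
  have "X \<subseteq> {1..width} \<and> card X \<le> k"
    using assms(1)
  proof (cases rule: pushed_gens_cases)
    case kept
    then show ?thesis using gensD(1,2)[OF min_gens_gens] by simp
  next
    case (push E)
    then have "E \<in> top_gens"
      using assms(2) by blast
    from top_gensD(5,7)[OF this] show ?thesis
      using push(2) card_Diff1_le[of E width] by auto
  qed
  then show 1: "X \<subseteq> {1..width}" "card X \<le> k"
    by auto
  show "finite X"
    by (rule finite_subset[OF 1(1)]) simp
qed

text \<open>An intersection can only lose the element \<open>width\<close>, and only if both sets
  contained it; so pairs meeting in exactly \<open>t\<close> elements are the ones to rule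
  out.\<close>

lemma pushed_gens_inter:
  assumes Q: "Q' \<subseteq> top_gens"
    and h1: "\<And>E1 E2. E1 \<in> Q' \<Longrightarrow> E2 \<in> top_gens \<Longrightarrow> card (E1 \<inter> E2) = t \<Longrightarrow> E2 \<in> Q"
    and h2: "\<And>E1 E2. E1 \<in> Q' \<Longrightarrow> E2 \<in> Q' \<Longrightarrow> card (E1 \<inter> E2) \<noteq> t"
    and X: "X \<in> pushed_gens Q Q'" "Y \<in> pushed_gens Q Q'"
  shows "t \<le> card (X \<inter> Y)"
proof -
  have gt: "t \<le> card ((E1 \<inter> E2) - {width})"
    if "E1 \<in> top_gens" "E2 \<in> gens width" "width \<in> E2" "card (E1 \<inter> E2) \<noteq> t" for E1 E2
  proof -
    have "t < card (E1 \<inter> E2)"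
      using gens_inter[OF top_gensD(2)[OF that(1)] that(2) width_le width_le] that(4) by simp
    then show ?thesis
      using that(3) top_gensD(3)[OF that(1)] by simp
  qed
  have mixed: "t \<le> card ((E - {width}) \<inter> Y)" if E: "E \<in> Q'" and Y: "Y \<in> min_gens width" "Y \<notin> Q" for E Y
  proof (cases "width \<in> Y")
    case True
    then have "Y \<in> top_gens"
      using Y(1) by (simp add: top_gens_def)
    then have "t \<le> card ((E \<inter> Y) - {width})"
      using gt[of E Y] h1[OF E, of Y] Y(2) E Q True min_gens_gens[OF Y(1)] by blast
    moreover have "(E - {width}) \<inter> Y = (E \<inter> Y) - {width}"
      by blast
    ultimately show ?thesis by simp
  next
    case False
    then have "(E - {width}) \<inter> Y = E \<inter> Y"
      by blast
    moreover have "E \<in> gens width"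
      using top_gensD(2) E Q by blast
    ultimately show ?thesis
      using gens_inter[OF _ min_gens_gens[OF Y(1)] width_le width_le] by simp
  qed
  show ?thesis
    using X(1)
  proof (cases rule: pushed_gens_cases)
    case X: kept
    show ?thesis
      using assms(5)
    proof (cases rule: pushed_gens_cases)
      case kept
      then show ?thesis
        using gens_inter[OF min_gens_gens min_gens_gens width_le width_le] X by simp
    next
      case (push E)
      then show ?thesis
        using mixed[OF push(1) X] by (simp add: Int_commute)
    qed
  next
    case X: (push E)
    show ?thesis
      using assms(5)
    proof (cases rule: pushed_gens_cases)
      case kept
      then show ?thesis
        using mixed[OF X(1) kept] X(2) by simp
    next
      case (push E')
      have "t \<le> card ((E \<inter> E') - {width})"
        using gt[of E E'] h2[OF X(1) push(1)] X(1) push(1) Q top_gensD(2,3) by blast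
      moreover have "(E - {width}) \<inter> (E' - {width}) = (E \<inter> E') - {width}"
        by blast
      ultimately show ?thesis
        using X(2) push(2) by simp
    qed
  qed
qed

lemma pushed_inter:
  assumes "Q' \<subseteq> top_gens"
    and "\<And>E1 E2. E1 \<in> Q' \<Longrightarrow> E2 \<in> top_gens \<Longrightarrow> card (E1 \<inter> E2) = t \<Longrightarrow> E2 \<in> Q"
    and "\<And>E1 E2. E1 \<in> Q' \<Longrightarrow> E2 \<in> Q' \<Longrightarrow> card (E1 \<inter> E2) \<noteq> t"
  shows "t_intersecting t (pushed Q Q')"
  unfolding t_intersecting_def
proof (intro ballI)
  fix A B assume A: "A \<in> pushed Q Q'" and B: "B \<in> pushed Q Q'"
  obtain X where X: "X \<in> pushed_gens Q Q'" "X \<subseteq> A"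
    using A by (auto simp: pushed_def)
  obtain Y where Y: "Y \<in> pushed_gens Q Q'" "Y \<subseteq> B"
    using B by (auto simp: pushed_def)
  have "t \<le> card (X \<inter> Y)"
    using assms X(1) Y(1) by (rule pushed_gens_inter)
  also have "\<dots> \<le> card (A \<inter> B)"
    using X(2) Y(2) ksetsD(3)[of A n k] A by (intro card_mono) (auto simp: pushed_def)
  finally show "t \<le> card (A \<inter> B)" .
qed

lemma card_trace_width:
  assumes "E \<subseteq> {1..width}" "card E \<le> k"
  shows "card {B \<in> ksets n k. B \<inter> {1..width} = E} = (n - width) choose (k - card E)"
  using card_ksets_trace[of "{1..width}" n E k] assms width_le by simp

text \<open>The \<open>k\<close>-sets with trace exactly \<open>E - {width}\<close> are new: a
  generator below such a set would be properly contained in the minimal generator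
  \<open>E\<close>.\<close>

lemma card_pushed_gain:
  assumes Q': "Q' \<subseteq> top_gens"
  shows "card (F \<inter> pushed Q Q') + (\<Sum>E\<in>Q'. (n - width) choose (k + 1 - card E)) \<le> card (pushed Q Q')"
proof -
  define U where "U E = {B \<in> ksets n k. B \<inter> {1..width} = E - {width}}" for E
  have finQ': "finite Q'"
    by (rule finite_subset[OF Q']) simp
  have "card (\<Union>E\<in>Q'. U E) = (\<Sum>E\<in>Q'. card (U E))"
  proof (rule card_UN_disjoint[OF finQ'])
    show "\<forall>E\<in>Q'. finite (U E)"
      by (simp add: U_def)
    show "\<forall>E\<in>Q'. \<forall>E'\<in>Q'. E \<noteq> E' \<longrightarrow> U E \<inter> U E' = {}"
    proof (intro ballI impI)
      fix E E' assume E: "E \<in> Q'" "E' \<in> Q'" "E \<noteq> E'"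
      then have "E = insert width (E - {width})" "E' = insert width (E' - {width})"
        using top_gensD(3) Q' by blast+
      then have "E - {width} \<noteq> E' - {width}"
        using E(3) by metis
      then show "U E \<inter> U E' = {}"
        by (auto simp: U_def)
    qed
  qed
  also have "\<dots> = (\<Sum>E\<in>Q'. (n - width) choose (k + 1 - card E))"
  proof (rule sum.cong[OF refl])
    fix E assume "E \<in> Q'"
    then have E: "E \<in> top_gens"
      using Q' by blast
    note D = top_gensD[OF E]
    have c: "card (E - {width}) = card E - 1"
      using D(3,6) by simp
    have "card (U E) = (n - width) choose (k - card (E - {width}))"
      unfolding U_def using D(5,7) c by (intro card_trace_width) auto
    moreover have "k - card (E - {width}) = k + 1 - card E"
      using c D(8) by simp
    ultimately show "card (U E) = (n - width) choose (k + 1 - card E)"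
      by simp
  qed
  finally have cU: "card (\<Union>E\<in>Q'. U E) = (\<Sum>E\<in>Q'. (n - width) choose (k + 1 - card E))" .
  have "B \<notin> F" if "E \<in> Q'" "B \<in> U E" for E B
  proof
    assume "B \<in> F"
    then obtain E' where E': "E' \<in> min_gens width" "E' \<subseteq> B"
      by (rule min_width_covers)
    have E: "E \<in> top_gens"
      using that(1) Q' by blast
    have "E' \<subseteq> B \<inter> {1..width}"
      using E' gensD(1)[OF min_gens_gens[OF E'(1)]] by blast
    then have "E' \<subset> E"
      using that(2) top_gensD(3)[OF E] by (auto simp: U_def)
    then show False
      using top_gensD(1)[OF E] min_gens_gens[OF E'(1)] by (auto simp: min_gens_def)
  qed
  then have "(F \<inter> pushed Q Q') \<inter> (\<Union>E\<in>Q'. U E) = {}"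
    by blast
  moreover have fin: "finite (pushed Q Q')"
    by (simp add: pushed_def)
  moreover have sub: "(\<Union>E\<in>Q'. U E) \<subseteq> pushed Q Q'"
    by (auto simp: U_def pushed_def pushed_gens_def)
  ultimately have "card (F \<inter> pushed Q Q') + card (\<Union>E\<in>Q'. U E) = card ((F \<inter> pushed Q Q') \<union> (\<Union>E\<in>Q'. U E))"
    by (subst card_Un_disjoint) (auto intro: finite_subset)
  also have "\<dots> \<le> card (pushed Q Q')"
    using sub by (intro card_mono[OF fin]) auto
  finally show ?thesis
    by (simp add: cU)
qed

text \<open>The trace of a lost set is exactly a discarded \<open>E\<close>: if it contained another
  \<open>q\<close>, the exchange would give a generator that is kept and lies below it.\<close>

lemma card_pushed_loss:
  assumes Q: "Q \<subseteq> top_gens" and Q': "Q' \<subseteq> top_gens"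
  shows "card (F - pushed Q Q') \<le> (\<Sum>E\<in>Q - Q'. (n - width) choose (k - card E))"
proof -
  define U where "U E = {B \<in> ksets n k. B \<inter> {1..width} = E}" for E
  have finQ: "finite (Q - Q')"
    by (rule finite_subset[of _ top_gens]) (use Q in auto)
  have "F - pushed Q Q' \<subseteq> (\<Union>E\<in>Q - Q'. U E)"
  proof
    fix B assume B: "B \<in> F - pushed Q Q'"
    then have K: "B \<in> ksets n k"
      using F_ksets by blast
    have none: "\<not> X \<subseteq> B" if "X \<in> pushed_gens Q Q'" for X
      using B K that by (auto simp: pushed_def)
    obtain E where E: "E \<in> min_gens width" "E \<subseteq> B"
      using min_width_covers[of B] B by blast
    have EQ: "E \<in> Q"
      using none[of E] E by (auto simp: pushed_gens_def)
    then have ET: "E \<in> top_gens"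
      using Q by blast
    have "E \<notin> Q'"
      using none[of "E - {width}"] E(2) by (auto simp: pushed_gens_def)
    moreover have "q \<in> E" if q: "q \<in> B" "q \<in> {1..width}" for q
    proof (rule ccontr)
      assume "q \<notin> E"
      then obtain E' where "E' \<in> min_gens width" "E' \<notin> top_gens" "E' \<subseteq> insert q (E - {width})"
        using top_gens_exchange[OF ET q(2)] by blast
      then have "E' \<in> pushed_gens Q Q'" "E' \<subseteq> B"
        using Q q(1) E(2) by (auto simp: pushed_gens_def)
      then show False
        using none by blast
    qed
    then have "B \<inter> {1..width} = E"
      using E(2) top_gensD(5)[OF ET] by blast
    ultimately show "B \<in> (\<Union>E\<in>Q - Q'. U E)"
      using EQ K by (auto simp: U_def)
  qed
  moreover have "finite (\<Union>E\<in>Q - Q'. U E)"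
    using finQ by (simp add: U_def)
  ultimately have "card (F - pushed Q Q') \<le> card (\<Union>E\<in>Q - Q'. U E)"
    by (rule card_mono[rotated])
  also have "\<dots> \<le> (\<Sum>E\<in>Q - Q'. card (U E))"
    by (rule card_UN_le[OF finQ])
  also have "\<dots> = (\<Sum>E\<in>Q - Q'. (n - width) choose (k - card E))"
  proof (rule sum.cong[OF refl])
    fix E assume "E \<in> Q - Q'"
    then have "E \<in> top_gens"
      using Q by blast
    then show "card (U E) = (n - width) choose (k - card E)"
      unfolding U_def using top_gensD(5,7) by (intro card_trace_width) auto
  qed
  finally show ?thesis .
qed

lemma card_pushed:
  assumes "Q \<subseteq> top_gens" "Q' \<subseteq> top_gens"
  shows "card F + (\<Sum>E\<in>Q'. (n - width) choose (k + 1 - card E))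
    \<le> card (pushed Q Q') + (\<Sum>E\<in>Q - Q'. (n - width) choose (k - card E))"
proof -
  have "finite F"
    by (rule finite_subset[OF F_ksets]) simp
  then have "card F = card (F \<inter> pushed Q Q') + card (F - pushed Q Q')"
    by (subst card_Un_disjoint[symmetric]) (auto intro: arg_cong[where f = card])
  then show ?thesis
    using card_pushed_gain[OF assms(2), of Q] card_pushed_loss[OF assms] by linarith
qed

text \<open>Since \<open>k < n\<close>, a pushed generator extends to a \<open>k\<close>-set
  avoiding any prescribed outside point, so \<open>T\<close> lies in every pushed generator. If a
  discarded \<open>E\<close> misses \<open>p \<in> T\<close> and also another \<open>q\<close>, the
  exchange at \<open>q\<close> gives a kept generator without \<open>p\<close>, a contradiction;
  hence \<open>E\<close> misses only \<open>p\<close>.\<close>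

lemma pushed_trivial:
  assumes triv: "trivial_family t (pushed Q Q')" and Q: "Q \<subseteq> top_gens" "Q' \<subseteq> top_gens" "Q' \<noteq> {}"
  obtains T p where "T \<subseteq> {1..width}" "card T = t" "p \<in> T" "{1..width} - {p} \<in> Q"
    "\<And>E. E \<in> min_gens width \<Longrightarrow> \<not> T \<subseteq> E \<Longrightarrow> \<exists>p\<in>T. E = {1..width} - {p}"
proof -
  obtain T where T: "finite T" "card T = t" "\<And>A. A \<in> pushed Q Q' \<Longrightarrow> T \<subseteq> A"
    using triv by (auto simp: trivial_family_def)
  have TX: "T \<subseteq> X" if X: "X \<in> pushed_gens Q Q'" for X
  proof
    fix p assume p: "p \<in> T"
    show "p \<in> X"
    proof (rule ccontr)
      assume np: "p \<notin> X"
      note b = pushed_gens_bounds[OF X Q(2)]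
      have "card {1..n} - 1 \<le> card ({1..n} - {p})"
        by (simp add: card_Diff_singleton_if)
      then have "k \<le> card ({1..n} - {p})"
        using n_gt by simp
      moreover have "X \<subseteq> {1..n} - {p}"
        using b(1) width_le np by force
      ultimately obtain B where B: "X \<subseteq> B" "B \<subseteq> {1..n} - {p}" "card B = k"
        using exists_subset_between[of X k "{1..n} - {p}"] b(2) by auto
      then have "B \<in> pushed Q Q'"
        using X by (auto simp: pushed_def ksets_def)
      then show False
        using T(3) p B(2) by blast
    qed
  qed
  have kept: "T \<subseteq> E" if "E \<in> min_gens width" "E \<notin> Q" for E
    using TX that by (auto simp: pushed_gens_def)
  have shape: "E = {1..width} - {p}" if E: "E \<in> Q" and p: "p \<in> T" "p \<notin> E" for E p
  proof -
    have ET: "E \<in> top_gens"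
      using E Q(1) by blast
    have "q \<in> E" if q: "q \<in> {1..width}" "q \<noteq> p" for q
    proof (rule ccontr)
      assume "q \<notin> E"
      then obtain E' where E': "E' \<in> min_gens width" "E' \<notin> top_gens" "E' \<subseteq> insert q (E - {width})"
        using top_gens_exchange[OF ET q(1)] by blast
      then have "T \<subseteq> E'"
        using kept Q(1) by blast
      then show False
        using p q(2) E'(3) by blast
    qed
    then show ?thesis
      using top_gensD(5)[OF ET] p(2) by blast
  qed
  have shape': "\<exists>p\<in>T. E = {1..width} - {p}" if "E \<in> min_gens width" "\<not> T \<subseteq> E" for E
    using kept[OF that(1)] shape[of E] that(2) by blast
  have "\<exists>E\<in>min_gens width. \<not> T \<subseteq> E"
  proof (rule ccontr)
    assume *: "\<not> ?thesis"
    have "T \<subseteq> A" if A: "A \<in> F" for A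
      using min_width_covers[OF A] * by (metis order_trans)
    then show False
      using F_nontriv trivial_familyI[OF T(1,2)] by blast
  qed
  then obtain E p where "E \<in> Q" "p \<in> T" "p \<notin> E"
    using kept by blast
  then have p: "p \<in> T" "{1..width} - {p} \<in> Q"
    using shape by auto
  obtain E where "E \<in> Q'"
    using Q(3) by blast
  then have "T \<subseteq> E - {width}" "E \<in> top_gens"
    using TX[of "E - {width}"] Q(2) by (auto simp: pushed_gens_def)
  then have "T \<subseteq> {1..width}"
    using top_gensD(5) by blast
  then show thesis
    using that[OF _ T(2) p shape'] by blast
qed

text \<open>Members containing \<open>T\<close> do not have trace exactly \<open>T\<close>, because
  generators have more than \<open>t\<close> elements. Any other member has trace
  \<open>{1..width} - {p}\<close> for one of the \<open>t\<close> points \<open>p\<close> of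
  \<open>T\<close>.\<close>

lemma card_F_of_shape:
  assumes T: "T \<subseteq> {1..width}" "card T = t" and w: "width \<le> k + 1" "t < width"
    and shape: "\<And>E. E \<in> min_gens width \<Longrightarrow> \<not> T \<subseteq> E \<Longrightarrow> \<exists>p\<in>T. E = {1..width} - {p}"
  shows "card F + ((n - width) choose (k - t))
    \<le> ((n - t) choose (k - t)) + t * ((n - width) choose (k + 1 - width))"
proof -
  define X where "X = {A \<in> ksets n k. T \<subseteq> A}"
  define Y where "Y = {A \<in> ksets n k. A \<inter> {1..width} = T}"
  define Z where "Z p = {A \<in> ksets n k. A \<inter> {1..width} = {1..width} - {p}}" for p
  have finT: "finite T"
    using T(1) finite_subset by auto
  have "F \<subseteq> (X - Y) \<union> (\<Union>p\<in>T. Z p)"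
  proof
    fix A assume A: "A \<in> F"
    then have K: "A \<in> ksets n k"
      using F_ksets by blast
    obtain E where E: "E \<in> min_gens width" "E \<subseteq> A"
      by (rule min_width_covers[OF A])
    have E': "E \<subseteq> {1..width}" "t < card E"
      using gensD(1) gens_card[OF _ width_le] min_gens_gens[OF E(1)] by auto
    show "A \<in> (X - Y) \<union> (\<Union>p\<in>T. Z p)"
    proof (cases "T \<subseteq> A")
      case True
      have "\<not> E \<subseteq> T"
        using card_mono[OF finT, of E] E'(2) T(2) by auto
      then have "A \<inter> {1..width} \<noteq> T"
        using E(2) E'(1) by blast
      then show ?thesis
        using K True by (simp add: X_def Y_def)
    next
      case False
      then obtain p where "p \<in> T" "E = {1..width} - {p}"
        using shape[OF E(1)] E(2) by blast
      moreover from this have "p \<notin> A"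
        using False E(2) T(1) by blast
      ultimately have "A \<in> Z p"
        using K E(2) by (auto simp: Z_def)
      then show ?thesis
        using \<open>p \<in> T\<close> by blast
    qed
  qed
  moreover have "finite ((X - Y) \<union> (\<Union>p\<in>T. Z p))"
    using finT by (simp add: X_def Z_def)
  ultimately have "card F \<le> card ((X - Y) \<union> (\<Union>p\<in>T. Z p))"
    by (rule card_mono[rotated])
  also have "\<dots> \<le> card (X - Y) + card (\<Union>p\<in>T. Z p)"
    by (rule card_Un_le)
  also have "card (\<Union>p\<in>T. Z p) \<le> (\<Sum>p\<in>T. card (Z p))"
    by (rule card_UN_le[OF finT])
  also have "\<dots> = (\<Sum>p\<in>T. (n - width) choose (k + 1 - width))"
  proof (rule sum.cong[OF refl])
    fix p assume "p \<in> T"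
    then have c: "card ({1..width} - {p}) = width - 1"
      using T(1) by (subst card_Diff_singleton) auto
    have "card (Z p) = (n - width) choose (k - (width - 1))"
      unfolding Z_def c[symmetric] using w c by (intro card_trace_width) auto
    moreover have "k - (width - 1) = k + 1 - width"
      using w by simp
    ultimately show "card (Z p) = (n - width) choose (k + 1 - width)"
      by simp
  qed
  also have "\<dots> = t * ((n - width) choose (k + 1 - width))"
    using T(2) by simp
  finally have "card F \<le> card (X - Y) + t * ((n - width) choose (k + 1 - width))"
    by simp
  moreover have "card (X - Y) = card X - card Y"
    using T(1) by (intro card_Diff_subset) (auto simp: X_def Y_def)
  moreover have "card Y \<le> card X"
    by (intro card_mono) (auto simp: X_def Y_def)
  moreover have "card X = (n - t) choose (k - t)"
    unfolding X_def using card_ksets_superset[of T n k] T t_less_k width_le by force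
  moreover have "card Y = (n - width) choose (k - t)"
    unfolding Y_def using card_trace_width[OF T(1)] T(2) t_less_k by simp
  ultimately show ?thesis by linarith
qed

text \<open>Stated additively to avoid truncated subtraction; \<open>shape_size\<close> later is the
  same bound over the integers.\<close>

definition shape_bound :: bool where
  "shape_bound \<longleftrightarrow> t < width \<and> width \<le> k + 1 \<and> card F + ((n - width) choose (k - t))
    \<le> ((n - t) choose (k - t)) + t * ((n - width) choose (k + 1 - width))"

text \<open>A nontrivial pushed family is no larger than \<open>F\<close>, so the gain is at most
  the loss; a trivial one forces the shape. The clause on \<open>width - 1\<close> records which set
  creates the shape, so that the balanced case can exclude it by size.\<close>

lemma push_dichotomy:
  assumes Q: "Q \<subseteq> top_gens" "Q' \<subseteq> top_gens" "Q' \<noteq> {}" and w: "t < width"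
    and h1: "\<And>E1 E2. E1 \<in> Q' \<Longrightarrow> E2 \<in> top_gens \<Longrightarrow> card (E1 \<inter> E2) = t \<Longrightarrow> E2 \<in> Q"
    and h2: "\<And>E1 E2. E1 \<in> Q' \<Longrightarrow> E2 \<in> Q' \<Longrightarrow> card (E1 \<inter> E2) \<noteq> t"
  shows "shape_bound \<and> (\<exists>E\<in>Q. card E = width - 1) \<or>
    (\<Sum>E\<in>Q'. (n - width) choose (k + 1 - card E)) \<le> (\<Sum>E\<in>Q - Q'. (n - width) choose (k - card E))"
proof (cases "trivial_family t (pushed Q Q')")
  case True
  obtain T p where T: "T \<subseteq> {1..width}" "card T = t" "p \<in> T" "{1..width} - {p} \<in> Q"
    "\<And>E. E \<in> min_gens width \<Longrightarrow> \<not> T \<subseteq> E \<Longrightarrow> \<exists>p\<in>T. E = {1..width} - {p}"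
    using pushed_trivial[OF True Q] by metis
  have c: "card ({1..width} - {p}) = width - 1"
    using T(1,3) by (subst card_Diff_singleton) auto
  have "{1..width} - {p} \<in> top_gens"
    using T(4) Q(1) by blast
  from top_gensD(7)[OF this] have "width \<le> k + 1"
    using c by simp
  then have "shape_bound"
    using card_F_of_shape[OF T(1,2) _ w T(5)] w by (simp add: shape_bound_def)
  then show ?thesis
    using T(4) c by blast
next
  case False
  have "t_intersecting t (pushed Q Q')"
    using Q(2) h1 h2 by (rule pushed_inter)
  then have "nontrivial_intersecting n k t (pushed Q Q')"
    using False by (auto simp: nontrivial_intersecting_def pushed_def)
  then show ?thesis
    using maximal card_pushed[OF Q(1,2)] by fastforce
qed

lemma shape_bound_unbalanced:
  assumes E0: "E0 \<in> top_gens" "2 * card E0 \<noteq> width + t" and w: "t < width"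
  shows shape_bound
proof (rule ccontr)
  assume no: "\<not> shape_bound"
  define i j where "i = card E0" and "j = width + t - card E0"
  define R where "R l = {E \<in> top_gens. card E = l}" for l
  have R: "R l \<subseteq> top_gens" "finite (R l)" for l
    by (auto simp: R_def)
  have ij: "i + j = width + t" "i \<noteq> j"
    using card_mono[OF _ top_gensD(5)[OF E0(1)]] E0(2) by (auto simp: i_def j_def)
  let ?N = "n - width"
  have le: "card (R u) * (?N choose (k + 1 - u)) \<le> card (R v) * (?N choose (k - v))"
    if uv: "u + v = width + t" "u \<noteq> v" and ne: "R u \<noteq> {}" for u v
  proof -
    have "R v - R u = R v"
      using uv(2) by (auto simp: R_def)
    moreover have "shape_bound \<and> (\<exists>E\<in>R v. card E = width - 1) \<or>
      (\<Sum>E\<in>R u. ?N choose (k + 1 - card E)) \<le> (\<Sum>E\<in>R v - R u. ?N choose (k - card E))"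
    proof (rule push_dichotomy[OF R(1) R(1) ne w])
      fix E1 E2 assume "E1 \<in> R u" "E2 \<in> top_gens" "card (E1 \<inter> E2) = t"
      then show "E2 \<in> R v"
        using top_gens_card_sum[of E1 E2] uv(1) by (simp add: R_def)
    next
      fix E1 E2 assume "E1 \<in> R u" "E2 \<in> R u"
      then show "card (E1 \<inter> E2) \<noteq> t"
        using top_gens_card_sum[of E1 E2] uv by (auto simp: R_def)
    qed
    ultimately have "(\<Sum>E\<in>R u. ?N choose (k + 1 - card E)) \<le> (\<Sum>E\<in>R v. ?N choose (k - card E))"
      using no by simp
    moreover have "(\<Sum>E\<in>R u. ?N choose (k + 1 - card E)) = (\<Sum>E\<in>R u. ?N choose (k + 1 - u))"
      by (rule sum.cong) (auto simp: R_def)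
    moreover have "(\<Sum>E\<in>R v. ?N choose (k - card E)) = (\<Sum>E\<in>R v. ?N choose (k - v))"
      by (rule sum.cong) (auto simp: R_def)
    ultimately show ?thesis by simp
  qed
  have Ri: "R i \<noteq> {}"
    using E0(1) by (auto simp: R_def i_def)
  \<comment> \<open>The gain of a pushed member is positive, so an empty complementary class, which
    means no loss, contradicts the inequality.\<close>
  have posA: "0 < ?N choose (k + 1 - i)"
    using top_gens_room[OF E0(1)] by (simp add: i_def)
  have "0 < card (R i) * (?N choose (k + 1 - i))"
    using Ri R(2) posA by (simp add: card_gt_0_iff)
  then have "0 < card (R j)"
    using le[OF ij Ri] by (metis gr0I mult_0 not_le)
  then have Rj: "R j \<noteq> {}"
    by auto
  then obtain E1 where E1: "E1 \<in> top_gens" "card E1 = j"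
    by (auto simp: R_def)
  have b: "i \<le> k" "j \<le> k" "k + 1 - i \<le> ?N" "k + 1 - j \<le> ?N"
    using top_gensD(7)[OF E0(1)] top_gensD(7)[OF E1(1)] E1(2) top_gens_room[OF E0(1)]
      top_gens_room[OF E1(1)] by (simp_all add: i_def)
  \<comment> \<open>The inequalities for pushing \<open>R i\<close> and for pushing
    \<open>R j\<close> are multiplied, and the class sizes cancel.\<close>
  have "(card (R i) * (?N choose (k + 1 - i))) * (card (R j) * (?N choose (k + 1 - j)))
      \<le> (card (R j) * (?N choose (k - j))) * (card (R i) * (?N choose (k - i)))"
    using ij by (intro mult_mono le Ri Rj) (auto simp: add.commute)
  then have "(card (R i) * card (R j)) * ((?N choose (k + 1 - i)) * (?N choose (k + 1 - j)))
      \<le> (card (R i) * card (R j)) * ((?N choose (k - i)) * (?N choose (k - j)))"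
    by (simp only: ac_simps)
  moreover have "0 < card (R i) * card (R j)"
    using Ri Rj R(2) by (simp add: card_gt_0_iff)
  ultimately have "(?N choose (k + 1 - i)) * (?N choose (k + 1 - j)) \<le> (?N choose (k - i)) * (?N choose (k - j))"
    by (simp only: nat_mult_le_cancel1)
  moreover have "(?N choose (k - i)) * (?N choose (k - j)) < (?N choose Suc (k - i)) * (?N choose Suc (k - j))"
    using b ij(1) n_ge width_le by (intro binomial_product_less) linarith
  moreover have "Suc (k - i) = k + 1 - i" "Suc (k - j) = k + 1 - j"
    using b by auto
  ultimately show False by simp
qed

text \<open>In the balanced case a whole class cannot be pushed; averaging over the positions below
  \<open>width\<close> finds a large subclass whose members all miss one position \<open>q\<close>.\<close>

lemma balanced_impossible:
  assumes E0: "E0 \<in> top_gens" "2 * card E0 = width + t" and w: "t + 2 < width"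
  shows False
proof -
  define i where "i = card E0"
  define R where "R = {E \<in> top_gens. card E = i}"
  define S where "S q = {E \<in> R. q \<notin> E}" for q
  have R: "R \<subseteq> top_gens" "finite R" "R \<noteq> {}"
    using E0(1) by (auto simp: R_def i_def)
  let ?N = "n - width"
  define r where "r = width - i"
  have r: "width = t + 2 * r" "i = t + r" "2 \<le> r"
    using E0(2) w by (auto simp: r_def i_def)
  have b: "i \<le> k" "k + 1 - i \<le> ?N"
    using top_gensD(7)[OF E0(1)] top_gens_room[OF E0(1)] by (simp_all add: i_def)
  define a where "a = k - i"
  have a: "k + 1 - i = Suc a" "Suc a \<le> ?N"
    using b by (auto simp: a_def)
  \<comment> \<open>Double counting: every member of \<open>R\<close> misses \<open>r\<close>
    positions, all of them below \<open>width\<close>.\<close>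
  have "(\<Sum>q\<in>{1..<width}. card (S q)) = (\<Sum>q\<in>{1..<width}. \<Sum>E\<in>R. if q \<notin> E then 1 else 0)"
    using R(2) by (intro sum.cong refl) (simp add: S_def sum.If_cases Int_def conj_commute)
  also have "\<dots> = (\<Sum>E\<in>R. \<Sum>q\<in>{1..<width}. if q \<notin> E then 1 else 0)"
    by (rule sum.swap)
  also have "\<dots> = (\<Sum>E\<in>R. r)"
  proof (rule sum.cong[OF refl])
    fix E assume "E \<in> R"
    then have E: "E \<in> top_gens" "card E = i"
      by (auto simp: R_def)
    note D = top_gensD[OF E(1)]
    have "{1..<width} \<inter> {q. q \<notin> E} = {1..width} - E"
      using D(3) by (auto simp: order_le_less)
    then have "(\<Sum>q\<in>{1..<width}. if q \<notin> E then 1 else 0) = card ({1..width} - E)"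
      by (simp add: sum.If_cases)
    also have "\<dots> = r"
      using D(5,6) E(2) by (simp add: card_Diff_subset r_def)
    finally show "(\<Sum>q\<in>{1..<width}. if q \<notin> E then 1 else 0) = r" .
  qed
  finally have sum: "(\<Sum>q\<in>{1..<width}. card (S q)) = card R * r"
    by simp
  have "\<exists>q\<in>{1..<width}. card R * r \<le> (width - 1) * card (S q)"
  proof (rule ccontr)
    assume "\<not> ?thesis"
    then have *: "\<And>q. q \<in> {1..<width} \<Longrightarrow> (width - 1) * card (S q) < card R * r"
      by (auto simp: not_le)
    have "(\<Sum>q\<in>{1..<width}. (width - 1) * card (S q)) < (\<Sum>q\<in>{1..<width}. card R * r)"
      using w by (intro sum_strict_mono *) auto
    then show False
      using sum by (simp add: sum_distrib_left[symmetric])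
  qed
  then obtain q where q: "q \<in> {1..<width}" "card R * r \<le> (width - 1) * card (S q)"
    by blast
  have S: "S q \<subseteq> R"
    by (auto simp: S_def)
  have finS: "finite (S q)"
    using S R(2) by (rule finite_subset)
  have "0 < card R * r"
    using R r(3) by (simp add: card_gt_0_iff)
  then have Sne: "S q \<noteq> {}"
    using q(2) by auto
  have "shape_bound \<and> (\<exists>E\<in>R. card E = width - 1) \<or>
    (\<Sum>E\<in>S q. ?N choose (k + 1 - card E)) \<le> (\<Sum>E\<in>R - S q. ?N choose (k - card E))"
  proof (rule push_dichotomy[OF R(1) _ Sne])
    show "S q \<subseteq> top_gens" "t < width"
      using S R(1) w by auto
    fix E1 E2 assume E: "E1 \<in> S q" "E2 \<in> top_gens" "card (E1 \<inter> E2) = t"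
    then show "E2 \<in> R"
      using top_gens_card_sum[of E1 E2] E0(2) by (simp add: R_def S_def i_def)
  next
    fix E1 E2 assume E: "E1 \<in> S q" "E2 \<in> S q"
    then have "E1 \<in> top_gens" "E2 \<in> top_gens" "q \<notin> E1 \<union> E2"
      by (auto simp: S_def R_def)
    then show "card (E1 \<inter> E2) \<noteq> t"
      using top_gens_union[of E1 E2] q(1) by (metis atLeastLessThan_iff atLeastAtMost_iff less_imp_le)
  qed
  moreover have "\<not> (\<exists>E\<in>R. card E = width - 1)"
    using r by (auto simp: R_def)
  moreover have "(\<Sum>E\<in>S q. ?N choose (k + 1 - card E)) = (\<Sum>E\<in>S q. ?N choose Suc a)"
    using a(1) by (intro sum.cong) (auto simp: S_def R_def)
  moreover have "(\<Sum>E\<in>R - S q. ?N choose (k - card E)) = (\<Sum>E\<in>R - S q. ?N choose a)"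
    by (intro sum.cong) (auto simp: R_def a_def)
  ultimately have "card (S q) * (?N choose Suc a) \<le> card (R - S q) * (?N choose a)"
    by simp
  moreover have "card (R - S q) + card (S q) = card R"
    using card_Diff_subset[OF finS S] card_mono[OF R(2) S] by simp
  \<comment> \<open>The same multiple of \<open>?N choose a\<close> is added to both sides: on the
    right \<open>R - S q\<close> is completed to \<open>R\<close>, and on the left Pascal's rule
    applies.\<close>
  ultimately have "card (S q) * (?N choose Suc a) + card (S q) * (?N choose a) \<le> card R * (?N choose a)"
    by (metis add_le_mono1 add_mult_distrib)
  then have "card (S q) * (Suc ?N choose Suc a) \<le> card R * (?N choose a)"
    by (simp add: algebra_simps)
  then have "Suc a * (card (S q) * (Suc ?N choose Suc a)) \<le> Suc a * (card R * (?N choose a))"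
    by (rule mult_le_mono2)
  moreover have "Suc a * (card (S q) * (Suc ?N choose Suc a)) = (card (S q) * Suc ?N) * (?N choose a)"
    using Suc_times_binomial[of a ?N] by (metis mult.assoc mult.left_commute)
  moreover have "Suc a * (card R * (?N choose a)) = (card R * Suc a) * (?N choose a)"
    by (simp only: ac_simps)
  moreover have "0 < ?N choose a"
    using a(2) by simp
  ultimately have le: "card (S q) * Suc ?N \<le> card R * Suc a"
    by (metis mult_le_cancel2)
  have "card R * (r * Suc ?N) = (card R * r) * Suc ?N"
    by (simp only: ac_simps)
  also have "\<dots> \<le> ((width - 1) * card (S q)) * Suc ?N"
    using q(2) by (rule mult_le_mono1)
  also have "\<dots> = (width - 1) * (card (S q) * Suc ?N)"
    by (simp only: ac_simps)
  also have "\<dots> \<le> (width - 1) * (card R * Suc a)"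
    using le by (rule mult_le_mono2)
  also have "\<dots> = card R * ((width - 1) * Suc a)"
    by (simp only: ac_simps)
  finally have "r * Suc ?N \<le> (width - 1) * Suc a"
    using R by (simp only: nat_mult_le_cancel1 card_gt_0_iff simp_thms)
  then have "int r * (int n - int t - 2 * int r + 1) \<le> (int t + 2 * int r - 1) * (int k - int t - int r + 1)"
    using r a b width_le by (simp only: of_nat_le_iff[symmetric, where 'a = int] of_nat_mult a_def)
      (simp add: of_nat_diff algebra_simps)
  \<comment> \<open>The terms \<open>r * (t + 2 * r - 1)\<close> on both sides cancel.\<close>
  then have up: "int r * int n \<le> (int t + 2 * int r - 1) * (int k - int t + 1)"
    by (simp add: algebra_simps)
  have "(int t + 2 * int r - 1) * (int k - int t + 1) \<le> (int r * (int t + 1)) * (int k - int t + 1)"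
  proof (rule mult_right_mono)
    have "0 \<le> (int r - 1) * (int t - 1)"
      using r(3) t_pos by simp
    then show "int t + 2 * int r - 1 \<le> int r * (int t + 1)"
      by (simp add: algebra_simps)
  qed (use t_less_k in simp)
  also have "\<dots> < int r * int n"
  proof -
    have "(int t + 1) * (int k - int t + 1) < int n"
    proof -
      have "int ((t + 1) * (k - t + 1)) < int n"
        using n_large by (simp only: of_nat_less_iff)
      moreover have "int ((t + 1) * (k - t + 1)) = (int t + 1) * (int k - int t + 1)"
      proof -
        obtain d where "k = t + d"
          using t_less_k less_imp_add_positive by blast
        then show ?thesis by (simp add: algebra_simps)
      qed
      ultimately show ?thesis by simp
    qed
    then have "int r * ((int t + 1) * (int k - int t + 1)) < int r * int n"
      using r(3) by (intro mult_strict_left_mono) auto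
    then show ?thesis
      by (simp only: mult.assoc)
  qed
  finally show False
    using up by simp
qed

theorem width_dichotomy: "width \<le> t + 2 \<or> shape_bound"
proof (cases "width \<le> t + 2")
  case False
  then obtain E where E: "E \<in> top_gens"
    using top_gens_ne by fastforce
  show ?thesis
    using balanced_impossible[OF E] shape_bound_unbalanced[OF E] False by fastforce
qed simp

end

section \<open>The nontrivial intersection theorem of Ahlswede and Khachatrian\<close>

text \<open>The largest family of the exceptional shape, with \<open>T = {1..t}\<close>. Realising
  the bound by a family lets the endpoints \<open>s = t + 2\<close> and \<open>s = k + 1\<close> be
  compared with \<open>EM\<close> and \<open>AK\<close> by inclusion.\<close>

definition shape_family :: "nat \<Rightarrow> nat \<Rightarrow> nat \<Rightarrow> nat \<Rightarrow> nat set set" where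
  "shape_family n k t s = {A \<in> ksets n k. {1..t} \<subseteq> A \<and> A \<inter> {1..s} \<noteq> {1..t}} \<union>
     (\<Union>p\<in>{1..t}. {A \<in> ksets n k. A \<inter> {1..s} = {1..s} - {p}})"

definition shape_size :: "nat \<Rightarrow> nat \<Rightarrow> nat \<Rightarrow> nat \<Rightarrow> int" where
  "shape_size n k t s = int ((n - t) choose (k - t)) - int ((n - s) choose (k - t))
     + int t * int ((n - s) choose (k + 1 - s))"

lemma card_shape_family:
  assumes "t < s" "s \<le> k + 1" "s \<le> n" "t \<le> k"
  shows "int (card (shape_family n k t s)) = shape_size n k t s"
proof -
  define X where "X = {A \<in> ksets n k. {1..t} \<subseteq> A}"
  define Y where "Y = {A \<in> ksets n k. A \<inter> {1..s} = {1..t}}"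
  define Z where "Z p = {A \<in> ksets n k. A \<inter> {1..s} = {1..s} - {p}}" for p
  have fin: "finite X" "finite Y" "finite (Z p)" for p
    by (auto simp: X_def Y_def Z_def)
  have YX: "Y \<subseteq> X"
    by (auto simp: X_def Y_def)
  have "card (\<Union>p\<in>{1..t}. Z p) = (\<Sum>p\<in>{1..t}. card (Z p))"
  proof (rule card_UN_disjoint)
    show "\<forall>p\<in>{1..t}. \<forall>q\<in>{1..t}. p \<noteq> q \<longrightarrow> Z p \<inter> Z q = {}"
    proof (intro ballI impI)
      fix p q assume pq: "p \<in> {1..t}" "q \<in> {1..t}" "p \<noteq> q"
      then have "p \<in> {1..s} - {q}" "p \<notin> {1..s} - {p}"
        using assms(1) by auto
      then show "Z p \<inter> Z q = {}"
        unfolding Z_def by blast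
    qed
  qed (use fin in auto)
  also have "\<dots> = (\<Sum>p\<in>{1..t}. (n - s) choose (k + 1 - s))"
  proof (rule sum.cong[OF refl])
    fix p assume "p \<in> {1..t}"
    then have c: "card ({1..s} - {p}) = s - 1"
      using assms(1) by (subst card_Diff_singleton) auto
    have "card (Z p) = (n - card {1..s}) choose (k - card ({1..s} - {p}))"
      unfolding Z_def using assms c by (intro card_ksets_trace) auto
    moreover have "k - (s - 1) = k + 1 - s"
      using assms by simp
    ultimately show "card (Z p) = (n - s) choose (k + 1 - s)"
      using c by simp
  qed
  finally have cZ: "card (\<Union>p\<in>{1..t}. Z p) = t * ((n - s) choose (k + 1 - s))"
    by simp
  have "Z p \<inter> X = {}" if p: "p \<in> {1..t}" for p
  proof -
    have "p \<in> {1..s}"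
      using p assms(1) by simp
    then have "p \<notin> A" if "A \<in> Z p" for A
      using that by (auto simp: Z_def set_eq_iff)
    then show ?thesis
      using p by (auto simp: X_def)
  qed
  then have "(X - Y) \<inter> (\<Union>p\<in>{1..t}. Z p) = {}"
    by blast
  then have "card ((X - Y) \<union> (\<Union>p\<in>{1..t}. Z p)) = card (X - Y) + t * ((n - s) choose (k + 1 - s))"
    using fin cZ by (subst card_Un_disjoint) auto
  moreover have "shape_family n k t s = (X - Y) \<union> (\<Union>p\<in>{1..t}. Z p)"
    by (auto simp: shape_family_def X_def Y_def Z_def)
  moreover have "card (X - Y) = card X - card Y"
    using fin YX by (intro card_Diff_subset)
  moreover have "card Y \<le> card X"
    using fin YX by (intro card_mono)
  moreover have "card X = (n - t) choose (k - t)"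
    unfolding X_def using card_ksets_superset[of "{1..t}" n k] assms by simp
  moreover have "card Y = (n - s) choose (k - t)"
    unfolding Y_def using card_ksets_trace[of "{1..s}" n "{1..t}" k] assms by simp
  ultimately show ?thesis
    by (simp add: shape_size_def of_nat_diff)
qed

lemma shape_size_le_EM:
  assumes "t < k" "t + 2 < n"
  shows "shape_size n k t (t + 2) \<le> int (card (EM n k (t + 2) (t + 1)))"
proof -
  have "t + 1 \<le> card (A \<inter> {1..t + 2})" if A: "A \<in> shape_family n k t (t + 2)" for A
  proof (cases "{1..t} \<subseteq> A \<and> A \<inter> {1..t + 2} \<noteq> {1..t}")
    case True
    then have "{1..t} \<subset> A \<inter> {1..t + 2}"
      by fastforce
    then have "card {1..t} < card (A \<inter> {1..t + 2})"
      by (intro psubset_card_mono) auto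
    then show ?thesis by simp
  next
    case False
    then obtain p where "p \<in> {1..t}" "A \<inter> {1..t + 2} = {1..t + 2} - {p}"
      using A unfolding shape_family_def by blast
    then show ?thesis
      by simp
  qed
  then have "shape_family n k t (t + 2) \<subseteq> EM n k (t + 2) (t + 1)"
    using assms by (auto simp: EM_def shape_family_def)
  moreover have "finite (EM n k (t + 2) (t + 1))"
    by (simp add: EM_def)
  ultimately have "card (shape_family n k t (t + 2)) \<le> card (EM n k (t + 2) (t + 1))"
    by (rule card_mono[rotated])
  then show ?thesis
    using card_shape_family[of t "t + 2" k n] assms by simp
qed

lemma shape_size_le_AK:
  assumes "t < k" "k < n"
  shows "shape_size n k t (k + 1) \<le> int (card (AK n k t))"
proof -
  have "A \<in> AK n k t" if A: "A \<in> shape_family n k t (k + 1)" for A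
  proof (cases "{1..t} \<subseteq> A \<and> A \<inter> {1..k + 1} \<noteq> {1..t}")
    case True
    then have "\<not> A \<inter> {1..k + 1} \<subseteq> {1..t}"
      using assms by fastforce
    then obtain q where "q \<in> A" "q \<in> {1..k + 1}" "q \<notin> {1..t}"
      by blast
    then have "q \<in> {t + 1..k + 1}"
      by simp
    with \<open>q \<in> A\<close> have "{t + 1..k + 1} \<inter> A \<noteq> {}"
      by blast
    then show ?thesis
      using True A by (auto simp: AK_def shape_family_def)
  next
    case False
    then obtain p where p: "A \<in> ksets n k" "p \<in> {1..t}" "A \<inter> {1..k + 1} = {1..k + 1} - {p}"
      using A unfolding shape_family_def by blast
    have "card ({1..k + 1} - {p}) = k"
      using p(2) assms by (subst card_Diff_singleton) auto
    then have "{1..k + 1} - {p} = A"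
      using p(3) ksetsD[OF p(1)] by (intro card_subset_eq) auto
    then show ?thesis
      using p(2) by (auto simp: AK_def)
  qed
  then have "shape_family n k t (k + 1) \<subseteq> AK n k t"
    by blast
  moreover have "finite (AK n k t)"
    by (simp add: AK_def)
  ultimately have "card (shape_family n k t (k + 1)) \<le> card (AK n k t)"
    by (rule card_mono[rotated])
  then show ?thesis
    using card_shape_family[of t "k + 1" k n] assms by simp
qed

text \<open>If no step before \<open>s\<close> is a rise, \<open>f s\<close> is at most
  \<open>f a\<close>; after the first rise \<open>f\<close> never falls again, and
  \<open>f s\<close> is at most \<open>f b\<close>.\<close>

lemma le_max_endpoints:
  fixes f :: "nat \<Rightarrow> int"
  assumes "a \<le> s" "s \<le> b"
    and step: "\<And>u. a \<le> u \<Longrightarrow> u + 2 \<le> b \<Longrightarrow> f u \<le> f (u + 1) \<Longrightarrow> f (u + 1) \<le> f (u + 2)"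
  shows "f s \<le> max (f a) (f b)"
proof (cases "\<exists>u. a \<le> u \<and> u < s \<and> f u \<le> f (u + 1)")
  case True
  then obtain u where u: "a \<le> u" "u < s" "f u \<le> f (u + 1)"
    by blast
  have inc: "w < b \<longrightarrow> f w \<le> f (Suc w)" if "u \<le> w" for w
    using that
  proof (induction w rule: dec_induct)
    case base
    then show ?case using u(3) by simp
  next
    case (step w)
    then show ?case using assms(3)[of w] u(1) by simp
  qed
  have "f s \<le> f w" if "s \<le> w" "w \<le> b" for w
    using that
  proof (induction w rule: dec_induct)
    case (step w)
    then show ?case using inc[of w] u(2) by simp
  qed simp
  then show ?thesis
    using assms(2) by (simp add: le_max_iff_disj)
next
  case False
  have "f w \<le> f a" if "a \<le> w" "w \<le> s" for w
    using that
  proof (induction w rule: dec_induct)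
    case (step w)
    then show ?case using False by fastforce
  qed simp
  then show ?thesis
    using assms(1) by (simp add: le_max_iff_disj)
qed

lemma shape_size_step:
  assumes "t < k" "t < s" "s \<le> k" "k < n"
  shows "shape_size n k t (s + 1) - shape_size n k t s =
    int ((n - s - 1) choose (k - t - 1)) - int t * int ((n - s - 1) choose (k + 1 - s))"
proof -
  have e: "n - s = Suc (n - s - 1)" "k - t = Suc (k - t - 1)" "k + 1 - s = Suc (k - s)"
    using assms by auto
  have "(n - s) choose (k - t) = ((n - s - 1) choose (k - t - 1)) + ((n - s - 1) choose (k - t))"
    by (subst (1) e(1), subst (1) e(2), subst binomial_Suc_Suc) (use e(2) in simp)
  moreover have "(n - s) choose (k + 1 - s) = ((n - s - 1) choose (k - s)) + ((n - s - 1) choose (k + 1 - s))"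
    by (subst (1) e(1), subst (1) e(3), subst binomial_Suc_Suc) (use e(3) in simp)
  ultimately show ?thesis
    by (simp add: shape_size_def algebra_simps)
qed

text \<open>The left side is multiplied by \<open>v / M\<close> and the right side by
  \<open>(M - u) / M\<close>, which is at least as large. This carries a nonnegative increment of
  \<open>shape_size\<close> to the next \<open>s\<close>.\<close>

lemma binomial_ratio_step:
  assumes "t * (M choose v) \<le> M choose u" "1 \<le> v" "v + u \<le> M"
  shows "t * ((M - 1) choose (v - 1)) \<le> (M - 1) choose u"
proof -
  have M: "0 < M"
    using assms by simp
  have "M * (t * ((M - 1) choose (v - 1))) = t * (v * (M choose v))"
    using binomial_absorption[of "v - 1" M] assms(2) by simp
  also have "\<dots> = v * (t * (M choose v))"
    by simp
  also have "\<dots> \<le> v * (M choose u)"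
    using assms(1) by (rule mult_le_mono2)
  also have "\<dots> \<le> (M - u) * (M choose u)"
    using assms(3) by (intro mult_le_mono1) simp
  also have "\<dots> = M * ((M - 1) choose u)"
    by (rule binomial_absorb_comp)
  finally show ?thesis
    using M by simp
qed

lemma shape_size_le_max:
  assumes "t < k" "k < n" "2 * k < n + t" "t + 2 \<le> s" "s \<le> k + 1"
  shows "shape_size n k t s \<le> max (shape_size n k t (t + 2)) (shape_size n k t (k + 1))"
proof (rule le_max_endpoints[OF assms(4,5)])
  fix u assume u: "t + 2 \<le> u" "u + 2 \<le> k + 1" "shape_size n k t u \<le> shape_size n k t (u + 1)"
  have "int (t * ((n - u - 1) choose (k + 1 - u))) \<le> int ((n - u - 1) choose (k - t - 1))"
    using shape_size_step[of t k u n] u assms by simp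
  then have "t * ((n - u - 1) choose (k + 1 - u)) \<le> (n - u - 1) choose (k - t - 1)"
    by (simp only: of_nat_le_iff)
  then have "t * ((n - u - 1 - 1) choose (k + 1 - u - 1)) \<le> (n - u - 1 - 1) choose (k - t - 1)"
    using u assms by (intro binomial_ratio_step) auto
  moreover have "n - u - 1 - 1 = n - (u + 1) - 1" "k + 1 - u - 1 = k + 1 - (u + 1)"
    by auto
  ultimately have "t * ((n - (u + 1) - 1) choose (k + 1 - (u + 1))) \<le> (n - (u + 1) - 1) choose (k - t - 1)"
    by simp
  then have "int t * int ((n - (u + 1) - 1) choose (k + 1 - (u + 1))) \<le> int ((n - (u + 1) - 1) choose (k - t - 1))"
    unfolding of_nat_mult[symmetric] of_nat_le_iff .
  moreover have "shape_size n k t ((u + 1) + 1) - shape_size n k t (u + 1) =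
      int ((n - (u + 1) - 1) choose (k - t - 1)) - int t * int ((n - (u + 1) - 1) choose (k + 1 - (u + 1)))"
    using u assms by (intro shape_size_step) auto
  ultimately show "shape_size n k t (u + 1) \<le> shape_size n k t (u + 2)"
    by (simp add: add.assoc)
qed

lemma binomial_descend:
  assumes "m \<le> a"
  shows "a choose Suc c \<le> ((a - m) choose Suc c) + m * ((a - 1) choose c)"
  using assms
proof (induction m)
  case (Suc m)
  have "a - m = Suc (a - Suc m)"
    using Suc.prems by simp
  then have "(a - m) choose Suc c = ((a - Suc m) choose c) + ((a - Suc m) choose Suc c)"
    by simp
  moreover have "(a - Suc m) choose c \<le> (a - 1) choose c"
    by (intro binomial_right_mono) simp
  ultimately show ?case
    using Suc by simp
qed simp

text \<open>This explains the case distinction in \<open>mnkt\<close>. With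
  \<open>c = k - t - 1\<close> the condition \<open>k \<le> 2 * t + 1\<close> reads
  \<open>c \<le> t\<close>, so the \<open>c\<close> terms from \<open>binomial_descend\<close> are
  paid for by \<open>t\<close> copies of \<open>a choose c\<close>.\<close>

lemma shape_size_AK_le_EM:
  assumes "t < k" "k \<le> 2 * t + 1" "2 * k + 2 \<le> n + t"
  shows "shape_size n k t (k + 1) \<le> shape_size n k t (t + 2)"
proof -
  obtain c where c: "k = t + Suc c"
    using assms(1) less_imp_Suc_add by fastforce
  define a where "a = n - (t + 2)"
  have a: "2 * c \<le> a" "n - (k + 1) = a - c"
    using assms(3) c by (auto simp: a_def)
  have "c * ((a - 1) choose c) + t \<le> t * (a choose c)"
  proof (cases c)
    case 0
    then show ?thesis by simp
  next
    case (Suc b)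
    have "a choose c = ((a - 1) choose b) + ((a - 1) choose c)"
      using Suc a(1) by (cases a) auto
    moreover have "1 \<le> (a - 1) choose b"
      using Suc a(1) by (simp add: Suc_le_eq)
    ultimately have "((a - 1) choose c) + 1 \<le> a choose c"
      by simp
    then have "t * (((a - 1) choose c) + 1) \<le> t * (a choose c)"
      by (rule mult_le_mono2)
    moreover have "c * ((a - 1) choose c) \<le> t * ((a - 1) choose c)"
      using assms(2) c by (intro mult_le_mono1) simp
    ultimately show ?thesis
      unfolding distrib_left by linarith
  qed
  moreover have "a choose Suc c \<le> ((a - c) choose Suc c) + c * ((a - 1) choose c)"
    using a(1) by (intro binomial_descend) simp
  ultimately have "(a choose Suc c) + t \<le> ((a - c) choose Suc c) + t * (a choose c)"
    by linarith
  then have "int (a choose Suc c) + int t \<le> int ((a - c) choose Suc c) + int t * int (a choose c)"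
    unfolding of_nat_mult[symmetric] of_nat_add[symmetric] of_nat_le_iff .
  then show ?thesis
    unfolding shape_size_def a(2) a_def[symmetric] using c by simp
qed

lemma shape_size_le_mnkt:
  assumes "t < k" "2 * k + 2 \<le> n + t" "t + 2 < n" "t + 2 \<le> s" "s \<le> k + 1"
  shows "shape_size n k t s \<le> int (mnkt n k t)"
proof -
  have "k < n"
    using assms(1,2) by simp
  note EM = shape_size_le_EM[OF assms(1,3)] and AK = shape_size_le_AK[OF assms(1) \<open>k < n\<close>]
  have max: "shape_size n k t s \<le> max (shape_size n k t (t + 2)) (shape_size n k t (k + 1))"
    using assms \<open>k < n\<close> by (intro shape_size_le_max) auto
  show ?thesis
  proof (cases "real t < (real k - 1) / 2")
    case True
    then show ?thesis
      using max EM AK by (auto simp: mnkt_def)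
  next
    case False
    then have "k \<le> 2 * t + 1"
      by simp
    then have "shape_size n k t (k + 1) \<le> shape_size n k t (t + 2)"
      using assms by (intro shape_size_AK_le_EM)
    then show ?thesis
      using max EM False by (auto simp: mnkt_def)
  qed
qed

lemma sum_shift_less:
  fixes H :: "nat set set"
  assumes H: "finite H" "\<And>A. A \<in> H \<Longrightarrow> finite A" and ij: "i < j" and ns: "\<not> stable i j H"
  shows "(\<Sum>A\<in>shift i j H. \<Sum>A) < (\<Sum>A\<in>H. \<Sum>A)"
proof -
  have less: "\<Sum>(insert i (A - {j})) < \<Sum>A" if "finite A" "j \<in> A" "i \<notin> A" for A
    using that ij sum.remove[OF that(1,2), of "\<lambda>x. x"] by simp
  have "(\<Sum>A\<in>shift i j H. \<Sum>A) = (\<Sum>A\<in>H. \<Sum>(shift_set i j H A))"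
    unfolding shift_def by (rule sum.reindex_cong[OF inj_on_shift_set]) auto
  also have "\<dots> < (\<Sum>A\<in>H. \<Sum>A)"
  proof (rule sum_strict_mono_ex1[OF H(1)])
    show "\<forall>A\<in>H. \<Sum>(shift_set i j H A) \<le> \<Sum>A"
      using less H(2) by (auto simp: shift_set_def less_imp_le)
    obtain A where A: "A \<in> H" "j \<in> A" "i \<notin> A" "insert i (A - {j}) \<notin> H"
      using ns by (auto simp: stable_def)
    then have "\<Sum>(shift_set i j H A) < \<Sum>A"
      using less[of A] H(2) by (simp add: shift_set_def)
    then show "\<exists>A\<in>H. \<Sum>(shift_set i j H A) < \<Sum>A"
      using A(1) by blast
  qed
  finally show ?thesis .
qed

theorem ahlswede_khachatrian_nontrivial:
  assumes H: "nontrivial_intersecting n k t H" and t: "1 \<le> t" and n: "(t + 1) * (k - t + 1) < n"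
  shows "card H \<le> mnkt n k t"
proof -
  let ?P = "nontrivial_intersecting n k t"
  have PD: "G \<subseteq> ksets n k" "t_intersecting t G" "\<not> trivial_family t G" if "?P G" for G
    using that by (auto simp: nontrivial_intersecting_def)
  have "\<forall>G. ?P G \<longrightarrow> card G < Suc (card (ksets n k))"
    using PD(1) by (auto intro!: le_imp_less_Suc card_mono)
  from ex_has_greatest_nat[of ?P, OF H this]
  obtain G0 where G0: "?P G0" "\<And>G. ?P G \<Longrightarrow> card G \<le> card G0"
    by blast
  \<comment> \<open>Among the extremal families, one with the least total of elements is chosen: a
    shift to smaller elements that keeps it nontrivial would lower the total.\<close>
  obtain G where G: "?P G" "card G = card G0"
    and min: "\<And>G'. ?P G' \<Longrightarrow> card G' = card G0 \<Longrightarrow> (\<Sum>A\<in>G. \<Sum>A) \<le> (\<Sum>A\<in>G'. \<Sum>A)"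
    using ex_has_least_nat[of "\<lambda>G. ?P G \<and> card G = card G0" G0 "\<lambda>G. \<Sum>A\<in>G. \<Sum>A"] G0(1) by blast
  have max: "card G' \<le> card G" if "?P G'" for G'
    using G0(2)[OF that] G(2) by simp
  have finG: "finite G" "\<And>A. A \<in> G \<Longrightarrow> finite A"
    using finite_subset[OF PD(1)[OF G(1)]] PD(1)[OF G(1)] ksetsD(3) by auto
  have tk: "t < k"
    by (rule t_less_k_of_nontrivial[OF PD[OF G(1)]])
  obtain d where d: "k = t + d" "0 < d"
    using tk less_imp_add_positive by blast
  have "1 * d \<le> t * d"
    using t by (intro mult_right_mono) auto
  moreover have "(t + 1) * (k - t + 1) = t * d + t + d + 1"
    using d by (simp add: algebra_simps)
  ultimately have n_ge: "2 * k + 2 \<le> n + t" "t + 2 < n"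
    using n d by linarith+
  have shape: "shape_size n k t s \<le> int (mnkt n k t)" if "t + 2 \<le> s" "s \<le> k + 1" for s
    by (rule shape_size_le_mnkt[OF tk n_ge that])
  have "card G \<le> mnkt n k t"
  proof (cases "\<exists>i j. 1 \<le> i \<and> i < j \<and> j \<le> n \<and> trivial_family t (shift i j G)")
    case True
    then obtain i j where ij: "1 \<le> i" "i < j" "j \<le> n" "trivial_family t (shift i j G)"
      by blast
    then have "card G + ((n - Suc k) choose (k - t)) \<le> ((n - t) choose (k - t)) + 1"
      using n_ge by (intro card_le_of_trivial_shift[OF PD[OF G(1)], of i j]) auto
    \<comment> \<open>The Hilton--Milner bound ends in \<open>+ 1\<close> and
      \<open>shape_size n k t (k + 1)\<close> in \<open>+ t\<close>.\<close>
    then have "int (card G) \<le> shape_size n k t (k + 1)"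
      using t by (simp add: shape_size_def)
    also have "\<dots> \<le> int (mnkt n k t)"
      using tk by (intro shape) auto
    finally show ?thesis by simp
  next
    case False
    have "stable i j G" if ij: "1 \<le> i" "i < j" "j \<le> n" for i j
    proof (rule ccontr)
      assume ns: "\<not> stable i j G"
      have "?P (shift i j G)"
        using False ij ksets_shift[OF PD(1)[OF G(1)], of i j]
          t_intersecting_shift[OF PD(1,2)[OF G(1)], of i j] by (auto simp: nontrivial_intersecting_def)
      then show False
        using min[of "shift i j G"] sum_shift_less[OF finG ij(2) ns] G(2) by simp
    qed
    then interpret extremal_compressed n k t G
      using G(1) max t n by unfold_locales auto
    show ?thesis
    proof (cases "width \<le> t + 2")
      case True
      have "G \<subseteq> EM n k (t + 2) (t + 1)"
        using F_subset_small_width[OF True] F_ksets tk by (auto simp: EM_def)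
      moreover have "finite (EM n k (t + 2) (t + 1))"
        by (simp add: EM_def)
      ultimately have "card G \<le> card (EM n k (t + 2) (t + 1))"
        by (rule card_mono[rotated])
      then show ?thesis
        by (auto simp: mnkt_def)
    next
      case wide: False
      then have "shape_bound"
        using width_dichotomy by simp
      then have b: "width \<le> k + 1"
        "card G + ((n - width) choose (k - t)) \<le> ((n - t) choose (k - t)) + t * ((n - width) choose (k + 1 - width))"
        by (auto simp: shape_bound_def)
      have "int (card G) + int ((n - width) choose (k - t))
          \<le> int ((n - t) choose (k - t)) + int t * int ((n - width) choose (k + 1 - width))"
        using b(2) unfolding of_nat_mult[symmetric] of_nat_add[symmetric] of_nat_le_iff .
      then have "int (card G) \<le> shape_size n k t width"
        by (simp add: shape_size_def)
      also have "\<dots> \<le> int (mnkt n k t)"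
        using wide b(1) by (intro shape) auto
      finally show ?thesis by simp
    qed
  qed
  then show ?thesis
    using max[OF H] by simp
qed

section \<open>Shadows of stars\<close>

lemma card_Sigma_by_card:
  assumes "finite T" "finite D" "\<And>c. finite (g c)"
  shows "card (Sigma {S. S \<subseteq> T \<and> card S \<in> D} (\<lambda>S. g (card S))) = (\<Sum>i\<in>D. (card T choose i) * card (g i))"
proof -
  let ?P = "{S. S \<subseteq> T \<and> card S \<in> D}"
  have "finite ?P"
    using assms(1) by simp
  then have "card (Sigma ?P (\<lambda>S. g (card S))) = (\<Sum>S\<in>?P. card (g (card S)))"
    using assms(3) by (intro card_SigmaI) auto
  also have "\<dots> = (\<Sum>i\<in>D. \<Sum>S\<in>{S \<in> ?P. card S = i}. card (g (card S)))"
    using \<open>finite ?P\<close> assms(2) by (intro sum.group[symmetric]) auto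
  also have "\<dots> = (\<Sum>i\<in>D. (card T choose i) * card (g i))"
  proof (rule sum.cong[OF refl])
    fix i assume "i \<in> D"
    then have "{S \<in> ?P. card S = i} = {S. S \<subseteq> T \<and> card S = i}"
      by auto
    then show "(\<Sum>S\<in>{S \<in> ?P. card S = i}. card (g (card S))) = (card T choose i) * card (g i)"
      using n_subsets[OF assms(1), of i] by simp
  qed
  finally show ?thesis .
qed

text \<open>Since \<open>T\<close> lies in every member, any subset of \<open>T\<close> can be
  combined with any set below a member of the stripped family, so traces on and off \<open>T\<close>
  are independent once the sizes add up to \<open>k - l\<close>.\<close>

lemma card_shadow_star:
  assumes H: "H \<subseteq> ksets n k" and T: "finite T" "T \<subseteq> {1..n}" "\<And>A. A \<in> H \<Longrightarrow> T \<subseteq> A"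
  shows "card (shadow n k l H) = (\<Sum>i\<le>k - l. (card T choose i) * card (shad (k - l - i) ((\<lambda>A. A - T) ` H)))"
proof -
  let ?G = "(\<lambda>A. A - T) ` H"
  let ?D = "Sigma {S. S \<subseteq> T \<and> card S \<in> {..k - l}} (\<lambda>S. shad (k - l - card S) ?G)"
  have HA: "A \<subseteq> {1..n}" "finite A" if "A \<in> H" for A
    using ksetsD[of A n k] H that by auto
  have "bij_betw (\<lambda>A. (A \<inter> T, A - T)) (shadow n k l H) ?D"
  proof (rule bij_betw_byWitness[where f' = "\<lambda>(S, B). S \<union> B"])
    show "\<forall>A\<in>shadow n k l H. (case (A \<inter> T, A - T) of (S, B) \<Rightarrow> S \<union> B) = A"
      by auto
    show "\<forall>SB\<in>?D. ((case SB of (S, B) \<Rightarrow> S \<union> B) \<inter> T, (case SB of (S, B) \<Rightarrow> S \<union> B) - T) = SB"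
      by (auto simp: shad_def)
    show "(\<lambda>A. (A \<inter> T, A - T)) ` shadow n k l H \<subseteq> ?D"
    proof (rule image_subsetI)
      fix A assume "A \<in> shadow n k l H"
      then obtain B where A: "A \<subseteq> {1..n}" "card A = k - l" "B \<in> H" "A \<subseteq> B"
        by (auto simp: shadow_def ksets_def)
      have fin: "finite A"
        using A(1) finite_subset by auto
      have "card (A \<inter> T) \<le> k - l"
        using card_mono[OF fin, of "A \<inter> T"] A(2) by simp
      moreover have "card (A - T) = k - l - card (A \<inter> T)"
        using card_Diff_subset_Int[of A T] fin A(2) by simp
      moreover have "A - T \<subseteq> B - T"
        using A(4) by blast
      ultimately show "(A \<inter> T, A - T) \<in> ?D"
        using A(3) fin by (auto intro!: shadI)
    qed
    show "(\<lambda>(S, B). S \<union> B) ` ?D \<subseteq> shadow n k l H"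
    proof (rule image_subsetI)
      fix SB assume "SB \<in> ?D"
      then obtain S B A where SB: "SB = (S, B)" "S \<subseteq> T" "card S \<le> k - l" "finite B"
        "card B = k - l - card S" "A \<in> H" "B \<subseteq> A - T"
        by (auto simp: shad_def)
      have "finite S"
        using SB(2) T(1) by (rule finite_subset)
      then have "card (S \<union> B) = k - l"
        using SB by (subst card_Un_disjoint) auto
      moreover have "S \<union> B \<subseteq> A"
        using SB T(3) by blast
      moreover have "S \<union> B \<subseteq> {1..n}"
        using \<open>S \<union> B \<subseteq> A\<close> HA(1)[OF SB(6)] by blast
      ultimately show "(case SB of (S, B) \<Rightarrow> S \<union> B) \<in> shadow n k l H"
        using SB(1,6) by (auto simp: shadow_def ksets_def)
    qed
  qed
  then have "card (shadow n k l H) = card ?D"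
    by (rule bij_betw_same_card)
  also have "\<dots> = (\<Sum>i\<in>{..k - l}. (card T choose i) * card (shad (k - l - i) ?G))"
  proof (rule card_Sigma_by_card[OF T(1)])
    show "finite (shad (k - l - c) ?G)" for c
      using HA(1) by (intro finite_shad[of "{1..n}"]) auto
  qed simp
  finally show ?thesis .
qed

section \<open>Colex segments of the full star\<close>

lemma card_rank_less:
  assumes "finite F" "inj_on w F"
  shows "card {A \<in> F. card {B \<in> F. w B < (w A :: nat)} < m} \<le> m"
proof -
  have mono: "card {B \<in> F. w B < w A} < card {B \<in> F. w B < w A'}" if "A \<in> F" "A' \<in> F" "w A < w A'" for A A'
    using that assms(1) by (intro psubset_card_mono) auto
  have "inj_on (\<lambda>A. card {B \<in> F. w B < w A}) {A \<in> F. card {B \<in> F. w B < w A} < m}"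
  proof (rule inj_onI)
    fix A A' assume A: "A \<in> {A \<in> F. card {B \<in> F. w B < w A} < m}" "A' \<in> {A \<in> F. card {B \<in> F. w B < w A} < m}"
      and eq: "card {B \<in> F. w B < w A} = card {B \<in> F. w B < w A'}"
    then have "w A = w A'"
      using mono[of A A'] mono[of A' A] by (cases "w A" "w A'" rule: linorder_cases) auto
    then show "A = A'"
      using A assms(2) by (auto dest: inj_onD)
  qed
  then have "card {A \<in> F. card {B \<in> F. w B < w A} < m} \<le> card {..<m}"
    by (rule card_inj_on_le) auto
  then show ?thesis by simp
qed

lemma Lcolex_eq_weight:
  assumes "F \<subseteq> ksets n k"
  shows "Lcolex m F = {A \<in> F. card {B \<in> F. colex_weight B < colex_weight A} < m}"
proof -
  have "{B \<in> F. colex_less B A} = {B \<in> F. colex_weight B < colex_weight A}" if "A \<in> F" for A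
  proof -
    have fin: "finite B" if "B \<in> F" for B
      using that assms ksetsD(3) by blast
    then show ?thesis
      using colex_less_iff_weight[OF fin fin[OF that]] by blast
  qed
  then show ?thesis
    by (auto simp: Lcolex_def)
qed

lemma card_Lcolex_le:
  assumes "F \<subseteq> ksets n k"
  shows "card (Lcolex m F) \<le> m"
proof -
  have "finite F"
    by (rule finite_subset[OF assms]) simp
  moreover have "F \<subseteq> {A. finite A}"
    using assms ksetsD(3) by auto
  then have "inj_on colex_weight F"
    by (rule inj_on_subset[OF inj_on_colex_weight])
  ultimately show ?thesis
    unfolding Lcolex_eq_weight[OF assms] by (rule card_rank_less)
qed

lemma EM_star:
  assumes "t \<le> k" "t < n"
  shows "EM n k t t = {A \<in> ksets n k. {1..t} \<subseteq> A}"
proof -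
  have "t \<le> card (A \<inter> {1..t}) \<longleftrightarrow> {1..t} \<subseteq> A" for A
  proof
    assume "t \<le> card (A \<inter> {1..t})"
    then have "A \<inter> {1..t} = {1..t}"
      by (intro card_seteq) auto
    then show "{1..t} \<subseteq> A" by blast
  qed (simp add: Int_absorb1)
  then show ?thesis
    using assms by (simp add: EM_def)
qed

text \<open>Removing the common part \<open>{1..t}\<close> preserves colex comparison, and a set
  below one contained in \<open>{1..n}\<close> is itself contained in \<open>{1..n}\<close>; so the
  segment is initial also in the unbounded ground set.\<close>

lemma colex_initial_Lcolex_star:
  assumes "t \<le> k" "t < n"
  shows "colex_initial (Suc t) (k - t) ((\<lambda>A. A - {1..t}) ` Lcolex m (EM n k t t))"
proof -
  define S where "S = EM n k t t"
  have S: "S = {A \<in> ksets n k. {1..t} \<subseteq> A}" "S \<subseteq> ksets n k"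
    using EM_star[OF assms] by (auto simp: S_def)
  have finS: "finite S"
    by (rule finite_subset[OF S(2)]) simp
  have LS: "A \<in> S" if "A \<in> Lcolex m S" for A
    using that by (simp add: Lcolex_def)
  have bounds: "finite (A - {1..t})" "A - {1..t} \<subseteq> {Suc t..}" "card (A - {1..t}) = k - t" if "A \<in> S" for A
    using that ksetsD[of A n k] by (auto simp: S(1) card_Diff_subset)
  show ?thesis
    unfolding S_def[symmetric] colex_initial_def
  proof (intro conjI ballI allI impI subsetI)
    fix A0 assume "A0 \<in> (\<lambda>A. A - {1..t}) ` Lcolex m S"
    then obtain A where A: "A \<in> Lcolex m S" "A0 = A - {1..t}"
      by blast
    show "A0 \<in> {A. finite A \<and> A \<subseteq> {Suc t..} \<and> card A = k - t}"
      using bounds[OF LS[OF A(1)]] A(2) by simp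
    fix B assume B: "finite B \<and> B \<subseteq> {Suc t..} \<and> card B = k - t \<and> colex_less B A0"
    have AK: "A \<in> ksets n k" "{1..t} \<subseteq> A"
      using LS[OF A(1)] by (auto simp: S(1))
    note K = ksetsD[OF AK(1)]
    have finA0: "finite A0"
      using K(3) A(2) by simp
    obtain u where u: "u \<in> A0" "u \<notin> B" "\<And>x. x > u \<Longrightarrow> x \<in> B \<longleftrightarrow> x \<in> A0"
      using colex_lessE[of B A0] B finA0 by metis
    let ?B = "B \<union> {1..t}"
    have "u \<le> n"
      using u(1) A(2) K(1) by auto
    have "x \<le> n" if "x \<in> B" for x
    proof (cases "x > u")
      case True
      then show ?thesis using that u(3) A(2) K(1) by auto
    next
      case False
      then show ?thesis using \<open>u \<le> n\<close> by simp
    qed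
    then have "?B \<subseteq> {1..n}"
      using B assms(2) by fastforce
    moreover have "B \<inter> {1..t} = {}"
      using B by fastforce
    then have "card ?B = k"
      using B assms(1) by (subst card_Un_disjoint) auto
    ultimately have BS: "?B \<in> S"
      by (simp add: S(1) ksets_def)
    have "u \<notin> {1..t}"
      using u(1) A(2) by blast
    then have "\<exists>m. m \<in> A \<and> m \<notin> ?B \<and> (\<forall>x>m. x \<in> ?B \<longleftrightarrow> x \<in> A)"
      using u A(2) AK(2) by (intro exI[of _ u]) blast
    then have "colex_less ?B A"
      using B K(3) by (subst colex_less_iff) auto
    then have less: "colex_weight ?B < colex_weight A"
      using B K(3) by (intro colex_weight_less) auto
    then have "card {X \<in> S. colex_weight X < colex_weight ?B} \<le> card {X \<in> S. colex_weight X < colex_weight A}"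
      using finS by (intro card_mono) auto
    then have "?B \<in> Lcolex m S"
      using A(1) BS unfolding Lcolex_eq_weight[OF S(2)] by simp
    moreover have "B = ?B - {1..t}"
      using \<open>B \<inter> {1..t} = {}\<close> by blast
    ultimately show "B \<in> (\<lambda>A. A - {1..t}) ` Lcolex m S"
      by (rule rev_image_eqI)
  qed
qed

lemma star_link:
  assumes H: "H \<subseteq> ksets n k" and T: "finite T" "\<And>A. A \<in> H \<Longrightarrow> T \<subseteq> A"
  shows "(\<lambda>A. A - T) ` H \<subseteq> {A. A \<subseteq> {1..n} - T \<and> card A = k - card T}"
    "card ((\<lambda>A. A - T) ` H) = card H"
proof -
  show "(\<lambda>A. A - T) ` H \<subseteq> {A. A \<subseteq> {1..n} - T \<and> card A = k - card T}"
  proof (rule image_subsetI)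
    fix A assume "A \<in> H"
    then show "A - T \<in> {A. A \<subseteq> {1..n} - T \<and> card A = k - card T}"
      using ksetsD[of A n k] H T by (auto simp: card_Diff_subset)
  qed
  have "inj_on (\<lambda>A. A - T) H"
    using T(2) by (intro inj_onI) blast
  then show "card ((\<lambda>A. A - T) ` H) = card H"
    by (rule card_image)
qed

theorem theorem1p6:
  fixes n k t l m :: nat and H :: "nat set set"
  assumes "t \<ge> 1" and "k \<ge> 3" and "1 \<le> l" and "l < k"
    and "int n > (int t + 1) * (int k - int t + 1)"
    and "H \<subseteq> ksets n k" and "t_intersecting t H"
    and "card H = m" and "m > mnkt n k t"
  shows "card (shadow n k l H) \<ge> card (shadow n k l (Lcolex m (EM n k t t)))
     \<and> (\<forall>x::real. real m = (x - real t) gchoose (k - t) \<longrightarrow>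
          real (card (shadow n k l H)) \<ge>
            (\<Sum>i\<in>{int t - int l .. int k - int l}.
               (if i < 0 then 0 else real (t choose nat i))
               * ((x - real t) gchoose nat (int k - int l - i))))"
proof -
  have m: "1 \<le> m" and "H \<noteq> {}"
    using assms(8,9) by auto
  then obtain A0 where A0: "A0 \<in> H"
    by blast
  have A0k: "A0 \<subseteq> {1..n}" "card A0 = k"
    using ksetsD[of A0 n k] A0 assms(6) by auto
  have tk: "t \<le> k"
    using assms(7) A0 A0k(2) unfolding t_intersecting_def by (metis Int_absorb)
  have "int ((t + 1) * (k - t + 1)) = (int t + 1) * (int k - int t + 1)"
  proof -
    obtain d where "k = t + d"
      using tk le_Suc_ex by blast
    then show ?thesis by (simp add: algebra_simps)
  qed
  then have n: "(t + 1) * (k - t + 1) < n"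
    using assms(5) by (simp only: of_nat_less_iff[symmetric, where 'a = int])
  have tn: "t < n"
    using n by simp
  have "trivial_family t H"
    using ahlswede_khachatrian_nontrivial[of n k t H] assms(1,6-9) n
    by (fastforce simp: nontrivial_intersecting_def)
  then obtain T where T: "finite T" "card T = t" "\<And>A. A \<in> H \<Longrightarrow> T \<subseteq> A"
    by (auto simp: trivial_family_def)
  have Tn: "T \<subseteq> {1..n}"
    using T(3)[OF A0] A0k(1) by blast
  define G where "G = (\<lambda>A. A - T) ` H"
  have G: "G \<subseteq> {A. A \<subseteq> {1..n} - T \<and> card A = k - t}" "card G = m"
    using star_link[OF assms(6) T(1,3)] T(2) assms(8) by (auto simp: G_def)
  have shH: "card (shadow n k l H) = (\<Sum>i\<le>k - l. (t choose i) * card (shad (k - l - i) G))"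
    using card_shadow_star[OF assms(6) T(1) Tn T(3), of l] T(2) by (simp add: G_def)
  define L where "L = Lcolex m (EM n k t t)"
  define C where "C = (\<lambda>A. A - {1..t}) ` L"
  have E: "EM n k t t \<subseteq> ksets n k" "\<And>A. A \<in> L \<Longrightarrow> {1..t} \<subseteq> A"
    using EM_star[OF tk tn] by (auto simp: L_def Lcolex_def)
  have L: "L \<subseteq> ksets n k"
    using E(1) by (auto simp: L_def Lcolex_def)
  have C: "finite C" "card C \<le> m" "colex_initial (Suc t) (k - t) C"
  proof -
    show "finite C"
      unfolding C_def by (intro finite_imageI finite_subset[OF L]) simp
    show "card C \<le> m"
      using star_link(2)[OF L _ E(2)] card_Lcolex_le[OF E(1), of m] by (simp add: C_def L_def)
    show "colex_initial (Suc t) (k - t) C"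
      unfolding C_def L_def by (rule colex_initial_Lcolex_star[OF tk tn])
  qed
  have shL: "card (shadow n k l L) = (\<Sum>i\<le>k - l. (t choose i) * card (shad (k - l - i) C))"
    using card_shadow_star[OF L, of "{1..t}" l] E(2) tn by (simp add: C_def)
  \<comment> \<open>The same segment \<open>C\<close> is optimal for every \<open>i\<close>, so the
    sums compare term by term.\<close>
  have "card (shadow n k l L) \<le> card (shadow n k l H)"
    unfolding shH shL using C G by (intro sum_mono mult_le_mono2 kruskal_katona[OF _ G(1)]) auto
  moreover have "(\<Sum>i\<in>{int t - int l .. int k - int l}. (if i < 0 then 0 else real (t choose nat i))
      * ((x - real t) gchoose nat (int k - int l - i))) \<le> real (card (shadow n k l H))"
    if x: "real m = (x - real t) gchoose (k - t)" for x :: real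
  proof -
    define y where "y = x - real t"
    have bound: "y gchoose j \<le> real (card (shad j G))" if j: "j \<le> k - t" for j
    \<comment> \<open>The reflection needs a positive lower index; for \<open>k = t\<close> the only
      level is 0.\<close>
    proof (cases "k - t = 0")
      case True
      then have "j = 0" "G \<noteq> {}"
        using j G(2) m by auto
      then show ?thesis by (simp add: shad_0)
    next
      case False
      have "1 \<le> k - t" "1 \<le> y gchoose (k - t)"
        using False x m by (auto simp: y_def)
      then obtain z where z: "real (k - t) \<le> z" "z gchoose (k - t) = y gchoose (k - t)"
        "\<And>j. j \<le> k - t \<Longrightarrow> y gchoose j \<le> z gchoose j"
        by (rule gbinomial_reflect) blast
      have "z gchoose j \<le> real (card (shad j G))"
        using z(1,2) x G(2) j by (intro lovasz_shadow[OF _ G(1)]) (auto simp: y_def)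
      then show ?thesis
        using z(3)[OF j] by simp
    qed
    let ?g = "\<lambda>i. real (t choose i) * real (card (shad (k - l - i) G))"
    \<comment> \<open>The index is negative for some terms when \<open>l > t\<close>, and these
      vanish. From \<open>i \<ge> t - l\<close> follows \<open>k - l - i \<le> k - t\<close>, the
      range in which \<open>bound\<close> holds.\<close>
    let ?h = "\<lambda>i. (if i < 0 then 0 else real (t choose nat i)) * (y gchoose nat (int k - int l - i))"
    have "(\<Sum>i\<in>{int t - int l .. int k - int l}. ?h i)
        \<le> (\<Sum>i\<in>{int t - int l .. int k - int l}. if i < 0 then 0 else ?g (nat i))"
    proof (rule sum_mono)
      fix i assume i: "i \<in> {int t - int l .. int k - int l}"
      show "?h i \<le> (if i < 0 then 0 else ?g (nat i))"
      proof (cases "i < 0")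
        case False
        then have "nat (int k - int l - i) = k - l - nat i" "k - l - nat i \<le> k - t"
          using i by auto
        then show ?thesis
          using False bound by (simp add: mult_left_mono)
      qed simp
    qed
    also have "\<dots> = (\<Sum>i\<in>{i \<in> {int t - int l .. int k - int l}. 0 \<le> i}. ?g (nat i))"
      by (rule sum.mono_neutral_cong_right) auto
    also have "\<dots> \<le> (\<Sum>i\<in>int ` {..k - l}. ?g (nat i))"
    proof (rule sum_mono2)
      show "{i \<in> {int t - int l .. int k - int l}. 0 \<le> i} \<subseteq> int ` {..k - l}"
      proof
        fix i assume "i \<in> {i \<in> {int t - int l .. int k - int l}. 0 \<le> i}"
        then show "i \<in> int ` {..k - l}"
          by (intro image_eqI[of _ _ "nat i"]) auto
      qed
    qed auto
    also have "\<dots> = (\<Sum>i\<le>k - l. ?g i)"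
      by (subst sum.reindex) (auto simp: inj_on_def)
    also have "\<dots> = real (card (shadow n k l H))"
      by (simp add: shH)
    finally show ?thesis
      by (simp add: y_def)
  qed
  ultimately show ?thesis
    by (simp add: L_def)
qed

end
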